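(* Let $1\le p\le\infty$, $0\le\gamma\le1$ and $F\in L^p(0,T;\mathcal D((-L)^\gamma))$, where $1/p=0$ if $p=\infty$. Consider the initial-boundary value problem with vanishing initial value $$\sum_{j=1}^m q_j\partial_t^{\alpha_j}u(x,t)=Lu(x,t)+F(x,t)\ (x\in\Omega,\ 0<t\le T),\quad u(x,t)=0\ (x\in\partial\Omega,\ 0<t\le T),\quad u(x,0)=0\ (x\in\Omega).$$ Then: (a) If $p=2$, there exists a unique solution $u\in L^2(0,T;\mathcal D((-L)^{\gamma+1}))$. Moreover, there exists a constant $C>0$, independent of $F$, such that $$\|u\|_{L^2(0,T;\mathcal D((-L)^{\gamma+1}))}\le C\|F\|_{L^2(0,T;\mathcal D((-L)^\gamma))}.$$ (b) If $p\ne2$, there exists a unique solution $u\in L^p(0,T;\mathcal D((-L)^{\gamma+1-\tau}))$ for any $\tau\in(0,1]$. Moreover, there exists a constant $C>0$, independent of $F$ and $\tau$, such that $$\|u\|_{L^p(0,T;\mathcal D((-L)^{\gamma+1-\tau}))}\le\frac C\tau\|F\|_{L^p(0,T;\mathcal D((-L)^\gamma))}.$$ (c) If $\alpha_1p>1$, then for any $\tau\in(\frac1{\alpha_1p},1]$ there holds $$\lim_{t\to0}\|u(\cdot,t)\|_{\mathcal D((-L)^{\gamma+1-\tau})}=0.$$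
   Context: $\Omega\subset\mathbb R^d$ is a bounded domain with smooth boundary (for example of class $C^2$), $T>0$ is fixed, $m$ is a positive integer, and $\alpha_j,q_j$ ($j=1,\dots,m$) are positive constants with $1>\alpha_1>\cdots>\alpha_m>0$ and $q_1=1$. For $0<\beta<1$ the Caputo derivative is $\partial_t^\beta f(t)=\frac1{\Gamma(1-\beta)}\int_0^t\frac{f'(s)}{(t-s)^\beta}\,ds$. The operator $L$ is defined on $\mathcal D(-L)=H^2(\Omega)\cap H^1_0(\Omega)$ by $Lf=\sum_{i,j=1}^d\partial_j(a_{ij}(x)\partial_if)+c(x)f$, where $a_{ij}=a_{ji}\in C^1(\overline\Omega)$, $c\in C(\overline\Omega)$, $c\le0$ in $\overline\Omega$, and there is $\delta>0$ with $\delta\sum_{i}\xi_i^2\le\sum_{i,j}a_{ij}(x)\xi_i\xi_j$ for all $x\in\overline\Omega$, $\xi\in\mathbb R^d$. Let $\{\lambda_n,\varphi_n\}_{n\ge1}$ be the eigensystem of $-L$: $0<\lambda_1<\lambda_2\le\cdots$, $\lambda_n\to\infty$, and $\{\varphi_n\}\subset H^2(\Omega)\cap H^1_0(\Omega)$ is an orthonormal basis of $L^2(\Omega)$, whose inner product is $(\cdot,\cdot)$. For $\gamma\ge0$, $\mathcal D((-L)^\gamma)=\{f\in L^2(\Omega):\sum_n|\lambda_n^\gamma(f,\varphi_n)|^2<\infty\}$ with norm $\|f\|_{\mathcal D((-L)^\gamma)}=\big(\sum_n|\lambda_n^\gamma(f,\varphi_n)|^2\big)^{1/2}$. A solution is understood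 through eigenfunction expansion: $u$ is a solution if, for every $n$, the coefficient $u_n(t)=(u(\cdot,t),\varphi_n)$ solves $\sum_{j=1}^mq_j\partial_t^{\alpha_j}u_n+\lambda_nu_n=(F(\cdot,t),\varphi_n)$, $u_n(0)=0$. Since $u_n$ need not be differentiable when $F$ is only $L^p$ in time, this scalar problem is taken in integrated form: $u_n\in L^1(0,T)$ and, for almost every $t\in(0,T)$, $$\sum_{j=1}^m\frac{q_j}{\Gamma(1-\alpha_j)}\int_0^t(t-s)^{-\alpha_j}u_n(s)\,ds+\lambda_n\int_0^tu_n(s)\,ds=\int_0^t(F(\cdot,s),\varphi_n)\,ds.$$ Functions are identified when equal for almost every $t$; the limit in (c) refers to a suitable representative of $u$. *)

theory Defs
  imports "HOL-Analysis.Analysis" "HOL-Probability.Essential_Supremum"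
begin

definition partial_deriv :: "'d::finite \<Rightarrow> (real^'d \<Rightarrow> real) \<Rightarrow> real^'d \<Rightarrow> real" where
  "partial_deriv i f x = frechet_derivative f (at x) (axis i 1)"

text \<open>The class \<open>C\<^sup>k(U)\<close>, meant for open \<open>U\<close>.\<close>

primrec Ck_on :: "nat \<Rightarrow> (real^'d::finite) set \<Rightarrow> (real^'d \<Rightarrow> real) \<Rightarrow> bool" where
  "Ck_on 0 U f \<longleftrightarrow> continuous_on U f"
| "Ck_on (Suc k) U f \<longleftrightarrow>
     (\<forall>x\<in>U. f differentiable (at x)) \<and> (\<forall>i. Ck_on k U (partial_deriv i f))"

text \<open>\<open>C\<^sup>1\<close> up to the boundary: the function and its first partial derivatives, taken in the open
  set, extend continuously to the closure.\<close>

definition C1_closure :: "(real^'d::finite) set \<Rightarrow> (real^'d \<Rightarrow> real) \<Rightarrow> bool" where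
  "C1_closure \<Omega> f \<longleftrightarrow> continuous_on (closure \<Omega>) f \<and> (\<forall>x\<in>\<Omega>. f differentiable (at x)) \<and>
     (\<forall>i. \<exists>g. continuous_on (closure \<Omega>) g \<and> (\<forall>x\<in>\<Omega>. g x = partial_deriv i f x))"

text \<open>Near each boundary point the set lies, up to relabelling (\<open>i\<close>) and reorienting (\<open>\<sigma>\<close>) the
  coordinate axes, on one side of the graph of a \<open>C\<^sup>k\<close> function of the other \<open>d - 1\<close> coordinates.
  Such a function is represented by \<open>h\<close> on the whole space that does not depend on the
  \<open>i\<close>-th coordinate.\<close>

definition Ck_boundary :: "nat \<Rightarrow> (real^'d::finite) set \<Rightarrow> bool" where
  "Ck_boundary k \<Omega> \<longleftrightarrow>
     (\<forall>z\<in>frontier \<Omega>. \<exists>r>0. \<exists>i. \<exists>\<sigma>\<in>{1, -1}. \<exists>h.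
        Ck_on k UNIV h \<and> (\<forall>x y. (\<forall>j. j \<noteq> i \<longrightarrow> x $ j = y $ j) \<longrightarrow> h x = h y) \<and>
        \<Omega> \<inter> ball z r = {x \<in> ball z r. \<sigma> * (x $ i) > h x})"

definition smooth_bounded_domain :: "(real^'d::finite) set \<Rightarrow> bool" where
  "smooth_bounded_domain \<Omega> \<longleftrightarrow>
     open \<Omega> \<and> connected \<Omega> \<and> \<Omega> \<noteq> {} \<and> bounded \<Omega> \<and> Ck_boundary 2 \<Omega>"

text \<open>Elements of function spaces over \<open>\<Omega>\<close> are represented by functions on the whole space; only
  their values almost everywhere in \<open>\<Omega>\<close> matter.\<close>

definition L2_space :: "(real^'d::finite) set \<Rightarrow> (real^'d \<Rightarrow> real) set" where
  "L2_space \<Omega> = {f. f \<in> borel_measurable (lebesgue_on \<Omega>) \<and>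
                     integrable (lebesgue_on \<Omega>) (\<lambda>x. (f x)\<^sup>2)}"

definition L2_inner :: "(real^'d::finite) set \<Rightarrow> (real^'d \<Rightarrow> real) \<Rightarrow> (real^'d \<Rightarrow> real) \<Rightarrow> real" where
  "L2_inner \<Omega> f g = (LINT x|lebesgue_on \<Omega>. f x * g x)"

definition L2_norm :: "(real^'d::finite) set \<Rightarrow> (real^'d \<Rightarrow> real) \<Rightarrow> real" where
  "L2_norm \<Omega> f = sqrt (L2_inner \<Omega> f f)"

definition test_functions :: "(real^'d::finite) set \<Rightarrow> (real^'d \<Rightarrow> real) set" where
  "test_functions \<Omega> = {\<psi>. (\<forall>k. Ck_on k UNIV \<psi>) \<and>
     compact (closure {x. \<psi> x \<noteq> 0}) \<and> closure {x. \<psi> x \<noteq> 0} \<subseteq> \<Omega>}"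

definition has_weak_pderiv ::
  "(real^'d::finite) set \<Rightarrow> 'd \<Rightarrow> (real^'d \<Rightarrow> real) \<Rightarrow> (real^'d \<Rightarrow> real) \<Rightarrow> bool" where
  "has_weak_pderiv \<Omega> i f g \<longleftrightarrow> f \<in> L2_space \<Omega> \<and> g \<in> L2_space \<Omega> \<and>
     (\<forall>\<psi>\<in>test_functions \<Omega>. L2_inner \<Omega> f (partial_deriv i \<psi>) = - L2_inner \<Omega> g \<psi>)"

definition weak_pderiv ::
  "(real^'d::finite) set \<Rightarrow> 'd \<Rightarrow> (real^'d \<Rightarrow> real) \<Rightarrow> (real^'d \<Rightarrow> real)" where
  "weak_pderiv \<Omega> i f = (SOME g. has_weak_pderiv \<Omega> i f g)"

definition H1_space :: "(real^'d::finite) set \<Rightarrow> (real^'d \<Rightarrow> real) set" where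
  "H1_space \<Omega> = {f \<in> L2_space \<Omega>. \<forall>i. \<exists>g\<in>L2_space \<Omega>. has_weak_pderiv \<Omega> i f g}"

definition H2_space :: "(real^'d::finite) set \<Rightarrow> (real^'d \<Rightarrow> real) set" where
  "H2_space \<Omega> = {f \<in> L2_space \<Omega>. \<forall>i. \<exists>g\<in>H1_space \<Omega>. has_weak_pderiv \<Omega> i f g}"

definition H10_space :: "(real^'d::finite) set \<Rightarrow> (real^'d \<Rightarrow> real) set" where
  "H10_space \<Omega> = {f \<in> H1_space \<Omega>. \<exists>\<psi>::nat \<Rightarrow> real^'d \<Rightarrow> real.
     (\<forall>k. \<psi> k \<in> test_functions \<Omega>) \<and>
     (\<lambda>k. L2_norm \<Omega> (\<lambda>x. \<psi> k x - f x)) \<longlonglongrightarrow> 0 \<and>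
     (\<forall>i. (\<lambda>k. L2_norm \<Omega> (\<lambda>x. partial_deriv i (\<psi> k) x - weak_pderiv \<Omega> i f x)) \<longlonglongrightarrow> 0)}"

text \<open>The choice operator in \<open>weak_pderiv\<close> is harmless: weak derivatives are unique up to null sets,
  and those below exist for \<open>f\<close> in \<open>H\<^sup>2(\<Omega>)\<close> and \<open>a i j\<close> of class \<open>C\<^sup>1\<close> up to the boundary.\<close>

definition elliptic_op :: "(real^'d::finite) set \<Rightarrow> ('d \<Rightarrow> 'd \<Rightarrow> real^'d \<Rightarrow> real) \<Rightarrow>
    (real^'d \<Rightarrow> real) \<Rightarrow> (real^'d \<Rightarrow> real) \<Rightarrow> (real^'d \<Rightarrow> real)" where
  "elliptic_op \<Omega> a c f = (\<lambda>x.
     (\<Sum>i\<in>UNIV. \<Sum>j\<in>UNIV. weak_pderiv \<Omega> j (\<lambda>y. a i j y * weak_pderiv \<Omega> i f y) x) + c x * f x)"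

definition elliptic_coeffs :: "(real^'d::finite) set \<Rightarrow> ('d \<Rightarrow> 'd \<Rightarrow> real^'d \<Rightarrow> real) \<Rightarrow>
    (real^'d \<Rightarrow> real) \<Rightarrow> bool" where
  "elliptic_coeffs \<Omega> a c \<longleftrightarrow>
     (\<forall>i j. C1_closure \<Omega> (a i j)) \<and> (\<forall>i j. \<forall>x\<in>closure \<Omega>. a i j x = a j i x) \<and>
     continuous_on (closure \<Omega>) c \<and> (\<forall>x\<in>closure \<Omega>. c x \<le> 0) \<and>
     (\<exists>\<delta>>0. \<forall>x\<in>closure \<Omega>. \<forall>\<xi>::real^'d.
        \<delta> * (\<Sum>i\<in>UNIV. (\<xi> $ i)\<^sup>2) \<le> (\<Sum>i\<in>UNIV. \<Sum>j\<in>UNIV. a i j x * \<xi> $ i * \<xi> $ j))"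

definition L2_orthonormal_basis ::
  "(real^'d::finite) set \<Rightarrow> (nat \<Rightarrow> real^'d \<Rightarrow> real) \<Rightarrow> bool" where
  "L2_orthonormal_basis \<Omega> \<phi> \<longleftrightarrow> (\<forall>n. \<phi> n \<in> L2_space \<Omega>) \<and>
     (\<forall>k n. L2_inner \<Omega> (\<phi> k) (\<phi> n) = (if k = n then 1 else 0)) \<and>
     (\<forall>f\<in>L2_space \<Omega>.
        (\<lambda>N. L2_norm \<Omega> (\<lambda>x. f x - (\<Sum>n<N. L2_inner \<Omega> f (\<phi> n) * \<phi> n x))) \<longlonglongrightarrow> 0)"

text \<open>The eigensystem is enumerated from \<open>0\<close>: \<open>l n\<close> and \<open>\<phi> n\<close> are \<open>\<lambda>\<^sub>n\<^sub>+\<^sub>1\<close> and \<open>\<phi>\<^sub>n\<^sub>+\<^sub>1\<close>.\<close>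

definition eigensystem :: "(real^'d::finite) set \<Rightarrow> ('d \<Rightarrow> 'd \<Rightarrow> real^'d \<Rightarrow> real) \<Rightarrow>
    (real^'d \<Rightarrow> real) \<Rightarrow> (nat \<Rightarrow> real) \<Rightarrow> (nat \<Rightarrow> real^'d \<Rightarrow> real) \<Rightarrow> bool" where
  "eigensystem \<Omega> a c l \<phi> \<longleftrightarrow>
     0 < l 0 \<and> l 0 < l 1 \<and> incseq l \<and> filterlim l at_top sequentially \<and>
     (\<forall>n. \<phi> n \<in> H2_space \<Omega> \<inter> H10_space \<Omega>) \<and>
     (\<forall>n. AE x in lebesgue_on \<Omega>. - elliptic_op \<Omega> a c (\<phi> n) x = l n * \<phi> n x) \<and>
     L2_orthonormal_basis \<Omega> \<phi>"

definition frac_dom :: "(real^'d::finite) set \<Rightarrow> (nat \<Rightarrow> real) \<Rightarrow> (nat \<Rightarrow> real^'d \<Rightarrow> real) \<Rightarrow>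
    real \<Rightarrow> (real^'d \<Rightarrow> real) set" where
  "frac_dom \<Omega> l \<phi> \<gamma> =
     {f \<in> L2_space \<Omega>. summable (\<lambda>n. \<bar>l n powr \<gamma> * L2_inner \<Omega> f (\<phi> n)\<bar>\<^sup>2)}"

definition frac_norm :: "(real^'d::finite) set \<Rightarrow> (nat \<Rightarrow> real) \<Rightarrow> (nat \<Rightarrow> real^'d \<Rightarrow> real) \<Rightarrow>
    real \<Rightarrow> (real^'d \<Rightarrow> real) \<Rightarrow> real" where
  "frac_norm \<Omega> l \<phi> \<gamma> f = sqrt (\<Sum>n. \<bar>l n powr \<gamma> * L2_inner \<Omega> f (\<phi> n)\<bar>\<^sup>2)"

text \<open>\<open>L\<^sup>p(0,T;X)\<close> for a space \<open>X\<close> of functions with norm \<open>N\<close>. Since \<open>X\<close> is a carrier set, not a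
  type, strong measurability is spelled out: almost everywhere a limit in norm of simple
  functions with values in \<open>X\<close>.\<close>

definition bochner_measurable ::
  "real \<Rightarrow> ('a \<Rightarrow> real) set \<Rightarrow> (('a \<Rightarrow> real) \<Rightarrow> real) \<Rightarrow> (real \<Rightarrow> 'a \<Rightarrow> real) \<Rightarrow> bool" where
  "bochner_measurable T X N u \<longleftrightarrow> (\<exists>s::nat \<Rightarrow> real \<Rightarrow> 'a \<Rightarrow> real.
     (\<forall>k. simple_function (lebesgue_on {0<..<T}) (s k) \<and> (\<forall>t\<in>{0<..<T}. s k t \<in> X)) \<and>
     (AE t in lebesgue_on {0<..<T}. (\<lambda>k. N (\<lambda>x. s k t x - u t x)) \<longlonglongrightarrow> 0))"

definition bochner_Lp ::
  "ennreal \<Rightarrow> real \<Rightarrow> ('a \<Rightarrow> real) set \<Rightarrow> (('a \<Rightarrow> real) \<Rightarrow> real) \<Rightarrow> (real \<Rightarrow> 'a \<Rightarrow> real) set" where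
  "bochner_Lp p T X N = {u. (AE t in lebesgue_on {0<..<T}. u t \<in> X) \<and> bochner_measurable T X N u \<and>
     (if p = \<infinity> then esssup (lebesgue_on {0<..<T}) (\<lambda>t. ereal (N (u t))) < \<infinity>
      else integrable (lebesgue_on {0<..<T}) (\<lambda>t. N (u t) powr enn2real p))}"

definition bochner_norm ::
  "ennreal \<Rightarrow> real \<Rightarrow> (('a \<Rightarrow> real) \<Rightarrow> real) \<Rightarrow> (real \<Rightarrow> 'a \<Rightarrow> real) \<Rightarrow> real" where
  "bochner_norm p T N u =
     (if p = \<infinity> then real_of_ereal (esssup (lebesgue_on {0<..<T}) (\<lambda>t. ereal (N (u t))))
      else (LINT t|lebesgue_on {0<..<T}. N (u t) powr enn2real p) powr (1 / enn2real p))"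

text \<open>Here and below \<open>u t x\<close> stands for \<open>u(x,t)\<close>.\<close>

definition Lp_frac :: "(real^'d::finite) set \<Rightarrow> (nat \<Rightarrow> real) \<Rightarrow> (nat \<Rightarrow> real^'d \<Rightarrow> real) \<Rightarrow>
    ennreal \<Rightarrow> real \<Rightarrow> real \<Rightarrow> (real \<Rightarrow> real^'d \<Rightarrow> real) set" where
  "Lp_frac \<Omega> l \<phi> p T \<gamma> = bochner_Lp p T (frac_dom \<Omega> l \<phi> \<gamma>) (frac_norm \<Omega> l \<phi> \<gamma>)"

definition Lp_frac_norm :: "(real^'d::finite) set \<Rightarrow> (nat \<Rightarrow> real) \<Rightarrow> (nat \<Rightarrow> real^'d \<Rightarrow> real) \<Rightarrow>
    ennreal \<Rightarrow> real \<Rightarrow> real \<Rightarrow> (real \<Rightarrow> real^'d \<Rightarrow> real) \<Rightarrow> real" where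
  "Lp_frac_norm \<Omega> l \<phi> p T \<gamma> u = bochner_norm p T (frac_norm \<Omega> l \<phi> \<gamma>) u"

definition ae_eq :: "(real^'d::finite) set \<Rightarrow> real \<Rightarrow>
    (real \<Rightarrow> real^'d \<Rightarrow> real) \<Rightarrow> (real \<Rightarrow> real^'d \<Rightarrow> real) \<Rightarrow> bool" where
  "ae_eq \<Omega> T u v \<longleftrightarrow>
     (AE t in lebesgue_on {0<..<T}. AE x in lebesgue_on \<Omega>. u t x = v t x)"

text \<open>The problem with zero initial value is posed for the eigenfunction coefficients, in the form
  obtained from the fractional differential equations by integrating once in time.\<close>

definition is_solution :: "(real^'d::finite) set \<Rightarrow> (nat \<Rightarrow> real) \<Rightarrow> (nat \<Rightarrow> real^'d \<Rightarrow> real) \<Rightarrow>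
    nat \<Rightarrow> (nat \<Rightarrow> real) \<Rightarrow> (nat \<Rightarrow> real) \<Rightarrow> real \<Rightarrow>
    (real \<Rightarrow> real^'d \<Rightarrow> real) \<Rightarrow> (real \<Rightarrow> real^'d \<Rightarrow> real) \<Rightarrow> bool" where
  "is_solution \<Omega> l \<phi> m \<alpha> q T F u \<longleftrightarrow>
     (AE t in lebesgue_on {0<..<T}. u t \<in> L2_space \<Omega>) \<and>
     (\<forall>n. integrable (lebesgue_on {0<..<T}) (\<lambda>t. L2_inner \<Omega> (u t) (\<phi> n)) \<and>
       (AE t in lebesgue_on {0<..<T}.
          (\<Sum>j=1..m. q j / Gamma (1 - \<alpha> j) *
             (LINT s|lebesgue_on {0<..<t}. (t - s) powr (- \<alpha> j) * L2_inner \<Omega> (u s) (\<phi> n)))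
          + l n * (LINT s|lebesgue_on {0<..<t}. L2_inner \<Omega> (u s) (\<phi> n))
          = (LINT s|lebesgue_on {0<..<t}. L2_inner \<Omega> (F s) (\<phi> n))))"

end

theory Submission
  imports Defs "HOL-Probability.Helly_Selection" "HOL-Real_Asymp.Real_Asymp"
begin

text \<open>
  Expanding in eigenfunctions turns the problem into one scalar equation for every eigenvalue
  \<open>\<lambda>\<close>. With \<open>k(t) = \<lambda> + (\<Sum>j. q\<^sub>j t powr -\<alpha>\<^sub>j / \<Gamma>(1 - \<alpha>\<^sub>j))\<close> and convolution over \<open>(0, t)\<close> it reads
  \<open>k * u = 1 * f\<close>. Everything follows from the existence of a well-behaved first kind resolvent,
  that is, of an \<open>r \<ge> 0\<close> with \<open>k * r = 1\<close>.

  \<^item> Solvability and uniqueness: by associativity \<open>u = r * f\<close> is a solution, and if \<open>k * w = 0\<close> then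
    \<open>1 * w = r * (k * w) = 0\<close>, so \<open>w = 0\<close> (\<open>volterra_solution\<close>, \<open>volterra_unique\<close>).

  \<^item> Bounds: \<open>r\<close> decreases, so \<open>1 = (k * r)(t)\<close> is at least \<open>r(t)\<close> times the integral of \<open>k\<close> over
    \<open>(0, t)\<close>. Since \<open>k\<close> is at least \<open>\<lambda>\<close> and at least \<open>t powr -\<alpha>\<^sub>1 / \<Gamma>(1 - \<alpha>\<^sub>1)\<close>, this bounds \<open>\<lambda> t r(t)\<close>
    and \<open>t powr (1 - \<alpha>\<^sub>1) r(t)\<close> by constants that do not depend on \<open>\<lambda>\<close>. Also \<open>\<lambda>\<close> times the integral
    of \<open>r\<close> is at most \<open>1\<close> (\<open>resolvent_bounds\<close>).

  The resolvent exists because \<open>k\<close> is log-convex and decreasing. On a mesh, \<open>k\<close> becomes a log-convex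
  decreasing sequence, and for such a sequence \<open>a\<close> the solution \<open>\<rho>\<close> of \<open>a * \<rho> = 1\<close> is nonnegative
  and decreasing by Kaluza's theorem (\<open>kaluza_antimono\<close>, \<open>deconvolution_nonneg\<close>). Helly's selection
  theorem provides a limit as the mesh is refined, and the bound on \<open>r\<close> above, which holds on every
  mesh, allows dominated convergence in the equation (\<open>resolvent_exists\<close>).

  For \<open>p = 2\<close> the kernels \<open>\<lambda> r\<close> have mass at most \<open>1\<close>, so Young's inequality bounds \<open>\<lambda> u\<close> by \<open>f\<close> in
  every mode with constant \<open>1\<close>, and the squares are summed over the modes (\<open>L2_estimate\<close>). For other
  \<open>p\<close> the two pointwise bounds are interpolated to
  \<open>\<lambda> powr (1 - \<tau>) r(t) \<le> C t powr (\<alpha>\<^sub>1 \<tau> - 1)\<close>, uniformly in \<open>\<lambda>\<close>; Minkowski's inequality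
  in the space of square summable sequences reduces the claim to Young's inequality for this kernel,
  whose mass is of order \<open>1 / \<tau>\<close> (\<open>Lp_estimate\<close>). Hoelder's inequality for the same kernel,
  instead of Young's, gives the decay at \<open>t = 0\<close>: the power of the kernel with the dual exponent is
  integrable at \<open>0\<close> if and only if \<open>\<alpha>\<^sub>1 \<tau> p > 1\<close> (\<open>initial_decay\<close>). Solutions are put together from their coefficients by the Riesz-Fischer theorem
  (\<open>riesz_fischer\<close>).
\<close>

section \<open>Deconvolution of log-convex sequences\<close>

text \<open>
  Log-convexity is monotonicity of the ratios \<open>a (Suc n) / a n\<close>; here it is cleared of denominators.
\<close>

lemma ratio_mono_of_log_convex:
  fixes a :: "nat \<Rightarrow> real"
  assumes pos: "\<And>n. a n > 0" and logconv: "\<And>n. (a (Suc n))\<^sup>2 \<le> a n * a (Suc (Suc n))"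
  shows "m \<le> n \<Longrightarrow> a (Suc m) * a n \<le> a m * a (Suc n)"
proof (induction n rule: dec_induct)
  case (step n)
  have "a (Suc m) * a (Suc n) * a n \<le> a m * (a (Suc n))\<^sup>2"
    using mult_right_mono[OF step.IH less_imp_le[OF pos[of "Suc n"]]]
    by (simp add: power2_eq_square mult_ac)
  also have "\<dots> \<le> a m * (a n * a (Suc (Suc n)))"
    using logconv[of n] pos[of m] by (intro mult_left_mono) auto
  finally have "(a (Suc m) * a (Suc n)) * a n \<le> (a m * a (Suc (Suc n))) * a n"
    by (simp add: mult_ac)
  then show ?case using pos[of n] by simp
qed (simp add: mult.commute)

text \<open>
  Kaluza's theorem. The decrements \<open>d\<close> of \<open>\<rho>\<close> satisfy \<open>a * d = \<rho> 0\<close> times the shifted sequence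
  \<open>a\<close>. When the index grows by one, each old term of \<open>a * d\<close> grows at most by the factor by which
  \<open>a\<close> itself does, because the ratios of \<open>a\<close> increase; the new decrement has to supply what is
  missing, hence is nonnegative.
\<close>

lemma kaluza_antimono:
  fixes a \<rho> :: "nat \<Rightarrow> real"
  assumes pos: "\<And>n. a n > 0" and logconv: "\<And>n. (a (Suc n))\<^sup>2 \<le> a n * a (Suc (Suc n))"
    and res: "\<And>n. (\<Sum>j\<le>n. a (n - j) * \<rho> j) = 1"
  shows "\<rho> (Suc n) \<le> \<rho> n"
proof -
  define d where "d j = \<rho> j - \<rho> (Suc j)" for j
  have key: "(\<Sum>j\<le>n. a (n - j) * d j) = \<rho> 0 * a (Suc n)" for n
  proof -
    have "(\<Sum>j\<le>n. a (n - j) * \<rho> (Suc j)) = 1 - a (Suc n) * \<rho> 0"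
      using res[of "Suc n"] by (subst (asm) sum.atMost_Suc_shift) simp
    then show ?thesis
      using res[of n] by (simp add: d_def algebra_simps sum_subtractf)
  qed
  have \<rho>0: "\<rho> 0 * a 0 = 1" using res[of 0] by (simp add: mult.commute)
  then have \<rho>0_pos: "\<rho> 0 > 0" using pos[of 0]
    by (metis zero_less_mult_pos2 zero_less_one)
  have "0 \<le> d n" for n
  proof (induction n rule: less_induct)
    case (less n)
    have eq: "d n * a 0 = \<rho> 0 * a (Suc n) - (\<Sum>j<n. a (n - j) * d j)"
      using key[of n] by (simp add: lessThan_Suc_atMost[symmetric] mult.commute)
    have "(\<Sum>j<n. a (n - j) * d j) \<le> \<rho> 0 * a (Suc n)"
    proof (cases n)
      case 0
      then show ?thesis using pos[of 1] \<rho>0_pos by simp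
    next
      case (Suc m)
      have "(\<Sum>j<n. a (n - j) * d j) * a n = (\<Sum>j\<le>m. a (Suc (m - j)) * a (Suc m) * d j)"
        unfolding sum_distrib_right Suc lessThan_Suc_atMost
        by (intro sum.cong) (auto simp: Suc_diff_le mult_ac)
      \<comment> \<open>this is where the ratios enter: the old decrements are nonnegative by induction\<close>
      also have "\<dots> \<le> (\<Sum>j\<le>m. a (m - j) * a (Suc (Suc m)) * d j)"
      proof (intro sum_mono mult_right_mono)
        fix j assume "j \<in> {..m}"
        then show "a (Suc (m - j)) * a (Suc m) \<le> a (m - j) * a (Suc (Suc m))" "0 \<le> d j"
          using less[of j] Suc by (auto intro!: ratio_mono_of_log_convex pos logconv)
      qed
      also have "\<dots> = (\<Sum>j\<le>m. a (m - j) * d j) * a (Suc (Suc m))"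
        unfolding sum_distrib_right by (intro sum.cong) auto
      also have "\<dots> = (\<rho> 0 * a (Suc n)) * a n"
        unfolding key Suc by (simp add: mult_ac)
      finally show ?thesis using pos[of n] by simp
    qed
    then have "0 \<le> d n * a 0" unfolding eq by simp
    then show ?case using pos[of 0] by (simp add: zero_le_mult_iff)
  qed
  from this[of n] show ?thesis by (simp add: d_def)
qed

text \<open>
  Since \<open>a\<close> decreases, the old terms of \<open>a * \<rho>\<close> can only shrink when the index grows; the new
  term restores the sum \<open>1\<close>.
\<close>

lemma deconvolution_nonneg:
  fixes a \<rho> :: "nat \<Rightarrow> real"
  assumes pos: "\<And>n. a n > 0" and anti: "\<And>n. a (Suc n) \<le> a n"
    and res: "\<And>n. (\<Sum>j\<le>n. a (n - j) * \<rho> j) = 1"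
  shows "0 \<le> \<rho> n"
proof (induction n rule: less_induct)
  case (less n)
  have "(\<Sum>j<n. a (n - j) * \<rho> j) \<le> 1"
  proof (cases n)
    case (Suc m)
    have "(\<Sum>j<n. a (n - j) * \<rho> j) \<le> (\<Sum>j\<le>m. a (m - j) * \<rho> j)"
      unfolding Suc lessThan_Suc_atMost using less Suc
      by (intro sum_mono mult_right_mono) (auto simp: Suc_diff_le anti)
    then show ?thesis using res[of m] by simp
  qed simp
  then have "0 \<le> \<rho> n * a 0"
    using res[of n] by (simp add: lessThan_Suc_atMost[symmetric] mult.commute)
  then show ?case using pos[of 0] by (simp add: zero_le_mult_iff)
qed

lemma deconvolution_exists:
  fixes a :: "nat \<Rightarrow> real"
  assumes "a 0 \<noteq> 0"
  shows "\<exists>\<rho>. \<forall>n. (\<Sum>j\<le>n. a (n - j) * \<rho> j) = 1"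
proof -
  define \<rho> where "\<rho> = wfrec less_than (\<lambda>\<rho> n. (1 - (\<Sum>j<n. a (n - j) * \<rho> j)) / a 0)"
  have "\<rho> n = (1 - (\<Sum>j<n. a (n - j) * \<rho> j)) / a 0" for n
    unfolding \<rho>_def by (subst wfrec) (auto simp: cut_def intro!: sum.cong)
  then have "a 0 * \<rho> n = 1 - (\<Sum>j<n. a (n - j) * \<rho> j)" for n
    using assms by (metis nonzero_mult_div_cancel_left times_divide_eq_right)
  then have "(\<Sum>j\<le>n. a (n - j) * \<rho> j) = 1" for n
    unfolding lessThan_Suc_atMost[symmetric] by simp
  then show ?thesis by blast
qed

section \<open>Convolution on the line\<close>

text \<open>
  Functions on the half-line are represented by functions on the whole line that vanish on
  \<open>{..0}\<close>; for these the integrand is supported in \<open>{0<..<t}\<close>.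
\<close>

definition conv :: "(real \<Rightarrow> real) \<Rightarrow> (real \<Rightarrow> real) \<Rightarrow> real \<Rightarrow> real" where
  "conv f g t = (LBINT s. f (t - s) * g s)"

lemma conv_comm: "conv f g t = conv g f t"
  unfolding conv_def
  by (subst lborel_integral_real_affine[where c="-1" and t=t]) (auto simp: mult.commute)

text \<open>
  Integrating first in \<open>t\<close> and using translation invariance leaves a multiple of \<open>\<bar>g\<bar>\<close>.
\<close>

lemma integrable_conv_pair:
  fixes f g :: "real \<Rightarrow> real"
  assumes f: "integrable lborel f" and g: "integrable lborel g"
  shows "integrable (lborel \<Otimes>\<^sub>M lborel) (\<lambda>(t, s). f (t - s) * g s)"
proof -
  have [measurable]: "f \<in> borel_measurable borel" "g \<in> borel_measurable borel"
    using f g by auto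
  have sh: "integrable lborel (\<lambda>t. f (t - s))" for s
    using lborel_integrable_real_affine[OF f, of 1 "- s"] by simp
  have "(LBINT t. norm (f (t - s))) = (LBINT t. norm (f t))" for s
    using lborel_integral_real_affine[of 1 "\<lambda>t. norm (f t)" "- s"] by simp
  then have "(\<lambda>s. \<integral>t. norm (f (t - s) * g s) \<partial>lborel) = (\<lambda>s. (LBINT t. norm (f t)) * norm (g s))"
    by (simp add: abs_mult)
  then have "integrable (lborel \<Otimes>\<^sub>M lborel) (\<lambda>(s, t). f (t - s) * g s)"
    using g sh by (intro lborel_pair.Fubini_integrable) auto
  from lborel_pair.integrable_product_swap[OF this] show ?thesis
    by (simp add: case_prod_beta')
qed

lemma AE_integrable_conv:
  fixes f g :: "real \<Rightarrow> real"
  assumes "integrable lborel f" "integrable lborel g"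
  shows "AE t in lborel. integrable lborel (\<lambda>s. f (t - s) * g s)"
  using lborel_pair.AE_integrable_fst'[OF integrable_conv_pair[OF assms]] by simp

lemma integrable_conv:
  assumes "integrable lborel f" "integrable lborel g"
  shows "integrable lborel (conv f g)"
  using lborel_pair.integrable_fst'[OF integrable_conv_pair[OF assms]] by (simp add: conv_def[abs_def])

lemma measurable_conv [measurable]:
  assumes [measurable]: "f \<in> borel_measurable borel" "g \<in> borel_measurable borel"
  shows "conv f g \<in> borel_measurable borel"
  unfolding conv_def[abs_def] by measurable

text \<open>
  The exchange of the two integrals at \<open>t\<close> needs \<open>(\<bar>f\<bar> * (\<bar>g\<bar> * \<bar>h\<bar>)) t\<close> to be finite, which is the
  case for almost every \<open>t\<close>.
\<close>

lemma conv_assoc_AE: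
  assumes f: "integrable lborel f" and g: "integrable lborel g" and h: "integrable lborel h"
  shows "AE t in lborel. conv f (conv g h) t = conv (conv f g) h t"
proof -
  have [measurable]: "f \<in> borel_measurable borel" "g \<in> borel_measurable borel" "h \<in> borel_measurable borel"
    using f g h by auto
  define gh where "gh = conv (\<lambda>x. \<bar>g x\<bar>) (\<lambda>x. \<bar>h x\<bar>)"
  have gh: "integrable lborel gh" unfolding gh_def by (intro integrable_conv integrable_abs g h)
  have "AE t in lborel. integrable lborel (\<lambda>s. \<bar>f (t - s)\<bar> * gh s)"
    by (rule AE_integrable_conv[OF integrable_abs[OF f] gh])
  then show ?thesis
  proof eventually_elim
    case (elim t)
    have int: "integrable (lborel \<Otimes>\<^sub>M lborel) (\<lambda>(s, r). f (t - s) * (g (s - r) * h r))"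
    proof (rule lborel_pair.Fubini_integrable)
      have "(LBINT r. norm (f (t - s) * (g (s - r) * h r))) = \<bar>f (t - s)\<bar> * gh s" for s
        by (simp add: gh_def conv_def abs_mult)
      then show "integrable lborel (\<lambda>s. \<integral>r. norm (case (s, r) of (s, r) \<Rightarrow> f (t - s) * (g (s - r) * h r)) \<partial>lborel)"
        using elim by simp
      show "AE s in lborel. integrable lborel (\<lambda>r. case (s, r) of (s, r) \<Rightarrow> f (t - s) * (g (s - r) * h r))"
        using AE_integrable_conv[OF g h] by eventually_elim simp
    qed simp
    have "conv f (conv g h) t = (LBINT s. (LBINT r. f (t - s) * (g (s - r) * h r)))"
      by (simp add: conv_def)
    also have "\<dots> = (LBINT r. (LBINT s. f (t - s) * (g (s - r) * h r)))"
      using lborel_pair.Fubini_integral[OF int] by simp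
    also have "\<dots> = (LBINT r. (LBINT s. f (t - s) * g (s - r)) * h r)"
      by (simp flip: mult.assoc)
    also have "\<dots> = conv (conv f g) h t"
    proof -
      have "(LBINT s. f (t - s) * g (s - r)) = conv f g (t - r)" for r
        using lborel_integral_real_affine[of 1 "\<lambda>s. f (t - s) * g (s - r)" r]
        by (simp add: conv_def algebra_simps)
      then show ?thesis by (simp add: conv_def)
    qed
    finally show ?case .
  qed
qed

lemma conv_cong_AE:
  assumes "AE s in lborel. f (t - s) * g s = f' (t - s) * g' s"
    and [measurable]: "f \<in> borel_measurable borel" "g \<in> borel_measurable borel"
      "f' \<in> borel_measurable borel" "g' \<in> borel_measurable borel"
  shows "conv f g t = conv f' g' t"
  unfolding conv_def by (rule integral_cong_AE) (use assms(1) in auto)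

lemma integral_conv:
  assumes f: "integrable lborel f" and g: "integrable lborel g"
  shows "(LBINT t. conv f g t) = (LBINT t. f t) * (LBINT t. g t)"
proof -
  have "(LBINT t. conv f g t) = (LBINT s. (LBINT t. f (t - s) * g s))"
    unfolding conv_def
    using lborel_pair.Fubini_integral[OF integrable_conv_pair[OF f g]] by simp
  also have "\<dots> = (LBINT s. (LBINT t. f t) * g s)"
  proof -
    have "(LBINT t. f (t - s)) = (LBINT t. f t)" for s
      using lborel_integral_real_affine[of 1 f "- s"] by simp
    then show ?thesis by simp
  qed
  finally show ?thesis by simp
qed

text \<open>
  A convolution on \<open>{0<..<T}\<close> sees only the values of both factors there, so kernels that are
  merely locally integrable may be cut off and treated as integrable functions.
\<close>

definition trunc :: "real \<Rightarrow> (real \<Rightarrow> real) \<Rightarrow> real \<Rightarrow> real" where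
  "trunc T f s = indicator {0<..<T} s * f s"

lemma trunc_measurable [measurable]: "f \<in> borel_measurable borel \<Longrightarrow> trunc T f \<in> borel_measurable borel"
  unfolding trunc_def[abs_def] by measurable

lemma trunc_off [simp]: "t \<le> 0 \<Longrightarrow> trunc T f t = 0" "T \<le> t \<Longrightarrow> trunc T f t = 0"
  and trunc_in [simp]: "0 < t \<Longrightarrow> t < T \<Longrightarrow> trunc T f t = f t"
  by (auto simp: trunc_def)

lemma conv_zero_left:
  assumes "\<And>t. t \<le> 0 \<Longrightarrow> f t = 0" "\<And>t. t \<le> 0 \<Longrightarrow> g t = 0" "t \<le> 0"
  shows "conv f g t = 0"
proof -
  have "(\<lambda>s. f (t - s) * g s) = (\<lambda>s. 0)"
  proof
    fix s show "f (t - s) * g s = 0" using assms by (cases "s \<le> 0") auto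
  qed
  then show ?thesis by (simp add: conv_def)
qed

lemma conv_trunc_right:
  assumes "\<And>t. t \<le> 0 \<Longrightarrow> f t = 0" "\<And>t. t \<le> 0 \<Longrightarrow> g t = 0" "t \<le> T"
  shows "conv f (trunc T g) t = conv f g t"
proof -
  have "(\<lambda>s. f (t - s) * trunc T g s) = (\<lambda>s. f (t - s) * g s)"
  proof
    fix s
    consider "s \<le> 0" | "t \<le> s" | "0 < s" "s < t" by linarith
    then show "f (t - s) * trunc T g s = f (t - s) * g s"
      by cases (use assms in auto)
  qed
  then show ?thesis by (simp add: conv_def)
qed

lemma conv_trunc:
  assumes "\<And>t. t \<le> 0 \<Longrightarrow> f t = 0" "\<And>t. t \<le> 0 \<Longrightarrow> g t = 0" "t \<le> T"
  shows "conv (trunc T f) (trunc T g) t = conv f g t"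
proof -
  have "conv (trunc T f) (trunc T g) t = conv g (trunc T f) t"
    using assms by (simp add: conv_trunc_right conv_comm)
  then show ?thesis using assms by (simp add: conv_trunc_right conv_comm)
qed

lemma has_bochner_integral_powr:
  fixes a t :: real
  assumes "a > -1" "t > 0"
  shows "has_bochner_integral lborel (\<lambda>s. indicator {0<..t} s * s powr a) (t powr (a + 1) / (a + 1))"
proof (rule has_bochner_integral_nn_integral)
  have "((\<lambda>x. x powr a) has_integral t powr (a + 1) / (a + 1)) {0..t}"
    using has_integral_powr_from_0[of a t] assms by simp
  then have "((\<lambda>x. if x \<in> {0..t} then x powr a else 0) has_integral t powr (a + 1) / (a + 1)) UNIV"
    by (simp only: has_integral_restrict_UNIV)
  moreover have "(\<lambda>x. if x \<in> {0..t} then x powr a else 0) = (\<lambda>s. indicator {0<..t} s * s powr a)"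
    by (rule ext) (auto split: split_indicator)
  ultimately have "((\<lambda>s. indicator {0<..t} s * s powr a) has_integral t powr (a + 1) / (a + 1)) UNIV"
    by (simp only:)
  then show "(\<integral>\<^sup>+ x. ennreal (indicat_real {0<..t} x * x powr a) \<partial>lborel) = ennreal (t powr (a + 1) / (a + 1))"
    by (intro nn_integral_has_integral_lborel) auto
qed (use assms in auto)

section \<open>First kind resolvents of log-convex kernels\<close>

lemma cell_arg_pos: "0 < (h::real) \<Longrightarrow> real n * h < s \<Longrightarrow> 0 < s"
  by (rule le_less_trans[OF mult_nonneg_nonneg]) auto

text \<open>
  The lower bound makes \<open>k\<close> unbounded at \<open>0\<close>. For bounded \<open>k\<close> the resolvent would have an atom at
  \<open>0\<close> and could not be a function.
\<close>

locale log_convex_kernel =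
  fixes k :: "real \<Rightarrow> real" and \<beta> c :: real
  assumes meas [measurable]: "k \<in> borel_measurable borel"
    and zero: "\<And>t. t \<le> 0 \<Longrightarrow> k t = 0"
    and anti: "\<And>s t. 0 < s \<Longrightarrow> s \<le> t \<Longrightarrow> k t \<le> k s"
    and logconv: "\<And>t h. 0 < t \<Longrightarrow> 0 < h \<Longrightarrow> (k (t + h))\<^sup>2 \<le> k t * k (t + 2 * h)"
    and int: "\<And>t. integrable lborel (\<lambda>s. indicator {0<..t} s * k s)"
    and \<beta>: "0 < \<beta>" "\<beta> < 1" and c: "0 < c"
    and lower: "\<And>t. 0 < t \<Longrightarrow> c * t powr (\<beta> - 1) \<le> k t"
begin

lemma pos: "0 < t \<Longrightarrow> 0 < k t"
  using lower[of t] c by (smt (verit) mult_pos_pos powr_gt_zero)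

lemma nonneg: "0 \<le> k t"
  using pos[of t] zero[of t] by (cases "t > 0") auto

text \<open>
  A decreasing \<open>r\<close> with \<open>k * r = 1\<close> satisfies \<open>r t * K t \<le> 1\<close>, so lower bounds for \<open>K\<close> are upper
  bounds for the resolvent.
\<close>

definition K :: "real \<Rightarrow> real" where
  "K t = (LBINT s. indicator {0<..t} s * k s)"

lemma K_mono: "s \<le> t \<Longrightarrow> K s \<le> K t"
  unfolding K_def by (intro integral_mono int) (auto split: split_indicator simp: nonneg)

lemma K_ge: assumes "0 < t" shows "t * k t \<le> K t"
proof -
  have "t * k t = (LBINT s. indicator {0<..t} s * k t)" using assms by simp
  also have "\<dots> \<le> K t"
    unfolding K_def using assms
    by (intro integral_mono int integrable_real_mult_indicator)
       (auto split: split_indicator intro!: anti integrable_real_indicator)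
  finally show ?thesis .
qed

lemma K_lower: assumes "0 < t" shows "c * t powr \<beta> \<le> K t"
proof -
  have "c * t powr \<beta> = t * (c * t powr (\<beta> - 1))"
    using assms by (simp add: powr_diff)
  also have "\<dots> \<le> t * k t" using lower[of t] assms by (intro mult_left_mono) auto
  also have "\<dots> \<le> K t" by (rule K_ge[OF assms])
  finally show ?thesis .
qed

lemma K_pos: "0 < t \<Longrightarrow> 0 < K t"
  using K_lower[of t] c by (smt (verit) mult_pos_pos powr_gt_zero)

lemma inverse_K_le: "0 < t \<Longrightarrow> 1 / K t \<le> t powr - \<beta> / c"
  using K_lower[of t] K_pos[of t] c by (simp add: field_simps powr_minus)

text \<open>
  Discretising with the masses of the cells, and not with point values of \<open>k\<close>, makes the discrete
  equation an exact convolution equation for step functions, see \<open>conv_step_grid\<close>.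
\<close>

definition cell :: "real \<Rightarrow> nat \<Rightarrow> real" where
  "cell h n = (LBINT s. indicator {real n * h<..real (Suc n) * h} s * k s)"

lemma integrable_k_on: assumes "A \<in> sets borel" "A \<subseteq> {..t}"
  shows "integrable lborel (\<lambda>s. indicator A s * k s)"
  by (rule Bochner_Integration.integrable_bound[OF int[of t]])
     (use assms in \<open>auto split: split_indicator simp: nonneg zero not_less\<close>)

lemma cell_shift:
  assumes "0 < h"
  shows "cell h (n + i) = (LBINT s. indicator {real n * h<..real (Suc n) * h} s * k (s + real i * h))"
    and "integrable lborel (\<lambda>s. indicator {real n * h<..real (Suc n) * h} s * k (s + real i * h))"
proof -
  have eq: "indicat_real {real (n + i) * h<..real (Suc (n + i)) * h} (real i * h + 1 * s) * k (real i * h + 1 * s)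
      = indicator {real n * h<..real (Suc n) * h} s * k (s + real i * h)" for s
    by (auto split: split_indicator simp: algebra_simps)
  have "integrable lborel (\<lambda>s. indicat_real {real (n + i) * h<..real (Suc (n + i)) * h} s * k s)"
    by (rule integrable_k_on[where t="real (Suc (n+i)) * h"]) auto
  then show "integrable lborel (\<lambda>s. indicator {real n * h<..real (Suc n) * h} s * k (s + real i * h))"
    by (subst eq[symmetric]) (rule lborel_integrable_real_affine, auto)
  show "cell h (n + i) = (LBINT s. indicator {real n * h<..real (Suc n) * h} s * k (s + real i * h))"
    unfolding cell_def by (subst lborel_integral_real_affine[where c=1 and t="real i * h"]) (simp_all only: eq, simp)
qed

lemma cell_pos: assumes "0 < h" shows "0 < cell h n"
proof -
  have "0 < h * k (real (Suc n) * h)" using assms pos by simp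
  also have "\<dots> = (LBINT s. indicator {real n * h<..real (Suc n) * h} s * k (real (Suc n) * h))"
    using assms by (simp add: algebra_simps)
  also have "\<dots> \<le> cell h n"
    unfolding cell_def using assms
    by (intro integral_mono integrable_k_on[where t="real (Suc n) * h"] integrable_real_mult_indicator)
       (auto split: split_indicator intro!: anti integrable_real_indicator
             intro: cell_arg_pos)
  finally show ?thesis .
qed

lemma cell_antimono: assumes "0 < h" shows "cell h (Suc n) \<le> cell h n"
  using assms unfolding cell_shift(1)[OF assms, of n 1, simplified]
  unfolding cell_def
  by (intro integral_mono cell_shift(2)[OF assms, of n 1, simplified] integrable_k_on[where t="real (Suc n) * h"])
     (auto split: split_indicator intro!: anti intro: cell_arg_pos)

text \<open>
  Log-convexity of \<open>k\<close> says that the quadratic form with coefficients \<open>k s\<close>, \<open>k (s + h)\<close>,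
  \<open>k (s + 2 * h)\<close> is nonnegative. This condition is linear in \<open>k\<close>, so it can be integrated over the
  cell.
\<close>

lemma cell_log_convex: assumes h: "0 < h" shows "(cell h (Suc n))\<^sup>2 \<le> cell h n * cell h (Suc (Suc n))"
proof -
  let ?I = "indicat_real {real n * h<..real (Suc n) * h}"
  have quad: "0 \<le> cell h n * x\<^sup>2 + 2 * cell h (Suc n) * x + cell h (Suc (Suc n))" for x
  proof -
    have "0 \<le> ?I s * k s * x\<^sup>2 + 2 * (?I s * k (s + h)) * x + ?I s * k (s + 2 * h)" for s
    proof (cases "s \<in> {real n * h<..real (Suc n) * h}")
      case True
      then have s: "0 < s" using h by (auto intro: cell_arg_pos)
      have "k s * (k s * x\<^sup>2 + 2 * k (s + h) * x + k (s + 2 * h))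
          = (k s * x + k (s + h))\<^sup>2 + (k s * k (s + 2 * h) - (k (s + h))\<^sup>2)"
        by (simp add: power2_eq_square algebra_simps)
      also have "\<dots> \<ge> 0" using logconv[OF s h] by simp
      finally show ?thesis using pos[OF s] True by (simp add: zero_le_mult_iff)
    qed simp
    then have "0 \<le> (LBINT s. ?I s * k s * x\<^sup>2 + 2 * (?I s * k (s + h)) * x + ?I s * k (s + 2 * h))"
      by (intro integral_nonneg_AE) auto
    also have "\<dots> = cell h n * x\<^sup>2 + 2 * cell h (Suc n) * x + cell h (Suc (Suc n))"
      using cell_shift[OF h, of n 0] cell_shift[OF h, of n 1] cell_shift[OF h, of n 2] by simp
    finally show ?thesis .
  qed
  have "0 \<le> cell h n * (cell h n * (- cell h (Suc n) / cell h n)\<^sup>2 + 2 * cell h (Suc n) * (- cell h (Suc n) / cell h n) + cell h (Suc (Suc n)))"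
    by (rule mult_nonneg_nonneg[OF less_imp_le[OF cell_pos[OF h]] quad])
  also have "\<dots> = cell h n * cell h (Suc (Suc n)) - (cell h (Suc n))\<^sup>2"
    using cell_pos[OF h, of n] by (simp add: field_simps power2_eq_square)
  finally show ?thesis by simp
qed

lemma sum_cell: assumes "0 < h" shows "(\<Sum>i<n. cell h i) = K (real n * h)"
proof -
  have "(\<Sum>i<n. cell h i) = (LBINT s. (\<Sum>i<n. indicator {real i * h<..real (Suc i) * h} s * k s))"
    unfolding cell_def
    by (subst Bochner_Integration.integral_sum) (auto intro!: integrable_k_on)
  also have "(\<lambda>s. \<Sum>i<n. indicat_real {real i * h<..real (Suc i) * h} s * k s) = (\<lambda>s. indicator {0<..real n * h} s * k s)"
  proof
    fix s
    have "(\<Sum>i<n. indicat_real {real i * h<..real (Suc i) * h} s) = indicator {0<..real n * h} s"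
    proof (induction n)
      case (Suc n)
      have "indicat_real {0<..real (Suc n) * h} s
          = indicator {0<..real n * h} s + indicator {real n * h<..real (Suc n) * h} s"
        using cell_arg_pos[OF assms, of n s] assms
        by (auto split: split_indicator simp: algebra_simps)
      then show ?case using Suc by simp
    qed simp
    then show "(\<Sum>i<n. indicat_real {real i * h<..real (Suc i) * h} s * k s) = indicator {0<..real n * h} s * k s"
      by (simp add: sum_distrib_right[symmetric])
  qed
  finally show ?thesis unfolding K_def .
qed

definition grid_weight :: "real \<Rightarrow> nat \<Rightarrow> real" where
  "grid_weight h = (SOME \<rho>. \<forall>n. (\<Sum>j\<le>n. cell h (n - j) * \<rho> j) = 1)"

lemma grid_weight: assumes "0 < h" shows "(\<Sum>j\<le>n. cell h (n - j) * grid_weight h j) = 1"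
  using someI_ex[OF deconvolution_exists[of "cell h"]] cell_pos[OF assms, of 0] unfolding grid_weight_def by simp

lemma grid_weight_nonneg: "0 < h \<Longrightarrow> 0 \<le> grid_weight h n"
  by (intro deconvolution_nonneg[of "cell h"] cell_pos cell_antimono grid_weight)

lemma grid_weight_Suc_le: "0 < h \<Longrightarrow> grid_weight h (Suc n) \<le> grid_weight h n"
  by (intro kaluza_antimono[of "cell h"] cell_pos cell_log_convex grid_weight)

lemma grid_weight_antimono: "0 < h \<Longrightarrow> m \<le> n \<Longrightarrow> grid_weight h n \<le> grid_weight h m"
  by (rule lift_Suc_antimono_le[of "grid_weight h"]) (auto intro: grid_weight_Suc_le)

text \<open>
  In \<open>a * \<rho> = 1\<close> every weight is at least the last one, and the masses add up to \<open>K\<close>.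
\<close>

lemma grid_weight_K: assumes h: "0 < h" shows "grid_weight h n * K (real (Suc n) * h) \<le> 1"
proof -
  have "grid_weight h n * K (real (Suc n) * h) = (\<Sum>j\<le>n. cell h (n - j) * grid_weight h n)"
    unfolding sum_cell[OF h, symmetric] lessThan_Suc_atMost sum_distrib_left
    by (subst sum.atLeastAtMost_rev[of _ 0 n, simplified atLeast0AtMost]) (simp add: mult.commute)
  also have "\<dots> \<le> (\<Sum>j\<le>n. cell h (n - j) * grid_weight h j)"
    using h cell_pos[OF h] by (intro sum_mono mult_left_mono grid_weight_antimono) (auto intro: less_imp_le)
  finally show ?thesis using grid_weight[OF h] by simp
qed

text \<open>
  The cells of the step function are closed on the left, those of \<open>cell\<close> on the right, because
  convolution reflects one of the factors; the left-closed ones also make the step function right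
  continuous, as Helly's theorem requires.
\<close>

definition step :: "real \<Rightarrow> real \<Rightarrow> real" where
  "step h s = (if s < 0 then 0 else grid_weight h (nat \<lfloor>s / h\<rfloor>))"

lemma step_measurable [measurable]: "step h \<in> borel_measurable borel"
  unfolding step_def[abs_def] by measurable

lemma step_nonneg: "0 < h \<Longrightarrow> 0 \<le> step h s"
  by (simp add: step_def grid_weight_nonneg)

lemma step_antimono: "0 < h \<Longrightarrow> 0 \<le> s \<Longrightarrow> s \<le> t \<Longrightarrow> step h t \<le> step h s"
  unfolding step_def by (auto intro!: grid_weight_antimono nat_mono floor_mono divide_right_mono)

lemma step_K: assumes h: "0 < h" and s: "0 < s" shows "step h s * K s \<le> 1"
proof -
  let ?n = "nat \<lfloor>s / h\<rfloor>"
  have "real ?n = of_int \<lfloor>s / h\<rfloor>" using h s by simp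
  then have "s / h \<le> real (Suc ?n)" unfolding of_nat_Suc by linarith
  then have "s \<le> real (Suc ?n) * h" using h by (simp add: field_simps)
  then have "grid_weight h ?n * K s \<le> grid_weight h ?n * K (real (Suc ?n) * h)"
    using h by (intro mult_left_mono K_mono grid_weight_nonneg)
  then show ?thesis using grid_weight_K[OF h, of ?n] s by (simp add: step_def)
qed

text \<open>
  At a mesh point the reflected cells of \<open>k\<close> and those of the step function coincide, and the
  integral is the discrete convolution.
\<close>

lemma conv_step_grid: assumes h: "0 < h" shows "conv k (step h) (real (Suc n) * h) = 1"
proof -
  let ?J = "\<lambda>j. indicat_real {real j * h..<real (Suc j) * h}"
  define t where "t = real (Suc n) * h"
  have cell_reflect: "?J j (t + - 1 * s) = indicator {real (n - j) * h<..real (Suc (n - j)) * h} s"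
    if "j \<le> n" for j s
  proof -
    obtain d where d: "n = j + d" using \<open>j \<le> n\<close> le_Suc_ex by blast
    have "t + - 1 * s \<in> {real j * h..<real (Suc j) * h} \<longleftrightarrow> s \<in> {real d * h<..real (Suc d) * h}"
      unfolding t_def d by (auto simp: algebra_simps)
    then show ?thesis by (simp add: indicator_def d)
  qed
  have pw: "k (t - s) * step h s = (\<Sum>j\<le>n. grid_weight h j * (?J j s * k (t - s)))" for s
  proof -
    consider "s < 0" | "0 \<le> s" "s < t" | "t \<le> s" by linarith
    then show ?thesis
    proof cases
      case 1
      then have "?J j s = 0" for j
      proof -
        have "0 \<le> real j * h" using h by simp
        then have "\<not> real j * h \<le> s" using 1 by linarith
        then show ?thesis by (simp add: indicator_def)
      qed
      then show ?thesis using 1 by (simp add: step_def)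
    next
      case 2
      have eq: "?J j s = (if j = nat \<lfloor>s / h\<rfloor> then 1 else 0)" for j
      proof -
        have "s \<in> {real j * h..<real (Suc j) * h} \<longleftrightarrow> real j \<le> s / h \<and> s / h < real (Suc j)"
          using h by (auto simp: field_simps)
        also have "\<dots> \<longleftrightarrow> j = nat \<lfloor>s / h\<rfloor>"
        proof -
          have "0 \<le> \<lfloor>s / h\<rfloor>" using 2 h by simp
          then have "j = nat \<lfloor>s / h\<rfloor> \<longleftrightarrow> \<lfloor>s / h\<rfloor> = int j" by linarith
          then show ?thesis by (simp add: floor_eq_iff add.commute)
        qed
        finally show ?thesis by (simp add: indicator_def)
      qed
      have "s / h < real (Suc n)" using 2 h by (simp add: t_def pos_divide_less_eq)
      then have "\<lfloor>s / h\<rfloor> < int (Suc n)" by (simp only: floor_less_iff of_int_of_nat_eq)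
      then have n: "nat \<lfloor>s / h\<rfloor> \<in> {..n}" by simp
      have "(\<Sum>j\<le>n. grid_weight h j * (?J j s * k (t - s)))
          = (\<Sum>j\<le>n. if j = nat \<lfloor>s / h\<rfloor> then grid_weight h j * k (t - s) else 0)"
        unfolding eq by (intro sum.cong) auto
      also have "\<dots> = grid_weight h (nat \<lfloor>s / h\<rfloor>) * k (t - s)"
        using n by (subst sum.delta) auto
      finally show ?thesis using 2 by (simp add: step_def)
    qed (simp add: zero)
  qed
  have intj: "integrable lborel (\<lambda>s. ?J j s * k (t - s))" 
    and valj: "(LBINT s. ?J j s * k (t - s)) = cell h (n - j)" if "j \<le> n" for j
  proof -
    have "(LBINT s. ?J j s * k (t - s)) = (LBINT s. ?J j (t + - 1 * s) * k (t - (t + - 1 * s)))"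
      using lborel_integral_real_affine[of "-1" "\<lambda>s. ?J j s * k (t - s)" t] by (simp only: abs_minus_cancel abs_one scaleR_one)
    also have "\<dots> = cell h (n - j)"
      unfolding cell_def cell_reflect[OF that] by simp
    finally show "(LBINT s. ?J j s * k (t - s)) = cell h (n - j)" .
    have "integrable lborel (\<lambda>s. indicator {real (n - j) * h<..real (Suc (n - j)) * h} s * k s)"
      by (rule integrable_k_on[where t="real (Suc (n - j)) * h"]) auto
    then have "integrable lborel (\<lambda>s. ?J j (t + - 1 * s) * k (t - (t + - 1 * s)))"
      unfolding cell_reflect[OF that] by simp
    then show "integrable lborel (\<lambda>s. ?J j s * k (t - s))"
      by (subst (asm) lborel_integrable_real_affine_iff) auto
  qed
  have "conv k (step h) t = (\<Sum>j\<le>n. \<integral>s. grid_weight h j * (?J j s * k (t - s)) \<partial>lborel)"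
    unfolding conv_def pw
    by (rule Bochner_Integration.integral_sum) (intro integrable_mult_right intj, simp)
  also have "\<dots> = (\<Sum>j\<le>n. grid_weight h j * cell h (n - j))"
    by (intro sum.cong refl) (simp only: integral_mult_right_zero valj atMost_iff)
  finally have "conv k (step h) t = (\<Sum>j\<le>n. grid_weight h j * cell h (n - j))" .
  then show ?thesis using grid_weight[OF h, of n] by (simp add: mult.commute t_def)
qed

lemma step_le: assumes "0 < h" "0 < s" shows "step h s \<le> s powr - \<beta> / c"
proof -
  have "step h s \<le> 1 / K s" using step_K[OF assms] K_pos[OF assms(2)] by (simp add: field_simps)
  then show ?thesis using inverse_K_le[OF assms(2)] by simp
qed

text \<open>
  The singularities of the factors sit at opposite ends of \<open>{0<..<t}\<close>; on either side of \<open>t / 2\<close>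
  one of the factors is bounded.
\<close>

lemma integrable_dominating:
  assumes t: "0 < t"
  shows "integrable lborel (\<lambda>s. k (t - s) * (indicator {0<..} s * s powr - \<beta>))"
proof (rule Bochner_Integration.integrable_bound)
  have 1: "integrable lborel (\<lambda>s. indicator {0<..t} s * s powr - \<beta>)"
    using has_bochner_integral_powr[of "-\<beta>" t] \<beta> t by (simp add: has_bochner_integral_iff)
  have 2: "integrable lborel (\<lambda>s. indicator {0<..t} (t + - 1 * s) * k (t + - 1 * s))"
    by (rule lborel_integrable_real_affine[OF int]) simp
  show "integrable lborel (\<lambda>s. k (t / 2) * (indicator {0<..t} s * s powr - \<beta>)
      + (t / 2) powr - \<beta> * (indicator {0<..t} (t - s) * k (t - s)))"
    using 1 2 by simp
  show "AE s in lborel. norm (k (t - s) * (indicat_real {0<..} s * s powr - \<beta>))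
      \<le> norm (k (t / 2) * (indicator {0<..t} s * s powr - \<beta>)
      + (t / 2) powr - \<beta> * (indicator {0<..t} (t - s) * k (t - s)))"
  proof (intro AE_I2)
    fix s
    consider "s \<le> 0" | "t \<le> s" | "0 < s" "s \<le> t / 2" | "t / 2 < s" "s < t" by linarith
    then show "norm (k (t - s) * (indicat_real {0<..} s * s powr - \<beta>))
      \<le> norm (k (t / 2) * (indicator {0<..t} s * s powr - \<beta>)
      + (t / 2) powr - \<beta> * (indicator {0<..t} (t - s) * k (t - s)))"
    proof cases
      case 3
      then have "k (t - s) * s powr - \<beta> \<le> k (t / 2) * s powr - \<beta>"
        using t by (intro mult_right_mono anti) auto
      moreover have "0 \<le> (t / 2) powr - \<beta> * k (t - s)" by (simp add: nonneg)
      ultimately have "k (t - s) * s powr - \<beta> \<le> k (t / 2) * s powr - \<beta> + (t / 2) powr - \<beta> * k (t - s)"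
        by linarith
      then show ?thesis using 3 t by (simp add: nonneg)
    next
      case 4
      then have "s powr - \<beta> * k (t - s) \<le> (t / 2) powr - \<beta> * k (t - s)"
        using t \<beta> by (intro mult_right_mono powr_mono2') (auto simp: nonneg)
      then show ?thesis using 4 t by (auto simp: nonneg mult.commute intro: order_trans add_increasing)
    qed (auto simp: zero nonneg)
  qed
qed simp

text \<open>
  The step functions decrease and are unbounded near \<open>0\<close> as the mesh is refined. Composed with
  \<open>\<lambda>x. exp (- x)\<close> they become increasing functions with values in the unit interval, to which
  Helly's selection theorem applies.
\<close>

lemma step_exp_right_continuous:
  assumes h: "0 < h"
  shows "continuous (at_right x) (\<lambda>t. if t < 0 then 0 else exp (- step h t))"
proof -
  have "\<forall>\<^sub>F t in at_right x. (if x < 0 then 0 else exp (- step h x)) = (if t < 0 then 0 else exp (- step h t))"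
  proof (cases "x < 0")
    case True
    then have "\<forall>\<^sub>F t in at_right x. t < 0" by (intro order_tendstoD(2)[OF tendsto_ident_at])
    then show ?thesis by eventually_elim (use True in simp)
  next
    case False
    have "x / h < of_int \<lfloor>x / h\<rfloor> + 1" by linarith
    then have "x < (of_int \<lfloor>x / h\<rfloor> + 1) * h" using h by (simp only: pos_divide_less_eq)
    then have "\<forall>\<^sub>F t in at_right x. t < (of_int \<lfloor>x / h\<rfloor> + 1) * h \<and> x < t"
      by (intro eventually_conj order_tendstoD(2)[OF tendsto_ident_at]) (auto simp: eventually_at_filter)
    then show ?thesis
    proof eventually_elim
      case (elim t)
      have "\<lfloor>t / h\<rfloor> = \<lfloor>x / h\<rfloor>"
      proof (rule floor_unique)
        have "of_int \<lfloor>x / h\<rfloor> \<le> x / h" by simp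
        also have "x / h \<le> t / h" using elim h by (simp add: divide_right_mono)
        finally show "of_int \<lfloor>x / h\<rfloor> \<le> t / h" .
        show "t / h < of_int \<lfloor>x / h\<rfloor> + 1" using elim h by (simp add: pos_divide_less_eq)
      qed
      then show ?case using False elim by (simp add: step_def)
    qed
  qed
  then show ?thesis
    unfolding continuous_within by (rule Lim_transform_eventually[OF tendsto_const])
qed

text \<open>
  The meshes of size \<open>1 / 2 ^ N\<close> are nested, so a dyadic point is a mesh point from some \<open>N\<close> on
  and the equation there passes to the limit.
\<close>

lemma resolvent_on_grid:
  "\<exists>r. r \<in> borel_measurable borel \<and> (\<forall>t\<le>0. r t = 0) \<and> (\<forall>t. 0 \<le> r t) \<and>
     (\<forall>s t. 0 < s \<longrightarrow> s \<le> t \<longrightarrow> r t \<le> r s) \<and> (\<forall>t>0. r t * K (t / 2) \<le> 1) \<and>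
     (\<forall>N p. conv k r (real (Suc p) / 2 ^ N) = 1)"
proof -
  define h where "h N = (1 / 2 ^ N :: real)" for N :: nat
  have h: "0 < h N" for N by (simp add: h_def)
  define f where "f N t = (if t < 0 then 0 else exp (- step (h N) t))" for N t
  have "mono (f N)" for N
    unfolding f_def by (intro monoI) (auto intro!: step_antimono h)
  moreover have "continuous (at_right x) (f N)" for N x
    unfolding f_def by (rule step_exp_right_continuous[OF h])
  moreover have f01: "\<bar>f N x\<bar> \<le> 1" for N x
    unfolding f_def by (auto intro!: step_nonneg h)
  ultimately obtain \<sigma> F where \<sigma>: "strict_mono \<sigma>" and F: "mono F" "\<And>x. \<bar>F x\<bar> \<le> 1"
    and lim: "\<And>x. isCont F x \<Longrightarrow> (\<lambda>n. f (\<sigma> n) x) \<longlonglongrightarrow> F x"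
    using Helly_selection[of f 1] by blast
  have countable: "countable {x. \<not> isCont F x}" by (rule mono_ctble_discont[OF F(1)])
  have F_lower: "exp (- 1 / K (t / 2)) \<le> F t" if t: "0 < t" for t
  proof -
    \<comment> \<open>Convergence is known at points of continuity only. One of them lies between \<open>t / 2\<close> and \<open>t\<close>, at
      the price of the argument \<open>t / 2\<close> in the bound.\<close>
    have "\<exists>x\<in>{t/2<..<t}. isCont F x"
    proof (rule ccontr)
      assume "\<not> ?thesis"
      then have "{t/2<..<t} \<subseteq> {x. \<not> isCont F x}" by auto
      then show False using countable countable_subset uncountable_open_interval[of "t/2" t] t by auto
    qed
    then obtain x where x: "t / 2 < x" "x < t" "isCont F x" by auto
    have "exp (- 1 / K (t / 2)) \<le> f (\<sigma> n) x" for n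
    proof -
      have "step (h (\<sigma> n)) x \<le> 1 / K x"
        using step_K[OF h, of x "\<sigma> n"] K_pos[of x] x t by (simp add: field_simps)
      also have "\<dots> \<le> 1 / K (t / 2)" using x t by (intro divide_left_mono K_mono mult_pos_pos K_pos) auto
      finally show ?thesis using x t by (simp add: f_def)
    qed
    then have "exp (- 1 / K (t / 2)) \<le> F x" by (intro LIMSEQ_le_const[OF lim[OF x(3)]]) auto
    also have "\<dots> \<le> F t" using F(1) x by (simp add: monoD)
    finally show ?thesis .
  qed
  have F_pos: "0 < F t" if "0 < t" for t
    by (rule less_le_trans[OF exp_gt_zero F_lower[OF that]])
  \<comment> \<open>undo the passage to \<open>exp (- step h t)\<close>\<close>
  define r where "r t = (if t \<le> 0 then 0 else - ln (F t))" for t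
  have [measurable]: "F \<in> borel_measurable borel" using F(1) by (rule borel_measurable_mono)
  have r_meas [measurable]: "r \<in> borel_measurable borel" unfolding r_def[abs_def] by measurable
  have r_nonneg: "0 \<le> r t" for t
    using F_pos[of t] F(2)[of t] by (auto simp: r_def)
  have r_anti: "r t \<le> r s" if "0 < s" "s \<le> t" for s t
    using F_pos[of s] F_pos[of t] that monoD[OF F(1), of s t] by (auto simp: r_def)
  have r_K: "r t * K (t / 2) \<le> 1" if t: "0 < t" for t
  proof -
    have "- 1 / K (t / 2) \<le> ln (F t)" using F_lower[OF t] F_pos[OF t] by (simp add: ln_ge_iff)
    then show ?thesis using K_pos[of "t/2"] t by (simp add: r_def field_simps)
  qed
  have r_lim: "(\<lambda>n. step (h (\<sigma> n)) s) \<longlonglongrightarrow> r s" if s: "0 < s" "isCont F s" for s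
  proof -
    have "(\<lambda>n. - ln (f (\<sigma> n) s)) \<longlonglongrightarrow> - ln (F s)"
      using F_pos[OF s(1)] by (intro tendsto_intros lim s(2)) auto
    then show ?thesis using s by (simp add: f_def r_def)
  qed
  have "conv k r (real (Suc p) / 2 ^ N) = 1" for N p
  proof -
    let ?t = "real (Suc p) / 2 ^ N"
    have ev1: "\<forall>\<^sub>F n in sequentially. conv k (step (h (\<sigma> n))) ?t = 1"
    proof (rule eventually_sequentiallyI)
      fix n assume "N \<le> n"
      then have le: "N \<le> \<sigma> n" using seq_suble[OF \<sigma>, of n] by linarith
      have "?t = real (Suc p * 2 ^ (\<sigma> n - N)) * h (\<sigma> n)"
      proof -
        obtain d where "\<sigma> n = N + d" using le le_Suc_ex by blast
        then show ?thesis by (simp add: h_def power_add field_simps)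
      qed
      moreover have "Suc p * 2 ^ (\<sigma> n - N) = Suc (Suc p * 2 ^ (\<sigma> n - N) - 1)" by simp
      ultimately show "conv k (step (h (\<sigma> n))) ?t = 1"
        using conv_step_grid[OF h] by metis
    qed
    have "(\<lambda>n. conv k (step (h (\<sigma> n))) ?t) \<longlonglongrightarrow> conv k r ?t"
      unfolding conv_def
    proof (rule integral_dominated_convergence)
      show "integrable lborel (\<lambda>s. 1 / c * (k (?t - s) * (indicator {0<..} s * s powr - \<beta>)))"
        by (intro integrable_mult_right integrable_dominating) simp
      have ne: "AE s in lborel. s \<noteq> 0 \<and> isCont F s"
        using AE_not_in[OF countable_imp_null_set_lborel[OF countable]] AE_lborel_singleton[of 0]
        by eventually_elim auto
      then show "AE s in lborel. (\<lambda>n. k (?t - s) * step (h (\<sigma> n)) s) \<longlonglongrightarrow> k (?t - s) * r s"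
      proof eventually_elim
        case (elim s)
        show ?case
        proof (cases "0 < s")
          case True
          then show ?thesis using elim by (intro tendsto_mult tendsto_const r_lim) auto
        qed (use elim in \<open>simp add: step_def r_def\<close>)
      qed
      show "AE s in lborel. norm (k (?t - s) * step (h (\<sigma> n)) s)
          \<le> 1 / c * (k (?t - s) * (indicator {0<..} s * s powr - \<beta>))" for n
        using ne
      proof eventually_elim
        case (elim s)
        show ?case
        proof (cases "0 < s")
          case True
          then have "k (?t - s) * step (h (\<sigma> n)) s \<le> k (?t - s) * (s powr - \<beta> / c)"
            by (intro mult_left_mono step_le h nonneg)
          then show ?thesis using True by (simp add: nonneg step_nonneg h)
        qed (use elim in \<open>simp add: step_def\<close>)
      qed
    qed auto
    then show ?thesis
      using LIMSEQ_unique tendsto_eventually[OF ev1] by blast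
  qed
  then show ?thesis
    using r_meas r_nonneg r_anti r_K by (intro exI[of _ r]) (auto simp: r_def)
qed

text \<open>
  When \<open>t\<close> grows to \<open>t'\<close>, the part of the integral with \<open>k\<close> on \<open>{0<..<t}\<close> decreases together with
  \<open>r\<close>, and on the new part \<open>k\<close> is at most \<open>k t\<close>.
\<close>

lemma conv_increment_le:
  assumes [measurable]: "r \<in> borel_measurable borel" and r0: "\<And>t. t \<le> 0 \<Longrightarrow> r t = 0" and r: "\<And>t. 0 \<le> r t"
    and r_anti: "\<And>s t. 0 < s \<Longrightarrow> s \<le> t \<Longrightarrow> r t \<le> r s"
    and r_bound: "\<And>s. 0 < s \<Longrightarrow> r s \<le> C * s powr - \<beta>"
    and t: "0 < t" "t < t'"
  shows "conv k r t' \<le> conv k r t + k t * (C * (t' - t) powr (1 - \<beta>) / (1 - \<beta>))"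
proof -
  have int_kr: "integrable lborel (\<lambda>s. k s * r (t - s))" if t: "0 < t" for t
  proof -
    have "integrable lborel (\<lambda>s. k (t - s) * r s)"
    proof (rule Bochner_Integration.integrable_bound)
      show "integrable lborel (\<lambda>s. C * (k (t - s) * (indicator {0<..} s * s powr - \<beta>)))"
        by (intro integrable_mult_right integrable_dominating t)
      have "k (t - s) * r s \<le> k (t - s) * (C * s powr - \<beta>)" if "0 < s" for s
        using that r_bound nonneg by (intro mult_left_mono) auto
      moreover have "0 \<le> C" using r_bound[of 1] r[of 1] by simp
      ultimately show "AE s in lborel. norm (k (t - s) * r s) \<le> norm (C * (k (t - s) * (indicator {0<..} s * s powr - \<beta>)))"
        by (intro AE_I2) (auto split: split_indicator simp: r0 r nonneg not_less abs_mult mult_ac intro: order_trans[OF _ abs_ge_self])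
    qed simp
    from lborel_integrable_real_affine[OF this, of "-1" t] show ?thesis by simp
  qed
  have dom: "has_bochner_integral lborel (\<lambda>s. indicator {0<..t' - t} s * s powr - \<beta>) ((t' - t) powr (1 - \<beta>) / (1 - \<beta>))"
    using has_bochner_integral_powr[of "-\<beta>" "t' - t"] \<beta> t by (simp add: add.commute)
  have int_r: "integrable lborel (\<lambda>s. indicator {0<..t' - t} s * r s)"
  proof (rule Bochner_Integration.integrable_bound)
    show "integrable lborel (\<lambda>s. C * (indicator {0<..t' - t} s * s powr - \<beta>))"
      using dom by (simp add: has_bochner_integral_iff)
    show "AE s in lborel. norm (indicator {0<..t' - t} s * r s) \<le> norm (C * (indicator {0<..t' - t} s * s powr - \<beta>))"
      by (intro AE_I2) (auto split: split_indicator simp: r intro: order_trans[OF r_bound])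
  qed simp
  then have int_r': "integrable lborel (\<lambda>s. indicator {0<..t' - t} (t' + - 1 * s) * r (t' + - 1 * s))"
    by (rule lborel_integrable_real_affine) simp
  have "conv k r t' = (LBINT s. k s * r (t' - s))"
    unfolding conv_comm[of k] by (simp add: conv_def mult.commute)
  also have "\<dots> \<le> (LBINT s. k s * r (t - s) + k t * (indicator {0<..t' - t} (t' + - 1 * s) * r (t' + - 1 * s)))"
  proof (intro integral_mono int_kr Bochner_Integration.integrable_add integrable_mult_right int_r')
    fix s
    consider "s \<le> 0" | "0 < s" "s < t" | "t \<le> s" "s < t'" | "t' \<le> s" using t by linarith
    then show "k s * r (t' - s) \<le> k s * r (t - s) + k t * (indicator {0<..t' - t} (t' + - 1 * s) * r (t' + - 1 * s))"
    proof cases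
      case 1
      then show ?thesis by (simp add: zero r nonneg)
    next
      case 2
      then have "k s * r (t' - s) \<le> k s * r (t - s)" using t by (intro mult_left_mono r_anti nonneg) auto
      moreover have "0 \<le> k t * (indicator {0<..t' - t} (t' + - 1 * s) * r (t' + - 1 * s))"
        by (simp add: r nonneg)
      ultimately show ?thesis by linarith
    next
      case 3
      then have "k s * r (t' - s) \<le> k t * r (t' - s)" using t by (intro mult_right_mono anti r) auto
      moreover have "0 \<le> k s * r (t - s)" by (simp add: r nonneg)
      ultimately have "k s * r (t' - s) \<le> k s * r (t - s) + k t * r (t' - s)" by linarith
      then show ?thesis using 3 by simp
    qed (simp add: r0 r nonneg)
  qed (use t in auto)
  also have "\<dots> = conv k r t + k t * (LBINT s. indicator {0<..t' - t} (t' + - 1 * s) * r (t' + - 1 * s))"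
    unfolding conv_comm[of k] using int_kr[OF t(1)] int_r'
    by (simp add: conv_def mult.commute)
  also have "(LBINT s. indicator {0<..t' - t} (t' + - 1 * s) * r (t' + - 1 * s)) = (LBINT s. indicator {0<..t' - t} s * r s)"
    by (subst (2) lborel_integral_real_affine[where c="-1" and t=t']) simp_all
  also have "\<dots> \<le> (LBINT s. C * (indicator {0<..t' - t} s * s powr - \<beta>))"
    using dom by (intro integral_mono int_r) (auto split: split_indicator simp: has_bochner_integral_iff r_bound)
  also have "\<dots> = C * (t' - t) powr (1 - \<beta>) / (1 - \<beta>)"
    using dom by (simp add: has_bochner_integral_iff)
  finally show ?thesis by (simp add: mult_left_mono nonneg)
qed

text \<open>
  The equation extends from dyadic points to all \<open>t\<close>: neighbouring dyadic points below and above
  bound \<open>conv k r t\<close> from above and below by \<open>conv_increment_le\<close>.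
\<close>

theorem resolvent_exists:
  "\<exists>r. r \<in> borel_measurable borel \<and> (\<forall>t\<le>0. r t = 0) \<and> (\<forall>t. 0 \<le> r t) \<and>
     (\<forall>t>0. r t * K (t / 2) \<le> 1) \<and> (\<forall>t>0. conv k r t = 1)"
proof -
  obtain r where [measurable]: "r \<in> borel_measurable borel"
    and r: "\<And>t. t \<le> 0 \<Longrightarrow> r t = 0" "\<And>t. 0 \<le> r t" "\<And>s t. 0 < s \<Longrightarrow> s \<le> t \<Longrightarrow> r t \<le> r s"
    and r_K: "\<And>t. 0 < t \<Longrightarrow> r t * K (t / 2) \<le> 1"
    and grid: "\<And>N p. conv k r (real (Suc p) / 2 ^ N) = 1"
    using resolvent_on_grid by blast
  define C where "C = 2 powr \<beta> / c"
  have r_bound: "r s \<le> C * s powr - \<beta>" if s: "0 < s" for s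
  proof -
    have "r s \<le> 1 / K (s / 2)" using r_K[OF s] K_pos[of "s/2"] s by (simp add: field_simps)
    also have "\<dots> \<le> (s / 2) powr - \<beta> / c" using s by (intro inverse_K_le) simp
    also have "\<dots> = C * s powr - \<beta>" using s by (simp add: C_def powr_divide powr_minus field_simps)
    finally show ?thesis .
  qed
  have "0 \<le> C" using c by (simp add: C_def)
  note incr = conv_increment_le[OF \<open>r \<in> borel_measurable borel\<close> r r_bound]
  have "conv k r t = 1" if t: "0 < t" for t
  proof -
    define e where "e N = C * (1 / 2 ^ N) powr (1 - \<beta>) / (1 - \<beta>)" for N :: nat
    have e: "e \<longlonglongrightarrow> 0"
    proof -
      have "(\<lambda>N::nat. (1 / 2 ^ N :: real)) \<longlonglongrightarrow> 0" by real_asymp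
      then have "(\<lambda>N::nat. (1 / 2 ^ N :: real) powr (1 - \<beta>)) \<longlonglongrightarrow> 0 powr (1 - \<beta>)"
        using \<beta> by (intro tendsto_powr') auto
      from tendsto_mult_left[OF this, of "C / (1 - \<beta>)"] show ?thesis by (simp add: e_def[abs_def])
    qed
    have e_ge: "C * d powr (1 - \<beta>) / (1 - \<beta>) \<le> e N" if "0 < d" "d \<le> 1 / 2 ^ N" for d N
      unfolding e_def using that \<beta> \<open>0 \<le> C\<close> by (intro divide_right_mono mult_left_mono powr_mono2) auto
    have "\<forall>\<^sub>F N in sequentially. (1 / 2 ^ N :: real) < t / 2"
      by (rule order_tendstoD(2)[of _ 0]) (use t in \<open>real_asymp | simp\<close>)+
    then have ev: "\<forall>\<^sub>F N in sequentially. conv k r t \<le> 1 + k (t / 2) * e N \<and> 1 \<le> conv k r t + k t * e N"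
    proof eventually_elim
      case (elim N)
      \<comment> \<open>rounding up and subtracting \<open>1\<close> keeps the lower dyadic point strictly below \<open>t\<close>\<close>
      define p where "p = nat (\<lceil>t * 2 ^ N\<rceil> - 1)"
      have tN: "1 < t * 2 ^ N" using elim t by (simp add: field_simps)
      then have p: "real p < t * 2 ^ N" "t * 2 ^ N \<le> real (Suc p)"
        unfolding p_def by linarith+
      then have p_pos: "0 < p" using tN by (cases p) auto
      define t1 t2 where "t1 = real p / 2 ^ N" and "t2 = real (Suc p) / 2 ^ N"
      have t12: "t1 < t" "t \<le> t2" "t2 - t1 = 1 / 2 ^ N" "t / 2 < t1" "0 < t1"
        using p elim t p_pos by (auto simp: t1_def t2_def field_simps)
      have 1: "conv k r t1 = 1" "conv k r t2 = 1"
        using grid[of p N] grid[of "p - 1" N] p_pos by (auto simp: t1_def t2_def)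
      have "conv k r t \<le> 1 + k t1 * (C * (t - t1) powr (1 - \<beta>) / (1 - \<beta>))"
        using incr[of t1 t] t12 1 by simp
      also have "\<dots> \<le> 1 + k (t / 2) * e N"
        using t12 t \<beta> \<open>0 \<le> C\<close> by (intro add_left_mono mult_mono anti e_ge) (auto simp: nonneg)
      finally have A: "conv k r t \<le> 1 + k (t / 2) * e N" .
      have "1 \<le> conv k r t + k t * e N"
      proof (cases "t = t2")
        case True
        then show ?thesis using 1 \<beta> \<open>0 \<le> C\<close> by (simp add: e_def nonneg)
      next
        case False
        then have "1 \<le> conv k r t + k t * (C * (t2 - t) powr (1 - \<beta>) / (1 - \<beta>))"
          using incr[of t t2] t12 1 t by simp
        also have "\<dots> \<le> conv k r t + k t * e N"
          using t12 False by (intro add_left_mono mult_left_mono e_ge nonneg) auto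
        finally show ?thesis .
      qed
      with A show ?case by blast
    qed
    have l1: "(\<lambda>N. 1 + k (t / 2) * e N) \<longlonglongrightarrow> 1 + k (t / 2) * 0"
      and l2: "(\<lambda>N. conv k r t + k t * e N) \<longlonglongrightarrow> conv k r t + k t * 0"
      by (intro tendsto_intros e)+
    have "conv k r t \<le> 1"
      using tendsto_le[OF trivial_limit_sequentially l1 tendsto_const[of "conv k r t"]] ev
      by (simp add: eventually_conj_iff)
    moreover have "1 \<le> conv k r t"
      using tendsto_le[OF trivial_limit_sequentially l2 tendsto_const[of 1]] ev
      by (simp add: eventually_conj_iff)
    ultimately show ?thesis by simp
  qed
  then show ?thesis using r r_K by (intro exI[of _ r]) auto
qed

end

section \<open>Volterra equations of the first kind\<close>

text \<open>
  The positive and the negative part of \<open>w\<close> are densities of two finite measures with the same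
  distribution function. As the primitive is assumed to vanish almost everywhere only, continuity
  is used first to make it vanish everywhere.
\<close>

lemma AE_zero_if_primitive_zero:
  fixes w :: "real \<Rightarrow> real"
  assumes w: "integrable lborel w" and w0: "\<And>t. t \<notin> {0<..<T} \<Longrightarrow> w t = 0" and T: "0 < T"
    and prim: "AE t\<in>{0<..<T} in lborel. (LBINT s. indicator {0<..<t} s * w s) = 0"
  shows "AE t in lborel. w t = 0"
proof -
  have [measurable]: "w \<in> borel_measurable borel" using w by auto
  have ind: "integrable lborel (\<lambda>s. indicator A s * w s)" if "A \<in> sets borel" for A :: "real set"
    using integrable_mult_indicator[of A lborel w] that w by simp
  have lt: "(LBINT s. indicator {0<..<t} s * w s) = 0" if t: "0 < t" "t \<le> T" for t
  proof -
    have "\<exists>s. s < t \<and> t - t / real (Suc n) < s \<and> (LBINT x. indicator {0<..<s} x * w x) = 0" for n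
    proof (rule ccontr)
      let ?I = "{t - t / real (Suc n)<..<t}"
      assume neg: "\<nexists>s. s < t \<and> t - t / real (Suc n) < s \<and> (LBINT x. indicator {0<..<s} x * w x) = 0"
      have "t / real (Suc n) \<le> t" using t by (simp add: field_simps)
      then have I: "?I \<subseteq> {0<..<T}" using t by auto
      have "AE s in lborel. s \<notin> ?I" using prim by eventually_elim (use neg I in auto)
      then have "emeasure lborel ?I = 0"
        by (subst (asm) AE_iff_null_sets[symmetric]) auto
      then show False using t by simp
    qed
    then obtain s where s: "\<And>n. s n < t" "\<And>n. t - t / real (Suc n) < s n"
      and zero: "\<And>n. (LBINT x. indicator {0<..<s n} x * w x) = 0" by metis
    have s_lim: "s \<longlonglongrightarrow> t"
    proof (rule tendsto_sandwich)
      show "\<forall>\<^sub>F n in sequentially. t - t / real (Suc n) \<le> s n" "\<forall>\<^sub>F n in sequentially. s n \<le> t"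
        using s by (auto intro!: always_eventually less_imp_le)
      show "(\<lambda>n. t - t / real (Suc n)) \<longlonglongrightarrow> t" by real_asymp
    qed simp
    have "(\<lambda>n. \<integral>x. indicator {0<..<s n} x * w x \<partial>lborel) \<longlonglongrightarrow> (LBINT x. indicator {0<..<t} x * w x)"
    proof (rule integral_dominated_convergence[OF _ _ integrable_abs[OF w]])
      show "AE x in lborel. (\<lambda>n. indicator {0<..<s n} x * w x) \<longlonglongrightarrow> indicator {0<..<t} x * w x"
      proof (intro AE_I2)
        fix x
        show "(\<lambda>n. indicator {0<..<s n} x * w x) \<longlonglongrightarrow> indicator {0<..<t} x * w x"
        proof (cases "x < t")
          case True
          then have "\<forall>\<^sub>F n in sequentially. x < s n" by (intro order_tendstoD(1)[OF s_lim])
          then have "\<forall>\<^sub>F n in sequentially. indicator {0<..<t} x * w x = indicator {0<..<s n} x * w x"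
            by eventually_elim (use True in \<open>auto split: split_indicator\<close>)
          then show ?thesis by (rule Lim_transform_eventually[OF tendsto_const])
        next
          case False
          then have "indicator {0<..<s n} x * w x = indicator {0<..<t} x * w x" for n
            using s(1)[of n] by (auto split: split_indicator)
          then show ?thesis by (simp only: tendsto_const)
        qed
      qed
    qed (auto split: split_indicator)
    then show ?thesis using zero by (simp add: LIMSEQ_const_iff)
  qed
  have Iic: "(LBINT s. indicator {..x} s * w s) = 0" for x
  proof -
    have "(LBINT s. indicator {..x} s * w s) = (LBINT s. indicator {0<..<min x T} s * w s)"
    proof (rule integral_cong_AE)
      show "AE s in lborel. indicator {..x} s * w s = indicator {0<..<min x T} s * w s"
        using AE_lborel_singleton[of x] by eventually_elim (auto split: split_indicator simp: w0)
    qed auto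
    also have "\<dots> = 0" using lt[of "min x T"] T by (cases "0 < x") auto
    finally show ?thesis .
  qed
  define M1 where "M1 = density lborel (\<lambda>x. ennreal (w x))"
  define M2 where "M2 = density lborel (\<lambda>x. ennreal (- w x))"
  have fin: "(\<integral>\<^sup>+x. ennreal (w x) \<partial>lborel) < \<infinity>" "(\<integral>\<^sup>+x. ennreal (- w x) \<partial>lborel) < \<infinity>"
    using w by (auto simp: real_integrable_def less_top)
  have sets: "sets M1 = sets borel" "sets M2 = sets borel" by (auto simp: M1_def M2_def)
  have "emeasure M1 (space M1) \<noteq> \<infinity>" "emeasure M2 (space M2) \<noteq> \<infinity>"
    unfolding M1_def M2_def using fin by (subst emeasure_density; simp)+
  then have fm: "finite_borel_measure M1" "finite_borel_measure M2"
    by (intro finite_borel_measure.intro finite_borel_measure_axioms.intro finite_measureI sets; simp)+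
  have "M1 = M2"
  proof (rule cdf_unique'[OF fm])
    show "cdf M1 = cdf M2"
    proof
      fix x
      let ?g = "\<lambda>s. indicator {..x} s * w s"
      have g: "integrable lborel ?g" by (rule ind) simp
      have eq1: "emeasure M1 {..x} = (\<integral>\<^sup>+s. ennreal (?g s) \<partial>lborel)"
        unfolding M1_def by (subst emeasure_density) (auto intro!: nn_integral_cong split: split_indicator)
      have eq2: "emeasure M2 {..x} = (\<integral>\<^sup>+s. ennreal (- ?g s) \<partial>lborel)"
        unfolding M2_def by (subst emeasure_density) (auto intro!: nn_integral_cong split: split_indicator)
      have "enn2real (\<integral>\<^sup>+s. ennreal (?g s) \<partial>lborel) - enn2real (\<integral>\<^sup>+s. ennreal (- ?g s) \<partial>lborel) = 0"
        using real_lebesgue_integral_def[OF g] Iic by simp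
      then show "cdf M1 x = cdf M2 x"
        unfolding cdf_def measure_def eq1 eq2 by simp
    qed
  qed
  then have "AE x in lborel. ennreal (w x) = ennreal (- w x)"
    unfolding M1_def M2_def by (subst (asm) sigma_finite_measure.density_unique_iff[OF sigma_finite_lborel]) auto
  then show ?thesis
  proof eventually_elim
    case (elim x)
    have "w x = max 0 (w x) - max 0 (- w x)" by simp
    also have "max 0 (w x) = max 0 (- w x)"
      using elim by (metis enn2real_ennreal ennreal_max_0 max.cobounded1)
    finally show ?case by simp
  qed
qed

text \<open>
  \<open>k * (r * f) = (k * r) * f\<close>, where \<open>k * r\<close> is the indicator of \<open>{0<..}\<close> on \<open>{..<T}\<close>.
\<close>

lemma volterra_solution:
  fixes k r f :: "real \<Rightarrow> real"
  assumes k: "integrable lborel k" "\<And>t. t \<le> 0 \<Longrightarrow> k t = 0"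
    and r: "integrable lborel r" "\<And>t. t \<le> 0 \<Longrightarrow> r t = 0"
    and res: "\<And>t. 0 < t \<Longrightarrow> t < T \<Longrightarrow> conv k r t = 1"
    and f: "integrable lborel f" "\<And>t. t \<le> 0 \<Longrightarrow> f t = 0"
  shows "AE t\<in>{0<..<T} in lborel. conv k (conv r f) t = (LBINT s. indicator {0<..<t} s * f s)"
  using conv_assoc_AE[OF k(1) r(1) f(1)]
proof eventually_elim
  case (elim t)
  show ?case
  proof
    assume t: "t \<in> {0<..<T}"
    have "(\<lambda>s. conv k r (t - s) * f s) = (\<lambda>s. indicator {0<..<t} s * f s)"
    proof
      fix s show "conv k r (t - s) * f s = indicator {0<..<t} s * f s"
      using conv_zero_left[of k r "t - s"] res[of "t - s"] k(2) r(2) f(2)[of s] t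
      by (cases "s \<le> 0"; cases "t \<le> s") auto
    qed
    then show "conv k (conv r f) t = (LBINT s. indicator {0<..<t} s * f s)"
      unfolding elim by (simp add: conv_def[of "conv k r"])
  qed
qed

text \<open>
  Convolving the equation with \<open>r\<close> gives \<open>(r * k) * w = 0\<close>, and \<open>(r * k) * w\<close> is the primitive of
  \<open>w\<close>.
\<close>

lemma volterra_unique:
  fixes k r w :: "real \<Rightarrow> real"
  assumes k: "integrable lborel k" "\<And>t. t \<le> 0 \<Longrightarrow> k t = 0"
    and r: "integrable lborel r" "\<And>t. t \<le> 0 \<Longrightarrow> r t = 0"
    and res: "\<And>t. 0 < t \<Longrightarrow> t < T \<Longrightarrow> conv k r t = 1"
    and w: "integrable lborel w" "\<And>t. t \<notin> {0<..<T} \<Longrightarrow> w t = 0" and T: "0 < T"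
    and eq: "AE t\<in>{0<..<T} in lborel. conv k w t = 0"
  shows "AE t in lborel. w t = 0"
proof (rule AE_zero_if_primitive_zero[OF w T])
  have [measurable]: "k \<in> borel_measurable borel" "r \<in> borel_measurable borel" "w \<in> borel_measurable borel"
    using k r w by auto
  have "AE t\<in>{0<..<T} in lborel. conv r (conv k w) t = (LBINT s. indicator {0<..<t} s * w s)"
    by (rule volterra_solution[OF r k]) (use res w conv_comm in auto)
  then show "AE t\<in>{0<..<T} in lborel. (LBINT s. indicator {0<..<t} s * w s) = 0"
  proof eventually_elim
    case (elim t)
    show ?case
    proof
      assume t: "t \<in> {0<..<T}"
      have "conv r (conv k w) t = conv r (\<lambda>_. 0) t"
      proof (rule conv_cong_AE)
        show "AE s in lborel. r (t - s) * conv k w s = r (t - s) * 0"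
          using eq
        proof eventually_elim
          case (elim s)
          then show ?case
            using conv_zero_left[of k w s] k(2) w(2) r(2)[of "t - s"] t
            by (cases "s \<le> 0"; cases "t \<le> s") auto
        qed
      qed measurable
      then show "(LBINT s. indicator {0<..<t} s * w s) = 0"
        using elim t by (simp add: conv_def)
    qed
  qed
qed

section \<open>Sums of powers\<close>

definition power_kernel :: "'i set \<Rightarrow> ('i \<Rightarrow> real) \<Rightarrow> ('i \<Rightarrow> real) \<Rightarrow> real \<Rightarrow> real" where
  "power_kernel J c a t = (if t \<le> 0 then 0 else \<Sum>j\<in>J. c j * t powr - a j)"

lemma power_kernel_measurable [measurable]: "power_kernel J c a \<in> borel_measurable borel"
  unfolding power_kernel_def[abs_def] by measurable

text \<open>
  A negative power is log-convex by the inequality between arithmetic and geometric mean; the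
  Cauchy-Schwarz inequality extends this to sums.
\<close>

lemma power_kernel_log_convex:
  assumes c: "\<And>j. j \<in> J \<Longrightarrow> 0 \<le> c j" and a: "\<And>j. j \<in> J \<Longrightarrow> 0 \<le> a j" and t: "0 < t" "0 < h"
  shows "(power_kernel J c a (t + h))\<^sup>2 \<le> power_kernel J c a t * power_kernel J c a (t + 2 * h)"
proof -
  let ?A = "\<lambda>x j. sqrt (c j) * x powr (- a j / 2)"
  have sq: "(?A x j)\<^sup>2 = c j * x powr - a j" if "j \<in> J" "0 < x" for j x
    using c[OF that(1)] that(2) by (simp add: power_mult_distrib power2_eq_square[of "_ powr _"] flip: powr_add)
  have "(\<Sum>j\<in>J. c j * (t + h) powr - a j) \<le> (\<Sum>j\<in>J. ?A t j * ?A (t + 2 * h) j)"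
  proof (intro sum_mono)
    fix j assume j: "j \<in> J"
    have "(t + h) powr - a j = ((t + h)\<^sup>2) powr (- a j / 2)"
      using t by (simp add: powr_powr flip: powr_numeral)
    also have "\<dots> \<le> (t * (t + 2 * h)) powr (- a j / 2)"
      using t a[OF j] by (intro powr_mono2' mult_pos_pos) (auto simp: power2_eq_square algebra_simps)
    also have "\<dots> = t powr (- a j / 2) * (t + 2 * h) powr (- a j / 2)"
      using t by (simp add: powr_mult)
    finally have "c j * (t + h) powr - a j \<le> (sqrt (c j) * sqrt (c j)) * (t powr (- a j / 2) * (t + 2 * h) powr (- a j / 2))"
      using c[OF j] by (simp add: mult_left_mono)
    then show "c j * (t + h) powr - a j \<le> ?A t j * ?A (t + 2 * h) j"
      by (simp only: mult_ac)
  qed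
  moreover have "0 \<le> (\<Sum>j\<in>J. c j * (t + h) powr - a j)" using c by (intro sum_nonneg) auto
  ultimately have "(\<Sum>j\<in>J. c j * (t + h) powr - a j)\<^sup>2 \<le> (\<Sum>j\<in>J. ?A t j * ?A (t + 2 * h) j)\<^sup>2"
    by (intro power_mono)
  also have "\<dots> \<le> (\<Sum>j\<in>J. (?A t j)\<^sup>2) * (\<Sum>j\<in>J. (?A (t + 2 * h) j)\<^sup>2)"
    by (rule Cauchy_Schwarz_ineq_sum)
  also have "\<dots> = (\<Sum>j\<in>J. c j * t powr - a j) * (\<Sum>j\<in>J. c j * (t + 2 * h) powr - a j)"
    using sq t by (intro arg_cong2[where f="(*)"] sum.cong) auto
  finally show ?thesis using t by (simp add: power_kernel_def)
qed

lemma integrable_power_kernel: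
  assumes "\<And>j. j \<in> J \<Longrightarrow> a j < 1"
  shows "integrable lborel (\<lambda>s. indicator {0<..t} s * power_kernel J c a s)"
proof (cases "0 < t")
  case True
  have "integrable lborel (\<lambda>s. \<Sum>j\<in>J. c j * (indicator {0<..t} s * s powr - a j))"
  proof (intro Bochner_Integration.integrable_sum integrable_mult_right)
    fix j assume "j \<in> J"
    then show "integrable lborel (\<lambda>s. indicator {0<..t} s * s powr - a j)"
      using has_bochner_integral_powr[of "- a j" t] assms[of j] True by (simp add: has_bochner_integral_iff)
  qed
  then show ?thesis
    by (rule Bochner_Integration.integrable_cong[THEN iffD1, rotated 2])
       (auto simp: power_kernel_def sum_distrib_left mult_ac split: split_indicator)
qed simp

lemma log_convex_power_kernel:
  assumes J: "finite J" "i \<in> J" and c: "\<And>j. j \<in> J \<Longrightarrow> 0 \<le> c j" and a: "\<And>j. j \<in> J \<Longrightarrow> 0 \<le> a j \<and> a j < 1"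
    and i: "0 < c i" "0 < a i"
  shows "log_convex_kernel (power_kernel J c a) (1 - a i) (c i)"
proof
  show "power_kernel J c a t \<le> power_kernel J c a s" if "0 < s" "s \<le> t" for s t
    unfolding power_kernel_def using that a c by (auto intro!: sum_mono mult_left_mono powr_mono2')
  show "c i * t powr (1 - a i - 1) \<le> power_kernel J c a t" if "0 < t" for t
    using member_le_sum[OF J(2), of "\<lambda>j. c j * t powr - a j"] J(1) c that by (auto simp: power_kernel_def)
  show "(power_kernel J c a (t + h))\<^sup>2 \<le> power_kernel J c a t * power_kernel J c a (t + 2 * h)"
    if "0 < t" "0 < h" for t h
    using that a c by (intro power_kernel_log_convex) auto
  show "integrable lborel (\<lambda>s. indicator {0<..t} s * power_kernel J c a s)" for t
    using a by (intro integrable_power_kernel) auto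
qed (use a[OF J(2)] i in \<open>auto simp: power_kernel_def\<close>)

text \<open>
  The two pointwise bounds come from \<open>r t * K (t / 2) \<le> 1\<close> by keeping a single term of the kernel:
  the power with index \<open>i\<close>, or the constant with index \<open>z\<close>. The first bound does not involve \<open>c z\<close>,
  which will be an eigenvalue. The bound on the mass is the equation at time \<open>T\<close>, where the kernel
  is at least \<open>c z\<close>.
\<close>

lemma resolvent_bounds:
  assumes J: "finite J" "i \<in> J" "z \<in> J" and c0: "\<And>j. j \<in> J \<Longrightarrow> 0 \<le> c j"
    and a: "\<And>j. j \<in> J \<Longrightarrow> 0 \<le> a j \<and> a j < 1"
    and i: "0 < c i" "0 < a i" and z: "0 < c z" "a z = 0" and T: "0 < T"
  shows "\<exists>r. r \<in> borel_measurable borel \<and> (\<forall>t. t \<notin> {0<..<T} \<longrightarrow> r t = 0) \<and> (\<forall>t. 0 \<le> r t) \<and>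
    (\<forall>t\<in>{0<..<T}. r t \<le> 2 powr (1 - a i) / c i * t powr (a i - 1)) \<and>
    (\<forall>t\<in>{0<..<T}. c z * t * r t \<le> 2) \<and> integrable lborel r \<and> c z * (LBINT t. r t) \<le> 1 \<and>
    (\<forall>t. 0 < t \<longrightarrow> t < T \<longrightarrow> conv (trunc T (power_kernel J c a)) r t = 1)"
proof -
  let ?k = "power_kernel J c a"
  interpret log_convex_kernel ?k "1 - a i" "c i"
    by (rule log_convex_power_kernel) (use J c0 a i in auto)
  obtain r where r_meas [measurable]: "r \<in> borel_measurable borel"
    and r: "\<And>t. t \<le> 0 \<Longrightarrow> r t = 0" "\<And>t. 0 \<le> r t"
    and r_K: "\<And>t. 0 < t \<Longrightarrow> r t * K (t / 2) \<le> 1"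
    and res: "\<And>t. 0 < t \<Longrightarrow> conv ?k r t = 1"
    using resolvent_exists by blast
  have k_ge: "c z \<le> ?k t" if "0 < t" for t
    using member_le_sum[OF J(3), of "\<lambda>j. c j * t powr - a j"] J(1) c0 that z(2) by (auto simp: power_kernel_def)
  have b1: "r t \<le> 2 powr (1 - a i) / c i * t powr (a i - 1)" if t: "0 < t" for t
  proof -
    have "r t \<le> 1 / K (t / 2)" using r_K[OF t] K_pos[of "t/2"] t by (simp add: field_simps)
    also have "\<dots> \<le> (t / 2) powr - (1 - a i) / c i" using t by (intro inverse_K_le) simp
    also have "\<dots> = 2 powr (1 - a i) / c i * t powr (a i - 1)"
      using t powr_minus_divide[of 2 "a i - 1"] by (simp add: powr_divide)
    finally show ?thesis .
  qed
  have b2: "c z * t * r t \<le> 2" if t: "0 < t" for t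
  proof -
    have "t / 2 * c z \<le> t / 2 * ?k (t / 2)" using t by (intro mult_left_mono k_ge) auto
    also have "\<dots> \<le> K (t / 2)" using t by (intro K_ge) simp
    finally have "r t * (t / 2 * c z) \<le> 1"
      using r_K[OF t] mult_left_mono[OF _ r(2)] by (meson order_trans)
    then show ?thesis by (simp add: mult_ac)
  qed
  have int_r: "integrable lborel (trunc T r)"
  proof (rule Bochner_Integration.integrable_bound)
    show "integrable lborel (\<lambda>s. 2 powr (1 - a i) / c i * (indicator {0<..T} s * s powr (a i - 1)))"
      using has_bochner_integral_powr[of "a i - 1" T] i T by (simp add: has_bochner_integral_iff)
    show "AE s in lborel. norm (trunc T r s) \<le> norm (2 powr (1 - a i) / c i * (indicator {0<..T} s * s powr (a i - 1)))"
      using i by (intro AE_I2) (auto simp: trunc_def r split: split_indicator intro: order_trans[OF b1])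
  qed simp
  have "integrable lborel (\<lambda>s. ?k (T - s) * r s)"
    using res[OF T] not_integrable_integral_eq[of lborel "\<lambda>s. ?k (T - s) * r s"]
    by (auto simp: conv_def)
  then have "(LBINT s. c z * trunc T r s) \<le> (LBINT s. ?k (T - s) * r s)"
  proof (intro integral_mono integrable_mult_right int_r)
    fix s show "c z * trunc T r s \<le> ?k (T - s) * r s"
      by (cases "0 < s \<and> s < T") (auto simp: trunc_def r nonneg intro!: mult_right_mono k_ge)
  qed
  then have "c z * (LBINT s. trunc T r s) \<le> 1" using res[OF T] by (simp add: conv_def)
  moreover have "conv (trunc T ?k) (trunc T r) t = 1" if "0 < t" "t < T" for t
    using res[OF that(1)] that by (subst conv_trunc) (auto simp: zero r)
  ultimately show ?thesis
    using b1 b2 int_r r by (intro exI[of _ "trunc T r"]) (auto simp: trunc_def)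
qed

section \<open>Integral inequalities\<close>

text \<open>
  A convex function lies above its tangents; for powers this is Young's inequality.
\<close>

lemma powr_tangent:
  fixes x y p :: real
  assumes "1 \<le> p" "0 \<le> x" "0 \<le> y"
  shows "y powr p + p * y powr (p - 1) * (x - y) \<le> x powr p"
proof (cases "p = 1 \<or> y = 0")
  case True
  then show ?thesis using assms by (cases "y = 0") auto
next
  case False
  then have p: "1 < p" and y: "0 < y" using assms by auto
  have "x * y powr (p - 1) \<le> x powr p / p + (y powr (p - 1)) powr (p / (p - 1)) / (p / (p - 1))"
    using p assms by (intro Youngs_inequality) (auto simp: field_simps)
  also have "(y powr (p - 1)) powr (p / (p - 1)) = y powr p" using p by (simp add: powr_powr)
  finally have "p * (x * y powr (p - 1)) \<le> p * (x powr p / p + y powr p / (p / (p - 1)))"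
    using p by (intro mult_left_mono) auto
  also have "\<dots> = x powr p + (p - 1) * y powr p" using p by (simp add: field_simps)
  finally have "p * (x * y powr (p - 1)) \<le> x powr p + (p - 1) * y powr p" .
  moreover have "p * y powr (p - 1) * (x - y) = p * (x * y powr (p - 1)) - p * (y powr (p - 1) * y)"
    by (simp add: algebra_simps)
  moreover have "y powr (p - 1) * y = y powr p" using y by (simp add: powr_diff)
  ultimately show ?thesis by (simp add: algebra_simps)
qed

text \<open>
  Jensen's inequality, by integration of the tangent at the weighted mean. With \<open>\<omega>\<close> a translate of
  a kernel it yields Young's inequality, with \<open>\<omega>\<close> a power of a kernel Hoelder's inequality.
\<close>

lemma weighted_power_mean:
  fixes \<omega> x :: "'a \<Rightarrow> real"
  assumes p: "1 \<le> p" and \<omega>: "integrable M \<omega>" "\<And>s. 0 \<le> \<omega> s"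
    and x: "x \<in> borel_measurable M" "\<And>s. 0 \<le> x s" and xp: "integrable M (\<lambda>s. \<omega> s * x s powr p)"
  shows "integrable M (\<lambda>s. \<omega> s * x s)"
    and "(\<integral>s. \<omega> s * x s \<partial>M) powr p \<le> (\<integral>s. \<omega> s \<partial>M) powr (p - 1) * (\<integral>s. \<omega> s * x s powr p \<partial>M)"
proof -
  have [measurable]: "x \<in> borel_measurable M" "\<omega> \<in> borel_measurable M" using x \<omega> by auto
  show int: "integrable M (\<lambda>s. \<omega> s * x s)"
  proof (rule Bochner_Integration.integrable_bound)
    show "integrable M (\<lambda>s. \<omega> s + \<omega> s * x s powr p)" using \<omega> xp by simp
    have "x s \<le> 1 + x s powr p" for s
    proof (cases "x s \<le> 1")
      case False
      then have "x s powr 1 \<le> x s powr p" using p by (intro powr_mono) auto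
      then show ?thesis using False by simp
    qed (simp add: add_increasing2)
    then have "\<omega> s * x s \<le> \<omega> s * (1 + x s powr p)" for s using \<omega> by (intro mult_left_mono)
    then show "AE s in M. norm (\<omega> s * x s) \<le> norm (\<omega> s + \<omega> s * x s powr p)"
      using x \<omega> by (intro AE_I2) (auto simp: distrib_left)
  qed simp
  define A where "A = (\<integral>s. \<omega> s \<partial>M)"
  define I where "I = (\<integral>s. \<omega> s * x s \<partial>M)"
  have I0: "0 \<le> I" unfolding I_def using \<omega> x by (intro integral_nonneg_AE) auto
  have A0: "0 \<le> A" unfolding A_def using \<omega> by (intro integral_nonneg_AE) auto
  have P0: "0 \<le> (\<integral>s. \<omega> s * x s powr p \<partial>M)" using \<omega> x by (intro integral_nonneg_AE) auto
  show "(\<integral>s. \<omega> s * x s \<partial>M) powr p \<le> (\<integral>s. \<omega> s \<partial>M) powr (p - 1) * (\<integral>s. \<omega> s * x s powr p \<partial>M)"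
  proof (cases "A = 0")
    case True
    then have "AE s in M. \<omega> s = 0"
      using integral_nonneg_eq_0_iff_AE[OF \<omega>(1)] \<omega>(2) by (simp add: A_def)
    then have "I = (\<integral>s. 0 \<partial>M)"
      unfolding I_def by (intro integral_cong_AE) auto
    then show ?thesis using P0 by (simp add: I_def)
  next
    case False
    then have A: "0 < A" using A0 by simp
    define y where "y = I / A"
    have y: "0 \<le> y" using A I0 by (simp add: y_def)
    have "(\<integral>s. \<omega> s * y powr p + p * y powr (p - 1) * (\<omega> s * x s - y * \<omega> s) \<partial>M) \<le> (\<integral>s. \<omega> s * x s powr p \<partial>M)"
    proof (intro integral_mono xp)
      fix s
      have "\<omega> s * (y powr p + p * y powr (p - 1) * (x s - y)) \<le> \<omega> s * x s powr p"
        using powr_tangent[OF p x(2) y] \<omega>(2) by (intro mult_left_mono)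
      then show "\<omega> s * y powr p + p * y powr (p - 1) * (\<omega> s * x s - y * \<omega> s) \<le> \<omega> s * x s powr p"
        by (simp add: algebra_simps)
    qed (use \<omega> int in auto)
    also have "(\<integral>s. \<omega> s * y powr p + p * y powr (p - 1) * (\<omega> s * x s - y * \<omega> s) \<partial>M)
        = A * y powr p + p * y powr (p - 1) * (I - y * A)"
      using \<omega> int by (simp add: A_def I_def)
    also have "I - y * A = 0" using A by (simp add: y_def)
    finally have "A powr (p - 1) * (A * y powr p) \<le> A powr (p - 1) * (\<integral>s. \<omega> s * x s powr p \<partial>M)"
      by (intro mult_left_mono) auto
    also have "A powr (p - 1) * (A * y powr p) = I powr p"
      using A I0 by (simp add: y_def powr_divide powr_diff)
    finally show ?thesis by (simp add: A_def I_def)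
  qed
qed

lemma young_convolution:
  fixes \<kappa> g :: "real \<Rightarrow> real"
  assumes p: "1 \<le> p" and \<kappa>: "integrable lborel \<kappa>" "\<And>s. 0 \<le> \<kappa> s"
    and g: "g \<in> borel_measurable borel" "\<And>s. 0 \<le> g s" and gp: "integrable lborel (\<lambda>s. g s powr p)"
  shows "AE t in lborel. integrable lborel (\<lambda>s. \<kappa> (t - s) * g s)"
    and "integrable lborel (\<lambda>t. conv \<kappa> g t powr p)"
    and "(LBINT t. conv \<kappa> g t powr p) \<le> (LBINT t. \<kappa> t) powr p * (LBINT t. g t powr p)"
proof -
  have [measurable]: "\<kappa> \<in> borel_measurable borel" "g \<in> borel_measurable borel" using \<kappa> g by auto
  define A where "A = (LBINT t. \<kappa> t)"
  have A0: "0 \<le> A" unfolding A_def using \<kappa> by (intro integral_nonneg_AE) auto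
  let ?h = "conv \<kappa> (\<lambda>s. g s powr p)"
  have h: "integrable lborel ?h" by (rule integrable_conv[OF \<kappa>(1) gp])
  have sh: "integrable lborel (\<lambda>s. \<kappa> (t - s))" "(LBINT s. \<kappa> (t - s)) = A" for t
    using lborel_integrable_real_affine[OF \<kappa>(1), of "-1" t] lborel_integral_real_affine[of "-1" \<kappa> t]
    by (auto simp: A_def)
  have ae: "AE t in lborel. integrable lborel (\<lambda>s. \<kappa> (t - s) * g s) \<and> conv \<kappa> g t powr p \<le> A powr (p - 1) * ?h t"
    using AE_integrable_conv[OF \<kappa>(1) gp]
  proof eventually_elim
    case (elim t)
    from weighted_power_mean[OF p sh(1) _ _ _ elim] \<kappa> g show ?case
      by (auto simp: conv_def sh)
  qed
  then show "AE t in lborel. integrable lborel (\<lambda>s. \<kappa> (t - s) * g s)" by eventually_elim simp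
  show int: "integrable lborel (\<lambda>t. conv \<kappa> g t powr p)"
  proof (rule Bochner_Integration.integrable_bound)
    show "integrable lborel (\<lambda>t. A powr (p - 1) * ?h t)" using h by simp
    show "AE t in lborel. norm (conv \<kappa> g t powr p) \<le> norm (A powr (p - 1) * ?h t)"
      using ae by eventually_elim (auto intro: order_trans[OF _ abs_ge_self])
  qed measurable
  have "(LBINT t. conv \<kappa> g t powr p) \<le> (LBINT t. A powr (p - 1) * ?h t)"
    using h ae by (intro integral_mono_AE int) auto
  also have "\<dots> = A powr (p - 1) * A * (LBINT t. g t powr p)"
    using integral_conv[OF \<kappa>(1) gp] by (simp add: A_def)
  also have "A powr (p - 1) * A = A powr p"
    using A0 by (cases "A = 0") (auto simp: powr_diff)
  finally show "(LBINT t. conv \<kappa> g t powr p) \<le> A powr p * (LBINT t. g t powr p)" .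
qed

text \<open>
  Minkowski's inequality for integrals of sequences, by duality: the vector \<open>c\<close> of the integrals is
  tested with itself, \<open>\<Sum>n. c n * c n\<close> is the integral of \<open>\<Sum>n. c n * b n s\<close>, and Cauchy-Schwarz
  bounds the integrand by the norm of \<open>c\<close> times \<open>\<omega> s\<close> times the norm of \<open>h\<close>.
\<close>

lemma minkowski_l2:
  fixes b h :: "nat \<Rightarrow> 'a \<Rightarrow> real" and \<omega> :: "'a \<Rightarrow> real"
  assumes b: "\<And>n. b n \<in> borel_measurable M" "\<And>n s. \<bar>b n s\<bar> \<le> \<omega> s * \<bar>h n s\<bar>" and \<omega>: "\<And>s. 0 \<le> \<omega> s"
    and h: "\<And>s. summable (\<lambda>n. (h n s)\<^sup>2)"
    and g: "integrable M (\<lambda>s. \<omega> s * sqrt (\<Sum>n. (h n s)\<^sup>2))"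
  shows "summable (\<lambda>n. (\<integral>s. b n s \<partial>M)\<^sup>2)"
    and "sqrt (\<Sum>n. (\<integral>s. b n s \<partial>M)\<^sup>2) \<le> (\<integral>s. \<omega> s * sqrt (\<Sum>n. (h n s)\<^sup>2) \<partial>M)"
proof -
  define c where "c n = (\<integral>s. b n s \<partial>M)" for n
  define G where "G s = sqrt (\<Sum>n. (h n s)\<^sup>2)" for s
  define I where "I = (\<integral>s. \<omega> s * G s \<partial>M)"
  have gI: "integrable M (\<lambda>s. \<omega> s * G s)" using g by (simp add: G_def)
  have G0: "0 \<le> G s" for s using suminf_nonneg[OF h] by (simp add: G_def)
  have I0: "0 \<le> I" unfolding I_def using \<omega> G0 by (intro integral_nonneg_AE) auto
  have hG: "sqrt (\<Sum>n<N. (h n s)\<^sup>2) \<le> G s" for N s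
    unfolding G_def by (intro real_sqrt_le_mono sum_le_suminf h) auto
  have "\<bar>h n s\<bar> \<le> G s" for n s
  proof -
    have "(h n s)\<^sup>2 \<le> (\<Sum>i<Suc n. (h i s)\<^sup>2)" by (simp add: sum_nonneg)
    then have "sqrt ((h n s)\<^sup>2) \<le> sqrt (\<Sum>i<Suc n. (h i s)\<^sup>2)" by (rule real_sqrt_le_mono)
    then show ?thesis using hG[where N="Suc n"] order_trans by (simp del: sum.lessThan_Suc) blast
  qed
  then have bG: "\<bar>b n s\<bar> \<le> \<omega> s * G s" for n s
    by (meson b(2) \<omega> mult_left_mono order_trans)
  have intb: "integrable M (b n)" for n
  proof (rule Bochner_Integration.integrable_bound[OF gI b(1)], rule AE_I2)
    fix s show "norm (b n s) \<le> norm (\<omega> s * G s)"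
      unfolding real_norm_def by (rule order_trans[OF bG abs_ge_self])
  qed
  have bound: "(\<Sum>n<N. (c n)\<^sup>2) \<le> I\<^sup>2" for N
  proof -
    define S where "S = sqrt (\<Sum>n<N. (c n)\<^sup>2)"
    have S0: "0 \<le> S" by (simp add: S_def sum_nonneg)
    have "S\<^sup>2 = (\<Sum>n<N. c n * c n)" by (simp add: S_def sum_nonneg power2_eq_square)
    also have "\<dots> = (\<integral>s. (\<Sum>n<N. c n * b n s) \<partial>M)"
      using intb by (subst Bochner_Integration.integral_sum) (auto simp: c_def)
    also have "\<dots> \<le> (\<integral>s. S * (\<omega> s * G s) \<partial>M)"
    proof (intro integral_mono)
      fix s
      have "(\<Sum>n<N. c n * b n s) \<le> (\<Sum>n<N. \<omega> s * (\<bar>c n\<bar> * \<bar>h n s\<bar>))"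
      proof (intro sum_mono)
        fix n
        have "c n * b n s \<le> \<bar>c n\<bar> * \<bar>b n s\<bar>" by (metis abs_ge_self abs_mult)
        also have "\<dots> \<le> \<bar>c n\<bar> * (\<omega> s * \<bar>h n s\<bar>)" by (intro mult_left_mono b) auto
        finally show "c n * b n s \<le> \<omega> s * (\<bar>c n\<bar> * \<bar>h n s\<bar>)" by (simp add: mult_ac)
      qed
      also have "\<dots> = \<omega> s * (\<Sum>n<N. \<bar>c n\<bar> * \<bar>h n s\<bar>)" by (simp add: sum_distrib_left)
      also have "(\<Sum>n<N. \<bar>c n\<bar> * \<bar>h n s\<bar>) \<le> S * G s"
      proof -
        have "(\<Sum>n<N. \<bar>c n\<bar> * \<bar>h n s\<bar>)\<^sup>2 \<le> (\<Sum>n<N. \<bar>c n\<bar>\<^sup>2) * (\<Sum>n<N. \<bar>h n s\<bar>\<^sup>2)"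
          by (rule Cauchy_Schwarz_ineq_sum)
        then have "(\<Sum>n<N. \<bar>c n\<bar> * \<bar>h n s\<bar>) \<le> sqrt ((\<Sum>n<N. (c n)\<^sup>2) * (\<Sum>n<N. (h n s)\<^sup>2))"
          by (intro real_le_rsqrt) simp
        also have "\<dots> \<le> S * G s"
          unfolding real_sqrt_mult S_def by (intro mult_left_mono hG) (simp add: sum_nonneg)
        finally show ?thesis .
      qed
      finally show "(\<Sum>n<N. c n * b n s) \<le> S * (\<omega> s * G s)"
        using mult_left_mono[OF _ \<omega>] by (simp add: mult_ac)
    qed (use intb gI in auto)
    also have "\<dots> = S * I" by (simp add: I_def)
    finally have "S * S \<le> S * I" by (simp add: power2_eq_square)
    then have "S \<le> I" using S0 I0 by (cases "S = 0") auto
    then have "S\<^sup>2 \<le> I\<^sup>2" using S0 by (intro power_mono)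
    then show ?thesis by (simp add: S_def sum_nonneg)
  qed
  show sm: "summable (\<lambda>n. (\<integral>s. b n s \<partial>M)\<^sup>2)"
    using bound by (intro summableI_nonneg_bounded[of _ "I\<^sup>2"]) (auto simp: c_def)
  have "(\<Sum>n. (c n)\<^sup>2) \<le> I\<^sup>2" using sm bound by (intro suminf_le_const) (auto simp: c_def)
  then have "sqrt (\<Sum>n. (c n)\<^sup>2) \<le> I" using I0 by (rule real_le_lsqrt[rotated -1])  
  then show "sqrt (\<Sum>n. (\<integral>s. b n s \<partial>M)\<^sup>2) \<le> (\<integral>s. \<omega> s * sqrt (\<Sum>n. (h n s)\<^sup>2) \<partial>M)"
    by (simp add: c_def I_def G_def)
qed

definition power_singularity :: "real \<Rightarrow> real \<Rightarrow> real \<Rightarrow> real" where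
  "power_singularity T b = trunc T (\<lambda>s. s powr (b - 1))"

lemma power_singularity_measurable [measurable]: "power_singularity T b \<in> borel_measurable borel"
  unfolding power_singularity_def by measurable

lemma power_singularity_nonneg: "0 \<le> power_singularity T b s"
  by (simp add: power_singularity_def trunc_def)

lemma has_bochner_integral_power_singularity:
  assumes "0 < b" "0 < T"
  shows "has_bochner_integral lborel (power_singularity T b) (T powr b / b)"
proof -
  have "has_bochner_integral lborel (\<lambda>s. indicator {0<..T} s * s powr (b - 1)) (T powr b / b)"
    using has_bochner_integral_powr[of "b - 1" T] assms by simp
  moreover have "AE s in lborel. indicator {0<..T} s * s powr (b - 1) = power_singularity T b s"
    using AE_lborel_singleton[of T]
    by eventually_elim (auto simp: power_singularity_def trunc_def split: split_indicator)
  ultimately show ?thesis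
    by (subst (asm) has_bochner_integral_cong_AE[of _ _ "power_singularity T b"]) auto
qed

text \<open>
  Hoelder's inequality. The weight in \<open>weighted_power_mean\<close> is the kernel to the dual exponent
  \<open>p / (p - 1)\<close>, again a power with exponent \<open>e - 1\<close>; it is integrable at \<open>0\<close> because \<open>e > 0\<close>,
  which amounts to \<open>b * p > 1\<close>.
\<close>

lemma conv_power_singularity_Lp:
  assumes p: "1 < p" and b: "1 < b * p" and t: "0 < t" "t \<le> T"
    and g: "g \<in> borel_measurable borel" "\<And>s. 0 \<le> g s" "\<And>s. s \<le> 0 \<Longrightarrow> g s = 0" and gp: "integrable lborel (\<lambda>s. g s powr p)"
  defines "e \<equiv> (b - 1) * (p / (p - 1)) + 1"
  shows "0 < e" "integrable lborel (\<lambda>s. power_singularity T b (t - s) * g s)"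
    and "conv (power_singularity T b) g t \<le> ((t powr e / e) powr (p - 1) * (LBINT s. g s powr p)) powr (1 / p)"
proof -
  have [measurable]: "g \<in> borel_measurable borel" by fact
  define p' where "p' = p / (p - 1)"
  have e: "e = (b - 1) * p' + 1" by (simp add: e_def p'_def)
  have "0 < (b * p - 1) / (p - 1)" using p b by simp
  also have "\<dots> = e" using p by (simp add: e_def field_simps)
  finally show e0: "0 < e" .
  define \<omega> where "\<omega> s = power_singularity t e (t + - 1 * s)" for s
  \<comment> \<open>chosen such that \<open>\<omega> s * x s\<close> is the integrand of the convolution and \<open>\<omega> s * x s powr p\<close> is \<open>g s powr p\<close>\<close>
  define x where "x s = (if 0 < s \<and> s < t then g s * (t - s) powr ((b - 1) * (1 - p')) else 0)" for s
  have \<omega>_int: "has_bochner_integral lborel \<omega> (t powr e / e)"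
    using has_bochner_integral_power_singularity[OF e0 t(1)]
      lborel_has_bochner_integral_real_affine_iff[of "-1" "power_singularity t e" "t powr e / e" t]
    unfolding \<omega>_def by simp
  have \<omega>x: "\<omega> s * x s = power_singularity T b (t - s) * g s" for s
  proof (cases "0 < s \<and> s < t")
    case True
    have "(t - s) powr (e - 1) * (t - s) powr ((b - 1) * (1 - p')) = (t - s) powr (b - 1)"
      by (simp add: e algebra_simps flip: powr_add)
    then show ?thesis using True t by (simp add: \<omega>_def x_def power_singularity_def)
  next
    case False
    then show ?thesis using g(3)[of s] by (cases "s \<le> 0") (auto simp: x_def power_singularity_def)
  qed
  have \<omega>xp: "\<omega> s * x s powr p = indicator {0<..<t} s * g s powr p" for s
  proof (cases "0 < s \<and> s < t")
    case True
    have "(t - s) powr (e - 1) * (g s * (t - s) powr ((b - 1) * (1 - p'))) powr p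
        = ((t - s) powr (e - 1) * (t - s) powr ((b - 1) * (1 - p') * p)) * g s powr p"
      using g(2) by (simp add: powr_mult powr_powr)
    also have "(t - s) powr (e - 1) * (t - s) powr ((b - 1) * (1 - p') * p) = (t - s) powr ((b - 1) * (p' + (1 - p') * p))"
      by (simp add: e algebra_simps flip: powr_add)
    also have "p' + (1 - p') * p = 0" using p by (simp add: p'_def field_simps)
    finally show ?thesis using True by (simp add: \<omega>_def x_def power_singularity_def)
  qed (auto simp: x_def)
  have [measurable]: "x \<in> borel_measurable borel" unfolding x_def[abs_def] by measurable
  have int_ind: "integrable lborel (\<lambda>s. indicator {0<..<t} s * g s powr p)"
    using integrable_mult_indicator[of "{0<..<t}" lborel "\<lambda>s. g s powr p"] gp by simp
  have \<omega>_int': "integrable lborel \<omega>" "(LBINT s. \<omega> s) = t powr e / e"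
    using \<omega>_int by (auto simp: has_bochner_integral_iff)
  have J: "integrable lborel (\<lambda>s. \<omega> s * x s)"
    "(LBINT s. \<omega> s * x s) powr p \<le> (LBINT s. \<omega> s) powr (p - 1) * (LBINT s. \<omega> s * x s powr p)"
  proof -
    have 1: "0 \<le> \<omega> s" "0 \<le> x s" for s
      by (auto simp: \<omega>_def x_def power_singularity_nonneg g)
    have 2: "integrable lborel (\<lambda>s. \<omega> s * x s powr p)" unfolding \<omega>xp by (rule int_ind)
    have 3: "x \<in> borel_measurable lborel" by simp
    show "integrable lborel (\<lambda>s. \<omega> s * x s)"
      "(LBINT s. \<omega> s * x s) powr p \<le> (LBINT s. \<omega> s) powr (p - 1) * (LBINT s. \<omega> s * x s powr p)"
      using weighted_power_mean[OF less_imp_le[OF p] \<omega>_int'(1) 1(1) 3 1(2) 2] by auto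
  qed
  show "integrable lborel (\<lambda>s. power_singularity T b (t - s) * g s)" using J(1) by (simp add: \<omega>x)
  have "(LBINT s. \<omega> s * x s powr p) \<le> (LBINT s. g s powr p)"
    unfolding \<omega>xp by (intro integral_mono int_ind gp) (auto split: split_indicator)
  then have "conv (power_singularity T b) g t powr p \<le> (t powr e / e) powr (p - 1) * (LBINT s. g s powr p)"
    using J(2) mult_left_mono[of _ _ "(t powr e / e) powr (p - 1)"] unfolding \<omega>x conv_def \<omega>_int'(2)
    by (meson order_trans powr_ge_zero)
  then have "(conv (power_singularity T b) g t powr p) powr (1 / p)
      \<le> ((t powr e / e) powr (p - 1) * (LBINT s. g s powr p)) powr (1 / p)"
    using p by (intro powr_mono2) auto
  moreover have "0 \<le> conv (power_singularity T b) g t"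
    unfolding conv_def by (intro integral_nonneg_AE) (auto simp: power_singularity_nonneg g)
  ultimately show "conv (power_singularity T b) g t \<le> ((t powr e / e) powr (p - 1) * (LBINT s. g s powr p)) powr (1 / p)"
    using p by (simp add: powr_powr)
qed

lemma conv_power_singularity_bounded:
  assumes b: "0 < b" and t: "0 < t" "t \<le> T"
    and g: "g \<in> borel_measurable borel" "\<And>s. 0 \<le> g s" "\<And>s. s \<le> 0 \<Longrightarrow> g s = 0" "AE s in lborel. g s \<le> B"
  shows "integrable lborel (\<lambda>s. power_singularity T b (t - s) * g s)"
    and "conv (power_singularity T b) g t \<le> B * (t powr b / b)"
proof -
  have [measurable]: "g \<in> borel_measurable borel" by fact
  define \<omega> where "\<omega> s = power_singularity t b (t + - 1 * s)" for s
  have \<omega>_int: "has_bochner_integral lborel \<omega> (t powr b / b)"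
    using has_bochner_integral_power_singularity[OF b t(1)]
      lborel_has_bochner_integral_real_affine_iff[of "-1" "power_singularity t b" "t powr b / b" t]
    unfolding \<omega>_def by simp
  have int: "integrable lborel (\<lambda>s. B * \<omega> s)" using \<omega>_int by (simp add: has_bochner_integral_iff)
  have le: "AE s in lborel. power_singularity T b (t - s) * g s \<le> B * \<omega> s"
    using g(4)
  proof eventually_elim
    case (elim s)
    consider "s \<le> 0" | "t \<le> s" | "0 < s" "s < t" by linarith
    then show ?case
    proof cases
      case 3
      then have "(t - s) powr (b - 1) * g s \<le> (t - s) powr (b - 1) * B" using elim by (intro mult_left_mono) auto
      then show ?thesis using 3 t by (simp add: \<omega>_def power_singularity_def mult.commute)
    qed (use g(3)[of s] t in \<open>auto simp: \<omega>_def power_singularity_def\<close>)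
  qed
  show int2: "integrable lborel (\<lambda>s. power_singularity T b (t - s) * g s)"
  proof (rule Bochner_Integration.integrable_bound[OF int])
    show "AE s in lborel. norm (power_singularity T b (t - s) * g s) \<le> norm (B * \<omega> s)"
      using le
    proof eventually_elim
      case (elim s)
      then have "power_singularity T b (t - s) * g s \<le> \<bar>B * \<omega> s\<bar>" by (rule order_trans[OF _ abs_ge_self])
      moreover have "0 \<le> power_singularity T b (t - s) * g s" by (simp add: power_singularity_nonneg g)
      ultimately show ?case by simp
    qed
  qed simp
  have "conv (power_singularity T b) g t \<le> (LBINT s. B * \<omega> s)"
    unfolding conv_def by (intro integral_mono_AE int int2 le)
  then show "conv (power_singularity T b) g t \<le> B * (t powr b / b)"
    using \<omega>_int by (simp add: has_bochner_integral_iff)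
qed

section \<open>Square integrable functions and the Riesz-Fischer theorem\<close>

lemma L2_mult_integrable:
  assumes "f \<in> L2_space \<Omega>" "g \<in> L2_space \<Omega>"
  shows "integrable (lebesgue_on \<Omega>) (\<lambda>x. f x * g x)"
proof (rule Bochner_Integration.integrable_bound)
  show "integrable (lebesgue_on \<Omega>) (\<lambda>x. (f x)\<^sup>2 + (g x)\<^sup>2)"
    using assms by (auto simp: L2_space_def)
  have "\<bar>f x * g x\<bar> \<le> (f x)\<^sup>2 + (g x)\<^sup>2" for x
  proof -
    have "0 \<le> (\<bar>f x\<bar> - \<bar>g x\<bar>)\<^sup>2" by simp
    then have "2 * (\<bar>f x\<bar> * \<bar>g x\<bar>) \<le> (f x)\<^sup>2 + (g x)\<^sup>2" by (simp add: power2_diff)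
    moreover have "0 \<le> \<bar>f x\<bar> * \<bar>g x\<bar>" by simp
    ultimately show ?thesis unfolding abs_mult by linarith
  qed
  then show "AE x in lebesgue_on \<Omega>. norm (f x * g x) \<le> norm ((f x)\<^sup>2 + (g x)\<^sup>2)" by simp
  show "(\<lambda>x. f x * g x) \<in> borel_measurable (lebesgue_on \<Omega>)"
    using assms by (auto simp: L2_space_def intro: borel_measurable_times)
qed

lemma L2_add: assumes "f \<in> L2_space \<Omega>" "g \<in> L2_space \<Omega>" shows "(\<lambda>x. f x + g x) \<in> L2_space \<Omega>"
proof -
  have "integrable (lebesgue_on \<Omega>) (\<lambda>x. (f x)\<^sup>2 + (g x)\<^sup>2 + 2 * (f x * g x))"
    using assms L2_mult_integrable[OF assms] by (auto simp: L2_space_def)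
  then show ?thesis using assms by (auto simp: L2_space_def power2_sum algebra_simps)
qed

lemma L2_scale: assumes "f \<in> L2_space \<Omega>" shows "(\<lambda>x. r * f x) \<in> L2_space \<Omega>"
  using assms by (auto simp: L2_space_def power_mult_distrib)

lemma L2_diff: assumes "f \<in> L2_space \<Omega>" "g \<in> L2_space \<Omega>" shows "(\<lambda>x. f x - g x) \<in> L2_space \<Omega>"
  using L2_add[OF assms(1) L2_scale[OF assms(2), of "-1"]] by simp

lemma L2_zero: "(\<lambda>x. 0) \<in> L2_space \<Omega>"
  by (simp add: L2_space_def)

lemma L2_sum: assumes "\<And>i. i \<in> I \<Longrightarrow> f i \<in> L2_space \<Omega>" shows "(\<lambda>x. \<Sum>i\<in>I. f i x) \<in> L2_space \<Omega>"
  using assms by (induction I rule: infinite_finite_induct) (auto simp: L2_zero intro: L2_add)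

lemma L2_inner_commute: "L2_inner \<Omega> f g = L2_inner \<Omega> g f"
  by (simp add: L2_inner_def mult.commute)

lemma L2_inner_diff_left:
  assumes "f \<in> L2_space \<Omega>" "g \<in> L2_space \<Omega>" "h \<in> L2_space \<Omega>"
  shows "L2_inner \<Omega> (\<lambda>x. f x - g x) h = L2_inner \<Omega> f h - L2_inner \<Omega> g h"
  using assms by (simp add: L2_inner_def left_diff_distrib L2_mult_integrable)

lemma L2_inner_scale_left: "L2_inner \<Omega> (\<lambda>x. r * f x) h = r * L2_inner \<Omega> f h"
  by (simp add: L2_inner_def mult.assoc)

lemma L2_inner_sum_left:
  assumes "\<And>i. i \<in> I \<Longrightarrow> f i \<in> L2_space \<Omega>" "h \<in> L2_space \<Omega>"
  shows "L2_inner \<Omega> (\<lambda>x. \<Sum>i\<in>I. f i x) h = (\<Sum>i\<in>I. L2_inner \<Omega> (f i) h)"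
  using assms by (simp add: L2_inner_def sum_distrib_right L2_mult_integrable)

lemma L2_inner_self_nonneg: "0 \<le> L2_inner \<Omega> f f"
  by (simp add: L2_inner_def)

lemma L2_Cauchy_Schwarz:
  assumes f: "f \<in> L2_space \<Omega>" and g: "g \<in> L2_space \<Omega>"
  shows "\<bar>L2_inner \<Omega> f g\<bar> \<le> sqrt (L2_inner \<Omega> f f) * sqrt (L2_inner \<Omega> g g)"
proof -
  let ?A = "L2_inner \<Omega> f f" and ?B = "L2_inner \<Omega> f g" and ?C = "L2_inner \<Omega> g g"
  have quad: "0 \<le> ?A * x\<^sup>2 + 2 * ?B * x + ?C" for x
  proof -
    have "0 \<le> L2_inner \<Omega> (\<lambda>y. x * f y + g y) (\<lambda>y. x * f y + g y)" by (rule L2_inner_self_nonneg)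
    also have "\<dots> = (LINT y|lebesgue_on \<Omega>. x\<^sup>2 * (f y * f y) + 2 * x * (f y * g y) + g y * g y)"
      unfolding L2_inner_def by (intro Bochner_Integration.integral_cong) (auto simp: power2_eq_square algebra_simps)
    also have "\<dots> = ?A * x\<^sup>2 + 2 * ?B * x + ?C"
      using f g by (simp add: L2_mult_integrable L2_inner_def)
    finally show ?thesis .
  qed
  have "?B\<^sup>2 \<le> ?A * ?C"
  proof (cases "?A = 0")
    case True
    have "?B = 0"
    proof (rule ccontr)
      assume "?B \<noteq> 0"
      then show False using quad[of "- (?C + 1) / (2 * ?B)"] True by (simp add: field_simps)
    qed
    then show ?thesis using True by simp
  next
    case False
    then have A: "0 < ?A" using L2_inner_self_nonneg[of \<Omega> f] by simp
    have "0 \<le> ?A * (?A * (- ?B / ?A)\<^sup>2 + 2 * ?B * (- ?B / ?A) + ?C)"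
      by (rule mult_nonneg_nonneg[OF less_imp_le[OF A] quad])
    also have "\<dots> = ?A * ?C - ?B\<^sup>2" using A by (simp add: field_simps power2_eq_square)
    finally show ?thesis by simp
  qed
  then have "sqrt (?B\<^sup>2) \<le> sqrt (?A * ?C)" by (rule real_sqrt_le_mono)
  then show ?thesis by (simp add: real_sqrt_mult)
qed

locale L2_basis =
  fixes \<Omega> :: "(real^'d::finite) set" and \<phi> :: "nat \<Rightarrow> real^'d \<Rightarrow> real"
  assumes \<Omega>: "\<Omega> \<in> lmeasurable" and basis: "L2_orthonormal_basis \<Omega> \<phi>"
begin

lemma \<phi>_L2: "\<phi> n \<in> L2_space \<Omega>" and \<phi>_orth: "L2_inner \<Omega> (\<phi> k) (\<phi> n) = (if k = n then 1 else 0)"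
  using basis by (auto simp: L2_orthonormal_basis_def)

abbreviation coef :: "(real^'d \<Rightarrow> real) \<Rightarrow> nat \<Rightarrow> real" where
  "coef f n \<equiv> L2_inner \<Omega> f (\<phi> n)"

lemma zero_coeffs_AE:
  assumes f: "f \<in> L2_space \<Omega>" and c: "\<And>n. coef f n = 0"
  shows "AE x in lebesgue_on \<Omega>. f x = 0"
proof -
  have "(\<lambda>N. L2_norm \<Omega> (\<lambda>x. f x - (\<Sum>n<N. coef f n * \<phi> n x))) \<longlonglongrightarrow> 0"
    using basis f by (auto simp: L2_orthonormal_basis_def)
  then have "L2_norm \<Omega> f = 0" by (simp add: c LIMSEQ_const_iff)
  then have "(LINT x|lebesgue_on \<Omega>. (f x)\<^sup>2) = 0"
    by (simp add: L2_norm_def L2_inner_def power2_eq_square)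
  then have "AE x in lebesgue_on \<Omega>. (f x)\<^sup>2 = 0"
    using f by (subst (asm) integral_nonneg_eq_0_iff_AE) (auto simp: L2_space_def)
  then show ?thesis by simp
qed

lemma eq_coeffs_AE:
  assumes f: "f \<in> L2_space \<Omega>" and g: "g \<in> L2_space \<Omega>" and c: "\<And>n. coef f n = coef g n"
  shows "AE x in lebesgue_on \<Omega>. f x = g x"
  using zero_coeffs_AE[OF L2_diff[OF f g]] c by (simp add: L2_inner_diff_left f g \<phi>_L2)

lemma combination_L2: "(\<lambda>x. \<Sum>n\<in>I. c n * \<phi> n x) \<in> L2_space \<Omega>"
  by (intro L2_sum L2_scale \<phi>_L2)

lemma combination_inner:
  assumes "finite I"
  shows "coef (\<lambda>x. \<Sum>n\<in>I. c n * \<phi> n x) k = (if k \<in> I then c k else 0)"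
proof -
  have "coef (\<lambda>x. \<Sum>n\<in>I. c n * \<phi> n x) k = (\<Sum>n\<in>I. c n * (if n = k then 1 else 0))"
    by (subst L2_inner_sum_left) (auto intro: L2_scale \<phi>_L2 simp: L2_inner_scale_left \<phi>_orth)
  also have "\<dots> = (if k \<in> I then c k else 0)" using assms by (simp add: if_distrib cong: if_cong)
  finally show ?thesis .
qed

lemma combination_norm:
  assumes "finite I"
  shows "(LINT x|lebesgue_on \<Omega>. (\<Sum>n\<in>I. c n * \<phi> n x)\<^sup>2) = (\<Sum>n\<in>I. (c n)\<^sup>2)"
proof -
  let ?f = "\<lambda>x. \<Sum>n\<in>I. c n * \<phi> n x"
  have "(LINT x|lebesgue_on \<Omega>. (?f x)\<^sup>2) = L2_inner \<Omega> ?f ?f"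
    by (simp add: L2_inner_def power2_eq_square)
  also have "\<dots> = (\<Sum>n\<in>I. L2_inner \<Omega> (\<lambda>x. c n * \<phi> n x) ?f)"
    by (intro L2_inner_sum_left L2_scale \<phi>_L2 combination_L2)
  also have "\<dots> = (\<Sum>n\<in>I. c n * c n)"
    using assms by (intro sum.cong) (auto simp: L2_inner_scale_left L2_inner_commute[of _ "\<phi> _"] combination_inner)
  finally show ?thesis by (simp add: power2_eq_square)
qed

text \<open>
  Partial sums with geometrically decaying distances in \<open>L\<^sup>2\<close> have, on a space of finite measure,
  summable distances in \<open>L\<^sup>1\<close>, and so converge almost everywhere. Fatou's lemma shows that the limit
  is also the limit in \<open>L\<^sup>2\<close>.
\<close>

lemma riesz_fischer:
  assumes c: "summable (\<lambda>n. (c n)\<^sup>2)"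
  shows "\<exists>f\<in>L2_space \<Omega>. \<forall>n. coef f n = c n"
proof -
  let ?M = "lebesgue_on \<Omega>"
  interpret finite_measure ?M
    using \<Omega> by (intro finite_measureI) (auto simp: emeasure_restrict_space fmeasurable_def)
  have "\<exists>N. \<forall>m\<ge>N. \<forall>n. (\<Sum>i=m..<n. (c i)\<^sup>2) < (1 / 4) ^ k" for k :: nat
  proof -
    have "\<exists>N. \<forall>m\<ge>N. \<forall>n. norm (\<Sum>i=m..<n. (c i)\<^sup>2) < (1 / 4) ^ k"
      using c unfolding summable_Cauchy by (rule allE[of _ "(1/4) ^ k"]) auto
    then show ?thesis by (auto simp: abs_less_iff)
  qed
  then obtain N0 where N0: "\<And>k m n. N0 k \<le> m \<Longrightarrow> (\<Sum>i=m..<n. (c i)\<^sup>2) < (1 / 4) ^ k" by metis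
  \<comment> \<open>an increasing choice of indices beyond both \<open>N0 k\<close> and \<open>k\<close>\<close>
  define \<sigma> where "\<sigma> k = (\<Sum>j\<le>k. N0 j) + k" for k :: nat
  have \<sigma>_le: "\<sigma> k \<le> \<sigma> j" if "k \<le> j" for k j
    unfolding \<sigma>_def using that by (intro add_mono sum_mono2) auto
  have \<sigma>_ge: "k \<le> \<sigma> k" "N0 k \<le> \<sigma> k" for k
    by (auto simp: \<sigma>_def intro: trans_le_add1 member_le_sum)
  define S where "S k x = (\<Sum>n<\<sigma> k. c n * \<phi> n x)" for k x
  have S_L2: "S k \<in> L2_space \<Omega>" for k unfolding S_def[abs_def] by (rule combination_L2)
  then have S_meas [measurable]: "S k \<in> borel_measurable ?M" for k by (auto simp: L2_space_def)
  have S_diff: "S j x - S k x = (\<Sum>n=\<sigma> k..<\<sigma> j. c n * \<phi> n x)" if "k \<le> j" for j k x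
    using sum.atLeastLessThan_concat[OF le0 \<sigma>_le[OF that], of "\<lambda>n. c n * \<phi> n x"]
    by (simp add: S_def atLeast0LessThan)
  have S_diff_int: "integrable ?M (\<lambda>x. (S j x - S k x)\<^sup>2)" for j k
    using L2_diff[OF S_L2 S_L2, of j k] by (simp add: L2_space_def)
  have S_diff_norm: "(LINT x|?M. (S j x - S k x)\<^sup>2) \<le> (1 / 4) ^ k" if "k \<le> j" for j k
    unfolding S_diff[OF that] combination_norm[OF finite_atLeastLessThan] using N0[OF \<sigma>_ge(2), of k] by (simp add: less_imp_le)
  define D where "D k x = \<bar>S (Suc k) x - S k x\<bar>" for k x
  have D_bound: "(\<integral>\<^sup>+x. ennreal (D k x) \<partial>?M) \<le> ennreal ((measure ?M (space ?M) + 1) * (1 / 2) ^ k)" for k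
  proof -
    \<comment> \<open>\<open>D \<le> \<epsilon> + D\<^sup>2 / \<epsilon>\<close> with \<open>\<epsilon> = (1 / 2) ^ k\<close>; both terms are summable after integration\<close>
    have pw: "D k x \<le> (1 / 2) ^ k + 2 ^ k * (S (Suc k) x - S k x)\<^sup>2" for x
    proof -
      have "0 \<le> ((1/2) ^ k - D k x)\<^sup>2" by simp
      then have "2 * (1/2)^k * D k x \<le> ((1/2) ^ k)\<^sup>2 + (D k x)\<^sup>2" by (simp add: power2_diff)
      then have "2 ^ k * (2 * (1/2)^k * D k x) \<le> 2 ^ k * (((1/2) ^ k)\<^sup>2 + (D k x)\<^sup>2)" by (intro mult_left_mono) auto
      then have "2 * D k x \<le> (1/2) ^ k + 2 ^ k * (D k x)\<^sup>2"
        by (simp add: power2_eq_square algebra_simps power_one_over)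
      moreover have "0 \<le> D k x" "(D k x)\<^sup>2 = (S (Suc k) x - S k x)\<^sup>2" by (auto simp: D_def)
      ultimately show ?thesis by simp
    qed
    have int: "integrable ?M (\<lambda>x. (1 / 2) ^ k + 2 ^ k * (S (Suc k) x - S k x)\<^sup>2)"
      using S_diff_int by simp
    have "(\<integral>\<^sup>+x. ennreal (D k x) \<partial>?M) \<le> (\<integral>\<^sup>+x. ennreal ((1 / 2) ^ k + 2 ^ k * (S (Suc k) x - S k x)\<^sup>2) \<partial>?M)"
      by (intro nn_integral_mono ennreal_leI pw)
    also have "\<dots> = ennreal (LINT x|?M. (1 / 2) ^ k + 2 ^ k * (S (Suc k) x - S k x)\<^sup>2)"
      by (rule nn_integral_eq_integral[OF int]) (simp add: add_nonneg_nonneg)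
    also have "(LINT x|?M. (1 / 2) ^ k + 2 ^ k * (S (Suc k) x - S k x)\<^sup>2)
        = measure ?M (space ?M) * (1 / 2) ^ k + 2 ^ k * (LINT x|?M. (S (Suc k) x - S k x)\<^sup>2)"
      using S_diff_int by simp
    also have "\<dots> \<le> measure ?M (space ?M) * (1 / 2) ^ k + 2 ^ k * (1 / 4) ^ k"
      by (intro add_left_mono mult_left_mono S_diff_norm) auto
    also have "2 ^ k * (1 / 4) ^ k = (1 / 2 :: real) ^ k" by (simp flip: power_mult_distrib)
    finally show ?thesis by (simp add: distrib_right ennreal_leI)
  qed
  have "(\<integral>\<^sup>+x. (\<Sum>k. ennreal (D k x)) \<partial>?M) = (\<Sum>k. \<integral>\<^sup>+x. ennreal (D k x) \<partial>?M)"
    unfolding D_def by (rule nn_integral_suminf) simp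
  also have "\<dots> \<le> (\<Sum>k. ennreal ((measure ?M (space ?M) + 1) * (1 / 2) ^ k))"
    by (intro suminf_le D_bound) auto
  also have "\<dots> < \<infinity>"
    by (subst suminf_ennreal2) (auto intro!: summable_mult summable_geometric)
  finally have "(\<integral>\<^sup>+x. (\<Sum>k. ennreal (D k x)) \<partial>?M) \<noteq> \<infinity>" by simp
  then have "AE x in ?M. (\<Sum>k. ennreal (D k x)) \<noteq> \<infinity>"
    by (intro nn_integral_PInf_AE) (auto simp: D_def)
  then have conv: "AE x in ?M. convergent (\<lambda>k. S k x)"
  proof eventually_elim
    case (elim x)
    have "summable (\<lambda>k. D k x)" using elim by (intro summable_suminf_not_top) (auto simp: D_def)
    then have "summable (\<lambda>k. S (Suc k) x - S k x)" unfolding D_def by (rule summable_rabs_cancel)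
    then have "convergent (\<lambda>k. \<Sum>i<k. S (Suc i) x - S i x)" by (simp add: summable_iff_convergent)
    then have "convergent (\<lambda>k. S k x - S 0 x)"
      by (simp only: sum_lessThan_telescope[of "\<lambda>k. S k x"])
    from convergent_add[OF this convergent_const[of "S 0 x"]] show ?case by simp
  qed
  define f where "f x = lim (\<lambda>k. S k x)" for x
  have f_meas [measurable]: "f \<in> borel_measurable ?M" unfolding f_def by measurable
  have tail: "(\<integral>\<^sup>+x. ennreal ((f x - S k x)\<^sup>2) \<partial>?M) \<le> ennreal ((1 / 4) ^ k)" for k
  proof -
    have "(\<integral>\<^sup>+x. ennreal ((f x - S k x)\<^sup>2) \<partial>?M) = (\<integral>\<^sup>+x. liminf (\<lambda>j. ennreal ((S j x - S k x)\<^sup>2)) \<partial>?M)"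
    proof (rule nn_integral_cong_AE)
      show "AE x in ?M. ennreal ((f x - S k x)\<^sup>2) = liminf (\<lambda>j. ennreal ((S j x - S k x)\<^sup>2))"
        using conv
      proof eventually_elim
        case (elim x)
        then have "(\<lambda>j. S j x) \<longlonglongrightarrow> f x" by (simp add: f_def convergent_LIMSEQ_iff)
        then have "(\<lambda>j. ennreal ((S j x - S k x)\<^sup>2)) \<longlonglongrightarrow> ennreal ((f x - S k x)\<^sup>2)"
          by (intro tendsto_ennrealI tendsto_intros)
        then show ?case by (rule lim_imp_Liminf[symmetric, rotated]) simp
      qed
    qed
    also have "\<dots> \<le> liminf (\<lambda>j. \<integral>\<^sup>+x. ennreal ((S j x - S k x)\<^sup>2) \<partial>?M)"
      by (rule nn_integral_liminf) simp
    also have "\<dots> \<le> ennreal ((1 / 4) ^ k)"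
    proof (rule Liminf_le)
      show "\<forall>\<^sub>F j in sequentially. (\<integral>\<^sup>+x. ennreal ((S j x - S k x)\<^sup>2) \<partial>?M) \<le> ennreal ((1 / 4) ^ k)"
        using eventually_ge_at_top[of k]
      proof eventually_elim
        case (elim j)
        then show ?case
          by (subst nn_integral_eq_integral[OF S_diff_int]) (auto intro!: ennreal_leI S_diff_norm)
      qed
    qed simp
    finally show ?thesis .
  qed
  have fS: "(\<lambda>x. f x - S k x) \<in> L2_space \<Omega>" and fS_norm: "L2_inner \<Omega> (\<lambda>x. f x - S k x) (\<lambda>x. f x - S k x) \<le> (1 / 4) ^ k" for k
  proof -
    have "(\<integral>\<^sup>+x. ennreal ((f x - S k x)\<^sup>2) \<partial>?M) < \<infinity>"
      by (rule le_less_trans[OF tail]) simp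
    then have int: "integrable ?M (\<lambda>x. (f x - S k x)\<^sup>2)"
      by (intro integrableI_nonneg) auto
    then show "(\<lambda>x. f x - S k x) \<in> L2_space \<Omega>" by (simp add: L2_space_def)
    have "ennreal (LINT x|?M. (f x - S k x)\<^sup>2) \<le> ennreal ((1 / 4) ^ k)"
      using tail[of k] by (subst (asm) nn_integral_eq_integral[OF int]) auto
    then show "L2_inner \<Omega> (\<lambda>x. f x - S k x) (\<lambda>x. f x - S k x) \<le> (1 / 4) ^ k"
      by (simp add: L2_inner_def power2_eq_square)
  qed
  have f_L2: "f \<in> L2_space \<Omega>" using L2_add[OF fS[of 0] S_L2[of 0]] by simp
  have "coef f n = c n" for n
  proof -
    have bound: "\<bar>coef f n - c n\<bar> \<le> (1 / 2) ^ k" if "n < k" for k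
    proof -
      have "coef (S k) n = c n"
        using that \<sigma>_ge(1)[of k] unfolding S_def[abs_def] by (subst combination_inner) auto
      then have "\<bar>coef f n - c n\<bar> = \<bar>coef (\<lambda>x. f x - S k x) n\<bar>"
        by (simp add: L2_inner_diff_left f_L2 S_L2 \<phi>_L2)
      also have "\<dots> \<le> sqrt (L2_inner \<Omega> (\<lambda>x. f x - S k x) (\<lambda>x. f x - S k x)) * sqrt (coef (\<phi> n) n)"
        by (rule L2_Cauchy_Schwarz[OF fS \<phi>_L2])
      also have "\<dots> \<le> sqrt ((1 / 4) ^ k)" using fS_norm[of k] by (simp add: \<phi>_orth)
      also have "\<dots> = (1 / 2) ^ k" by (simp add: real_sqrt_power real_sqrt_divide)
      finally show ?thesis .
    qed
    have "(\<lambda>k. (1 / 2 :: real) ^ k) \<longlonglongrightarrow> 0" by (rule LIMSEQ_power_zero) simp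
    then have "\<bar>coef f n - c n\<bar> \<le> 0"
      by (rule LIMSEQ_le_const) (use bound in \<open>auto intro!: exI[of _ "Suc n"]\<close>)
    then show ?thesis by simp
  qed
  then show ?thesis using f_L2 by blast
qed

end

section \<open>Fractional power spaces and functions of time with values in them\<close>

lemma AE_lebesgue_on_iff:
  fixes S :: "real set"
  assumes "S \<in> sets borel"
  shows "(AE t in lebesgue_on S. P t) \<longleftrightarrow> (AE t\<in>S in lborel. P t)"
  using assms by (simp add: AE_restrict_space_iff AE_completion_iff)

lemma summable_square_le:
  fixes f g :: "nat \<Rightarrow> real"
  assumes "summable g" "\<And>n. (f n)\<^sup>2 \<le> g n"
  shows "summable (\<lambda>n. (f n)\<^sup>2)"
  by (rule summable_comparison_test'[OF assms(1), where N=0]) (simp add: assms(2))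

lemma borel_measurable_lebesgue_on_AE:
  fixes f g :: "real \<Rightarrow> real"
  assumes S: "S \<in> sets borel" and g: "g \<in> borel_measurable (lebesgue_on S)"
    and eq: "AE t\<in>S in lborel. f t = g t"
  shows "f \<in> borel_measurable (lebesgue_on S)"
proof -
  have S': "S \<in> sets lebesgue" using S by simp
  have "(\<lambda>t. if t \<in> S then g t else 0) \<in> borel_measurable lebesgue"
    using g borel_measurable_if[OF S', of g] by simp
  moreover have "AE t in lebesgue. (if t \<in> S then g t else 0) = (if t \<in> S then f t else 0)"
  proof (rule AE_completion)
    show "AE t in lborel. (if t \<in> S then g t else 0) = (if t \<in> S then f t else 0)"
      using eq by eventually_elim auto
  qed
  ultimately have "(\<lambda>t. if t \<in> S then f t else 0) \<in> borel_measurable lebesgue"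
    by (rule borel_measurable_AE)
  then show ?thesis using borel_measurable_if[OF S', of f] by simp
qed

text \<open>
  The problem is posed with Lebesgue measure on intervals, but Fubini's theorem for convolutions is
  applied to \<open>lborel\<close>; Borel representatives connect the two.
\<close>

lemma lebesgue_on_borel_representative:
  fixes f g :: "real \<Rightarrow> real"
  assumes S: "S \<in> sets borel" and [measurable]: "g \<in> borel_measurable borel"
    and eq: "AE t\<in>S in lborel. f t = g t"
  shows "f \<in> borel_measurable (lebesgue_on S)"
    and "(LINT t|lebesgue_on S. f t) = (LBINT t. indicator S t * g t)"
    and "integrable (lebesgue_on S) f \<longleftrightarrow> integrable lborel (\<lambda>t. indicator S t * g t)"
proof -
  have [measurable]: "S \<in> sets borel" by fact
  have g: "g \<in> borel_measurable (lebesgue_on S)"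
    by (intro measurable_restrict_space1 measurable_completion) simp
  show f: "f \<in> borel_measurable (lebesgue_on S)"
    by (rule borel_measurable_lebesgue_on_AE[OF S g eq])
  have ae: "AE t in lebesgue_on S. f t = g t" using eq S by (simp add: AE_lebesgue_on_iff)
  have "(LINT t|lebesgue_on S. f t) = (LINT t|lebesgue_on S. g t)"
    by (rule integral_cong_AE[OF f g ae])
  also have "\<dots> = (\<integral>t. indicator S t * g t \<partial>lebesgue)"
    using S by (subst integral_restrict_space) auto
  also have "\<dots> = (LBINT t. indicator S t * g t)" by (rule integral_completion) simp
  finally show "(LINT t|lebesgue_on S. f t) = (LBINT t. indicator S t * g t)" .
  have "integrable (lebesgue_on S) f \<longleftrightarrow> integrable (lebesgue_on S) g"
    by (rule integrable_cong_AE[OF f g ae])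
  also have "\<dots> \<longleftrightarrow> integrable lebesgue (\<lambda>t. indicator S t * g t)"
    using S by (subst integrable_restrict_space) auto
  also have "\<dots> \<longleftrightarrow> integrable lborel (\<lambda>t. indicator S t * g t)" by (rule integrable_completion) simp
  finally show "integrable (lebesgue_on S) f \<longleftrightarrow> integrable lborel (\<lambda>t. indicator S t * g t)" .
qed

text \<open>
  The uniform lower bound on \<open>l\<close> makes the norm of order \<open>\<gamma> \<ge> 0\<close> stronger than the norm of \<open>L\<^sup>2\<close>.
\<close>

locale spectral_scale = L2_basis \<Omega> \<phi> for \<Omega> :: "(real^'d::finite) set" and \<phi> :: "nat \<Rightarrow> real^'d \<Rightarrow> real" +
  fixes l :: "nat \<Rightarrow> real" and l0 :: real
  assumes l0: "0 < l0" and l_ge: "\<And>n. l0 \<le> l n"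
begin

lemma l_pos: "0 < l n" using l0 l_ge[of n] by simp

abbreviation "D \<equiv> frac_dom \<Omega> l \<phi>"
abbreviation "N \<equiv> frac_norm \<Omega> l \<phi>"

lemma frac_domD: assumes "f \<in> D \<gamma>"
  shows "f \<in> L2_space \<Omega>" "summable (\<lambda>n. (l n powr \<gamma> * coef f n)\<^sup>2)"
  using assms by (auto simp: frac_dom_def)

lemma frac_norm_eq: "N \<gamma> f = sqrt (\<Sum>n. (l n powr \<gamma> * coef f n)\<^sup>2)"
  by (simp add: frac_norm_def)

lemma coefficient_le_frac_norm:
  assumes "f \<in> D \<gamma>" shows "\<bar>l n powr \<gamma> * coef f n\<bar> \<le> N \<gamma> f"
proof -
  have "(l n powr \<gamma> * coef f n)\<^sup>2 \<le> (\<Sum>n. (l n powr \<gamma> * coef f n)\<^sup>2)"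
    using sum_le_suminf[OF frac_domD(2)[OF assms], of "{n}"] by simp
  then have "sqrt ((l n powr \<gamma> * coef f n)\<^sup>2) \<le> N \<gamma> f"
    unfolding frac_norm_eq by (rule real_sqrt_le_mono)
  then show ?thesis by simp
qed

lemma frac_dom_diff:
  assumes f: "f \<in> D \<gamma>" and g: "g \<in> D \<gamma>" shows "(\<lambda>x. f x - g x) \<in> D \<gamma>"
proof -
  let ?a = "\<lambda>n. l n powr \<gamma> * coef f n" and ?b = "\<lambda>n. l n powr \<gamma> * coef g n"
  have "summable (\<lambda>n. 2 * (?a n)\<^sup>2 + 2 * (?b n)\<^sup>2)"
    using frac_domD(2)[OF f] frac_domD(2)[OF g] by (intro summable_add summable_mult)
  moreover have "(?a n - ?b n)\<^sup>2 \<le> 2 * (?a n)\<^sup>2 + 2 * (?b n)\<^sup>2" for n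
    using zero_le_power2[of "?a n + ?b n"] by (simp add: power2_sum power2_diff)
  ultimately have "summable (\<lambda>n. (?a n - ?b n)\<^sup>2)"
    by (rule summable_square_le)
  then show ?thesis
    using frac_domD(1)[OF f] frac_domD(1)[OF g]
    by (simp add: frac_dom_def L2_diff L2_inner_diff_left \<phi>_L2 right_diff_distrib)
qed

text \<open>
  The value \<open>0\<close> outside the square summable sequences makes \<open>vec c\<close> an element of \<open>L\<^sup>2\<close> for
  every \<open>c\<close>, even at the exceptional times at which a series of coefficients diverges.
\<close>

definition vec :: "(nat \<Rightarrow> real) \<Rightarrow> real^'d \<Rightarrow> real" where
  "vec c = (if summable (\<lambda>n. (c n)\<^sup>2)
    then SOME f. f \<in> L2_space \<Omega> \<and> (\<forall>n. coef f n = c n) else (\<lambda>x. 0))"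

lemma vec_L2: "vec c \<in> L2_space \<Omega>"
  and vec_inner: "summable (\<lambda>n. (c n)\<^sup>2) \<Longrightarrow> coef (vec c) n = c n"
proof -
  have "vec c \<in> L2_space \<Omega> \<and> (\<forall>n. coef (vec c) n = c n)" if "summable (\<lambda>n. (c n)\<^sup>2)"
    using someI_ex[OF riesz_fischer[OF that, unfolded Bex_def]] that unfolding vec_def by simp
  then show "vec c \<in> L2_space \<Omega>" "summable (\<lambda>n. (c n)\<^sup>2) \<Longrightarrow> coef (vec c) n = c n"
    by (auto simp: vec_def L2_zero)
qed

lemma summable_unweighted:
  assumes "0 \<le> \<gamma>" "summable (\<lambda>n. (l n powr \<gamma> * c n)\<^sup>2)"
  shows "summable (\<lambda>n. (c n)\<^sup>2)"
proof -
  have "summable (\<lambda>n. (l0 powr - \<gamma>)\<^sup>2 * (l n powr \<gamma> * c n)\<^sup>2)" by (intro summable_mult assms)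
  moreover have "(c n)\<^sup>2 \<le> (l0 powr - \<gamma>)\<^sup>2 * (l n powr \<gamma> * c n)\<^sup>2" for n
  proof -
    have "l0 powr \<gamma> \<le> l n powr \<gamma>" using assms l0 l_ge by (intro powr_mono2) auto
    then have "l0 powr - \<gamma> * l0 powr \<gamma> \<le> l0 powr - \<gamma> * l n powr \<gamma>" by (intro mult_left_mono) auto
    then have 1: "1 \<le> l0 powr - \<gamma> * l n powr \<gamma>" using l0 by (simp flip: powr_add)
    have "\<bar>c n\<bar> * 1 \<le> \<bar>c n\<bar> * (l0 powr - \<gamma> * l n powr \<gamma>)" by (intro mult_left_mono 1) auto
    then have "\<bar>c n\<bar> \<le> \<bar>l0 powr - \<gamma> * (l n powr \<gamma> * c n)\<bar>" by (simp add: abs_mult mult_ac)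
    then show ?thesis by (simp only: abs_le_square_iff flip: power_mult_distrib)
  qed
  ultimately show ?thesis
    by (rule summable_square_le)
qed

lemma vec_frac:
  assumes "0 \<le> \<gamma>" "summable (\<lambda>n. (l n powr \<gamma> * c n)\<^sup>2)"
  shows "vec c \<in> D \<gamma>" "coef (vec c) n = c n" "N \<gamma> (vec c) = sqrt (\<Sum>n. (l n powr \<gamma> * c n)\<^sup>2)"
  using assms vec_L2 vec_inner[OF summable_unweighted[OF assms]] by (auto simp: frac_dom_def frac_norm_eq)

lemma combination_frac_dom: "(\<lambda>x. \<Sum>n<k. c n * \<phi> n x) \<in> D \<gamma>"
proof -
  have "summable (\<lambda>n. (l n powr \<gamma> * (if n < k then c n else 0))\<^sup>2)"
    by (rule summable_finite[of "{..<k}"]) auto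
  then show ?thesis by (simp add: frac_dom_def combination_L2 combination_inner)
qed

text \<open>
  The approximations are finite sections with simple coefficients that are bounded by twice the
  true ones. Hence all errors are dominated by three times the true coefficients, and dominated
  convergence of the series applies.
\<close>

lemma bochner_measurable_vec:
  assumes w: "\<And>n. w n \<in> borel_measurable borel" and \<gamma>: "0 \<le> \<gamma>"
    and sm: "AE t\<in>{0<..<T} in lborel. summable (\<lambda>n. (l n powr \<gamma> * w n t)\<^sup>2)"
  shows "bochner_measurable T (D \<gamma>) (N \<gamma>) (\<lambda>t. vec (\<lambda>n. w n t))"
proof -
  let ?M = "lebesgue_on {0<..<T}"
  have "\<forall>n. \<exists>F. (\<forall>i. simple_function ?M (F i)) \<and> (\<forall>x\<in>space ?M. (\<lambda>i. F i x) \<longlonglongrightarrow> w n x) \<and>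
      (\<forall>i. \<forall>x\<in>space ?M. dist (F i x) 0 \<le> 2 * dist (w n x) 0)"
    by (rule allI, rule borel_measurable_implies_sequence_metric)
       (intro measurable_restrict_space1 measurable_completion, use w in simp)
  from choice[OF this] obtain \<sigma> where \<sigma>_all: "\<forall>n. (\<forall>k. simple_function ?M (\<sigma> n k)) \<and>
      (\<forall>t\<in>space ?M. (\<lambda>k. \<sigma> n k t) \<longlonglongrightarrow> w n t) \<and>
      (\<forall>k. \<forall>t\<in>space ?M. dist (\<sigma> n k t) 0 \<le> 2 * dist (w n t) 0)" by blast
  have \<sigma>: "\<And>n k. simple_function ?M (\<sigma> n k)"
    and \<sigma>_lim: "\<And>n t. t \<in> {0<..<T} \<Longrightarrow> (\<lambda>k. \<sigma> n k t) \<longlonglongrightarrow> w n t"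
    and \<sigma>_bound: "\<And>n k t. t \<in> {0<..<T} \<Longrightarrow> \<bar>\<sigma> n k t\<bar> \<le> 2 * \<bar>w n t\<bar>"
    using \<sigma>_all by (auto simp: space_restrict_space)
  define s where "s k t x = (\<Sum>n<k. \<sigma> n k t * \<phi> n x)" for k t x
  have "simple_function ?M (\<lambda>t x. \<Sum>n<j. \<sigma> n k t * \<phi> n x)" for j k
  proof (induction j)
    case (Suc j)
    from simple_function_compose2[OF Suc \<sigma>[of j k], of "\<lambda>f y x. f x + y * \<phi> j x"]
    show ?case by simp
  qed simp
  then have "simple_function ?M (s k)" for k by (simp add: s_def[abs_def])
  moreover have s_dom: "s k t \<in> D \<gamma>" for k t
    unfolding s_def[abs_def] by (rule combination_frac_dom)
  moreover have "AE t in ?M. (\<lambda>k. N \<gamma> (\<lambda>x. s k t x - vec (\<lambda>n. w n t) x)) \<longlonglongrightarrow> 0"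
    unfolding AE_lebesgue_on_iff[OF borel_open[OF open_greaterThanLessThan]]
    using sm
  proof eventually_elim
    case (elim t)
    show ?case
    proof
      assume t: "t \<in> {0<..<T}"
      with elim have sm: "summable (\<lambda>n. (l n powr \<gamma> * w n t)\<^sup>2)" by simp
      define e where "e k n = (if n < k then \<sigma> n k t else 0) - w n t" for k n
      have N_eq: "N \<gamma> (\<lambda>x. s k t x - vec (\<lambda>n. w n t) x) = sqrt (\<Sum>n. (l n powr \<gamma> * e k n)\<^sup>2)" for k
      proof -
        have "coef (\<lambda>x. s k t x - vec (\<lambda>n. w n t) x) n = e k n" for n
          using vec_frac(2)[OF \<gamma> sm] frac_domD(1)[OF s_dom]
          by (subst L2_inner_diff_left) (auto simp: vec_L2 \<phi>_L2 e_def s_def[abs_def] combination_inner)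
        then show ?thesis by (simp add: frac_norm_eq)
      qed
      have e_bound: "\<bar>e k n\<bar> \<le> 3 * \<bar>w n t\<bar>" for k n
        using \<sigma>_bound[OF t, of n k] by (auto simp: e_def)
      have "((\<lambda>k. \<Sum>n. (l n powr \<gamma> * e k n)\<^sup>2) \<longlongrightarrow> (\<Sum>n. 0)) sequentially"
      proof (rule tannerys_theorem[THEN conjunct2, THEN conjunct2])
        show "summable (\<lambda>n. 9 * (l n powr \<gamma> * w n t)\<^sup>2)" by (intro summable_mult sm)
        have "norm ((l n powr \<gamma> * e k n)\<^sup>2) \<le> 9 * (l n powr \<gamma> * w n t)\<^sup>2" for n k
        proof -
          have "\<bar>l n powr \<gamma> * e k n\<bar> \<le> \<bar>3 * (l n powr \<gamma> * w n t)\<bar>"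
            using mult_left_mono[OF e_bound[of k n], of "l n powr \<gamma>"] by (simp add: abs_mult)
          then have "(l n powr \<gamma> * e k n)\<^sup>2 \<le> (3 * (l n powr \<gamma> * w n t))\<^sup>2" by (simp only: abs_le_square_iff)
          then show ?thesis by (simp add: power_mult_distrib)
        qed
        then show "\<forall>\<^sub>F (n, k) in sequentially \<times>\<^sub>F sequentially. norm ((l n powr \<gamma> * e k n)\<^sup>2) \<le> 9 * (l n powr \<gamma> * w n t)\<^sup>2"
          by (intro always_eventually) auto
        fix n
        have "\<forall>\<^sub>F k in sequentially. \<sigma> n k t - w n t = e k n"
          using eventually_gt_at_top[of n] by eventually_elim (simp add: e_def)
        moreover have "(\<lambda>k. \<sigma> n k t - w n t) \<longlonglongrightarrow> 0"
          using \<sigma>_lim[OF t, of n] by (simp add: LIM_zero)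
        ultimately have "(\<lambda>k. e k n) \<longlonglongrightarrow> 0" by (rule Lim_transform_eventually[rotated])
        then have "(\<lambda>k. (l n powr \<gamma> * e k n)\<^sup>2) \<longlonglongrightarrow> (l n powr \<gamma> * 0)\<^sup>2" by (intro tendsto_intros)
        then show "(\<lambda>k. (l n powr \<gamma> * e k n)\<^sup>2) \<longlonglongrightarrow> 0" by simp
      qed simp
      then have "(\<lambda>k. sqrt (\<Sum>n. (l n powr \<gamma> * e k n)\<^sup>2)) \<longlonglongrightarrow> sqrt 0"
        by (intro tendsto_real_sqrt) simp
      then show "(\<lambda>k. N \<gamma> (\<lambda>x. s k t x - vec (\<lambda>n. w n t) x)) \<longlonglongrightarrow> 0"
        unfolding N_eq by simp
    qed
  qed
  ultimately show ?thesis unfolding bochner_measurable_def by (intro exI[of _ s]) auto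
qed

text \<open>
  Convergence in the graph norm implies convergence of every coefficient, so each coefficient of
  \<open>F\<close> is a limit of simple functions almost everywhere.
\<close>

lemma coefficient_measurable:
  assumes dom: "AE t\<in>{0<..<T} in lborel. F t \<in> D \<gamma>" and bm: "bochner_measurable T (D \<gamma>) (N \<gamma>) F"
  shows "(\<lambda>t. coef (F t) n) \<in> borel_measurable (lebesgue_on {0<..<T})"
proof -
  let ?M = "lebesgue_on {0<..<T}"
  obtain s where s: "\<And>k. simple_function ?M (s k)" "\<And>k t. t \<in> {0<..<T} \<Longrightarrow> s k t \<in> D \<gamma>"
    and lim: "AE t in ?M. (\<lambda>k. N \<gamma> (\<lambda>x. s k t x - F t x)) \<longlonglongrightarrow> 0"
    using bm unfolding bochner_measurable_def by blast
  have [measurable]: "(\<lambda>t. coef (s k t) n) \<in> borel_measurable ?M" for k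
    using simple_function_compose1[OF s(1)] by (rule borel_measurable_simple_function)
  have "(\<lambda>t. lim (\<lambda>k. coef (s k t) n)) \<in> borel_measurable ?M" by measurable
  moreover have "AE t\<in>{0<..<T} in lborel. coef (F t) n = lim (\<lambda>k. coef (s k t) n)"
    using dom lim[unfolded AE_lebesgue_on_iff[OF borel_open[OF open_greaterThanLessThan]]]
  proof eventually_elim
    case (elim t)
    show ?case
    proof
      assume t: "t \<in> {0<..<T}"
      with elim have F: "F t \<in> D \<gamma>" and lim: "(\<lambda>k. N \<gamma> (\<lambda>x. s k t x - F t x)) \<longlonglongrightarrow> 0" by auto
      have "(\<lambda>k. coef (s k t) n - coef (F t) n) \<longlonglongrightarrow> 0"
      proof (rule Lim_null_comparison)
        show "(\<lambda>k. N \<gamma> (\<lambda>x. s k t x - F t x) / l n powr \<gamma>) \<longlonglongrightarrow> 0"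
          using tendsto_divide[OF lim tendsto_const[of "l n powr \<gamma>"]] l_pos[of n] by simp
        show "\<forall>\<^sub>F k in sequentially. norm (coef (s k t) n - coef (F t) n)
            \<le> N \<gamma> (\<lambda>x. s k t x - F t x) / l n powr \<gamma>"
        proof (intro always_eventually allI)
          fix k
          have "\<bar>l n powr \<gamma> * (coef (s k t) n - coef (F t) n)\<bar> \<le> N \<gamma> (\<lambda>x. s k t x - F t x)"
            using coefficient_le_frac_norm[OF frac_dom_diff[OF s(2)[OF t, of k] F], of n] frac_domD(1)[OF s(2)[OF t]] frac_domD(1)[OF F]
            by (simp add: L2_inner_diff_left \<phi>_L2)
          then show "norm (coef (s k t) n - coef (F t) n) \<le> N \<gamma> (\<lambda>x. s k t x - F t x) / l n powr \<gamma>"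
            using l_pos[of n] by (simp add: abs_mult pos_le_divide_eq mult.commute)
        qed
      qed
      then have "(\<lambda>k. coef (s k t) n) \<longlonglongrightarrow> coef (F t) n"
        by (rule LIM_zero_cancel)
      then show "coef (F t) n = lim (\<lambda>k. coef (s k t) n)"
        by (rule limI[symmetric])
    qed
  qed
  ultimately show ?thesis by (rule borel_measurable_lebesgue_on_AE[rotated]) simp
qed

lemma borel_representative:
  fixes h :: "real \<Rightarrow> real"
  assumes h: "h \<in> borel_measurable (lebesgue_on {0<..<T})"
  obtains f where "f \<in> borel_measurable borel" "\<And>t. t \<notin> {0<..<T} \<Longrightarrow> f t = 0"
    "AE t\<in>{0<..<T} in lborel. h t = f t"
proof -
  have "(\<lambda>t. if t \<in> {0<..<T} then h t else 0) \<in> borel_measurable (completion lborel)"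
    using h borel_measurable_if[of "{0<..<T}" h] by simp
  then obtain f where [measurable]: "f \<in> borel_measurable lborel"
    and f: "AE t in lborel. (if t \<in> {0<..<T} then h t else 0) = f t"
    using completion_ex_borel_measurable_real by blast
  show ?thesis
  proof (rule that[of "\<lambda>t. indicator {0<..<T} t * f t"])
    show "(\<lambda>t. indicator {0<..<T} t * f t) \<in> borel_measurable borel" by simp
    show "AE t\<in>{0<..<T} in lborel. h t = indicator {0<..<T} t * f t"
      using f by eventually_elim auto
  qed simp
qed

definition is_coeffs :: "real \<Rightarrow> (real \<Rightarrow> real^'d \<Rightarrow> real) \<Rightarrow> (nat \<Rightarrow> real \<Rightarrow> real) \<Rightarrow> bool" where
  "is_coeffs T F f \<longleftrightarrow> (\<forall>n. f n \<in> borel_measurable borel) \<and> (\<forall>n t. t \<notin> {0<..<T} \<longrightarrow> f n t = 0) \<and>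
     (AE t\<in>{0<..<T} in lborel. (\<forall>n. coef (F t) n = f n t))"

text \<open>
  The coefficients are set to \<open>0\<close> on the null set where their weighted squares are not summable,
  so that later estimates hold at every time and not only at almost every time.
\<close>

lemma Lp_frac_coefficients:
  assumes F: "F \<in> Lp_frac \<Omega> l \<phi> p T \<gamma>"
  obtains f where "is_coeffs T F f" "\<And>t. summable (\<lambda>n. (l n powr \<gamma> * f n t)\<^sup>2)"
    "AE t\<in>{0<..<T} in lborel. N \<gamma> (F t) = sqrt (\<Sum>n. (l n powr \<gamma> * f n t)\<^sup>2)"
proof -
  have dom: "AE t\<in>{0<..<T} in lborel. F t \<in> D \<gamma>" and bm: "bochner_measurable T (D \<gamma>) (N \<gamma>) F"
    using F by (auto simp: Lp_frac_def bochner_Lp_def AE_lebesgue_on_iff)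
  have "\<forall>n. \<exists>f. f \<in> borel_measurable borel \<and> (\<forall>t. t \<notin> {0<..<T} \<longrightarrow> f t = 0) \<and>
      (AE t\<in>{0<..<T} in lborel. coef (F t) n = f t)"
  proof
    fix n
    obtain f where "f \<in> borel_measurable borel" "\<And>t. t \<notin> {0<..<T} \<Longrightarrow> f t = 0"
      "AE t\<in>{0<..<T} in lborel. coef (F t) n = f t"
      by (rule borel_representative[OF coefficient_measurable[OF dom bm, of n]], rule that)
    then show "\<exists>f. f \<in> borel_measurable borel \<and> (\<forall>t. t \<notin> {0<..<T} \<longrightarrow> f t = 0) \<and>
      (AE t\<in>{0<..<T} in lborel. coef (F t) n = f t)" by blast
  qed
  from choice[OF this] obtain f0 where f0 [measurable]: "\<And>n. f0 n \<in> borel_measurable borel"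
    and f0_off: "\<And>n t. t \<notin> {0<..<T} \<Longrightarrow> f0 n t = 0"
    and f0_eq: "\<And>n. AE t\<in>{0<..<T} in lborel. coef (F t) n = f0 n t" by blast
  define good where "good t \<longleftrightarrow> (\<Sum>n. ennreal ((l n powr \<gamma> * f0 n t)\<^sup>2)) \<noteq> \<infinity>" for t
  have [measurable]: "Measurable.pred borel good" unfolding good_def by measurable
  define f where "f n t = (if good t then f0 n t else 0)" for n t
  have f_meas: "f n \<in> borel_measurable borel" for n unfolding f_def[abs_def] by measurable
  have f_sum: "summable (\<lambda>n. (l n powr \<gamma> * f n t)\<^sup>2)" for t
  proof (cases "good t")
    case True
    then show ?thesis unfolding good_def f_def by (intro summable_suminf_not_top) (auto simp: good_def)
  qed (simp add: f_def)
  have f0_all: "AE t in lborel. \<forall>n. t \<in> {0<..<T} \<longrightarrow> coef (F t) n = f0 n t"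
    unfolding AE_all_countable using f0_eq by blast
  have ae: "AE t\<in>{0<..<T} in lborel. F t \<in> D \<gamma> \<and> (\<forall>n. coef (F t) n = f n t)"
    using dom f0_all
  proof eventually_elim
    case (elim t)
    show ?case
    proof
      assume t: "t \<in> {0<..<T}"
      with elim have F: "F t \<in> D \<gamma>" and eq: "\<And>n. coef (F t) n = f0 n t" by auto
      have "good t"
        using frac_domD(2)[OF F] unfolding good_def eq by (subst suminf_ennreal2) auto
      then show "F t \<in> D \<gamma> \<and> (\<forall>n. coef (F t) n = f n t)" using F eq by (simp add: f_def)
    qed
  qed
  show ?thesis
  proof (rule that[of f])
    have "AE t\<in>{0<..<T} in lborel. (\<forall>n. coef (F t) n = f n t)"
      using ae by eventually_elim simp
    then show "is_coeffs T F f" using f_meas f0_off by (simp add: is_coeffs_def f_def)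
    show "AE t\<in>{0<..<T} in lborel. N \<gamma> (F t) = sqrt (\<Sum>n. (l n powr \<gamma> * f n t)\<^sup>2)"
      using ae by eventually_elim (simp add: frac_norm_eq)
  qed (rule f_sum)
qed

lemma Lp_frac_norm_finite:
  assumes p: "1 \<le> p" "p \<noteq> \<infinity>" and [measurable]: "g \<in> borel_measurable borel"
    and g_off: "\<And>t. t \<notin> {0<..<T} \<Longrightarrow> g t = 0"
    and eq: "AE t\<in>{0<..<T} in lborel. N \<gamma> (F t) = g t"
  shows "integrable (lebesgue_on {0<..<T}) (\<lambda>t. N \<gamma> (F t) powr enn2real p) \<longleftrightarrow> integrable lborel (\<lambda>t. g t powr enn2real p)"
    and "Lp_frac_norm \<Omega> l \<phi> p T \<gamma> F = (LBINT t. g t powr enn2real p) powr (1 / enn2real p)"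
proof -
  have ind: "(\<lambda>t. indicator {0<..<T} t * g t powr enn2real p) = (\<lambda>t. g t powr enn2real p)"
    using g_off by (auto split: split_indicator)
  have m: "(\<lambda>t. g t powr enn2real p) \<in> borel_measurable borel" by measurable
  have ae: "AE t\<in>{0<..<T} in lborel. N \<gamma> (F t) powr enn2real p = g t powr enn2real p"
    using eq by eventually_elim simp
  note rep = lebesgue_on_borel_representative[OF _ m ae, unfolded ind]
  show "integrable (lebesgue_on {0<..<T}) (\<lambda>t. N \<gamma> (F t) powr enn2real p) \<longleftrightarrow> integrable lborel (\<lambda>t. g t powr enn2real p)"
    by (rule rep(3)) simp
  show "Lp_frac_norm \<Omega> l \<phi> p T \<gamma> F = (LBINT t. g t powr enn2real p) powr (1 / enn2real p)"
    using p rep(2) by (simp add: Lp_frac_norm_def bochner_norm_def)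
qed

text \<open>
  If the essential supremum is \<open>-\<infinity>\<close>, its real value \<open>0\<close> says nothing, but then the interval is a
  null set and there is nothing to show.
\<close>

lemma Lp_frac_norm_infinite:
  assumes F: "F \<in> Lp_frac \<Omega> l \<phi> \<infinity> T \<gamma>"
    and eq: "AE t\<in>{0<..<T} in lborel. N \<gamma> (F t) = g t"
  shows "AE t\<in>{0<..<T} in lborel. g t \<le> Lp_frac_norm \<Omega> l \<phi> \<infinity> T \<gamma> F"
proof -
  let ?E = "esssup (lebesgue_on {0<..<T}) (\<lambda>t. ereal (N \<gamma> (F t)))"
  have fin: "?E < \<infinity>" using F by (simp add: Lp_frac_def bochner_Lp_def)
  have nm: "Lp_frac_norm \<Omega> l \<phi> \<infinity> T \<gamma> F = real_of_ereal ?E" by (simp add: Lp_frac_norm_def bochner_norm_def)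
  have "AE t in lebesgue_on {0<..<T}. ereal (N \<gamma> (F t)) \<le> ?E" by (rule esssup_AE)
  then have "AE t\<in>{0<..<T} in lborel. ereal (N \<gamma> (F t)) \<le> ?E" by (simp add: AE_lebesgue_on_iff)
  then show ?thesis using eq
  proof eventually_elim
    case (elim t)
    then show ?case using fin unfolding nm by (cases ?E) auto
  qed
qed

text \<open>
  A scalar majorant \<open>G\<close> of the weighted norms of the coefficients decides on membership and bounds
  the norm.
\<close>

lemma Lp_frac_vec:
  assumes w: "\<And>n. w n \<in> borel_measurable borel" and \<gamma>: "0 \<le> \<gamma>" and p: "1 \<le> p"
    and G [measurable]: "G \<in> borel_measurable borel"
    and le: "AE t\<in>{0<..<T} in lborel.
      summable (\<lambda>n. (l n powr \<gamma> * w n t)\<^sup>2) \<and> sqrt (\<Sum>n. (l n powr \<gamma> * w n t)\<^sup>2) \<le> G t"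
  shows "p \<noteq> \<infinity> \<Longrightarrow> integrable lborel (\<lambda>t. G t powr enn2real p) \<Longrightarrow>
      (\<lambda>t. vec (\<lambda>n. w n t)) \<in> Lp_frac \<Omega> l \<phi> p T \<gamma> \<and>
      Lp_frac_norm \<Omega> l \<phi> p T \<gamma> (\<lambda>t. vec (\<lambda>n. w n t)) \<le> (LBINT t. G t powr enn2real p) powr (1 / enn2real p)"
    and "p = \<infinity> \<Longrightarrow> 0 \<le> B \<Longrightarrow> AE t\<in>{0<..<T} in lborel. G t \<le> B \<Longrightarrow>
      (\<lambda>t. vec (\<lambda>n. w n t)) \<in> Lp_frac \<Omega> l \<phi> p T \<gamma> \<and>
      Lp_frac_norm \<Omega> l \<phi> p T \<gamma> (\<lambda>t. vec (\<lambda>n. w n t)) \<le> B"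
proof -
  let ?u = "\<lambda>t. vec (\<lambda>n. w n t)"
  let ?S = "\<lambda>t. \<Sum>n. (l n powr \<gamma> * w n t)\<^sup>2"
  define g where "g t = indicator {0<..<T} t * sqrt (?S t)" for t
  have [measurable]: "w n \<in> borel_measurable borel" for n by (rule w)
  have g_meas [measurable]: "g \<in> borel_measurable borel" unfolding g_def by measurable
  have bm: "bochner_measurable T (D \<gamma>) (N \<gamma>) ?u"
    using le by (intro bochner_measurable_vec w \<gamma>) (auto elim: eventually_mono)
  have dom: "AE t\<in>{0<..<T} in lborel. ?u t \<in> D \<gamma>"
    using le by eventually_elim (auto intro: vec_frac[OF \<gamma>])
  have nm: "AE t\<in>{0<..<T} in lborel. N \<gamma> (?u t) = g t"
    using le by eventually_elim (auto simp: g_def vec_frac[OF \<gamma>])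
  have g_le: "AE t\<in>{0<..<T} in lborel. 0 \<le> g t \<and> g t \<le> G t"
    using le by eventually_elim (auto simp: g_def intro!: suminf_nonneg)
  {
    assume fin: "p \<noteq> \<infinity>" and int: "integrable lborel (\<lambda>t. G t powr enn2real p)"
    have p0: "0 < enn2real p" using p fin by (cases p) (auto simp: ennreal_le_iff simp flip: ennreal_1)
    have le': "AE t in lborel. g t powr enn2real p \<le> G t powr enn2real p"
      using g_le
    proof eventually_elim
      case (elim t)
      show ?case
        by (cases "t \<in> {0<..<T}") (use elim p0 in \<open>auto intro!: powr_mono2 simp: g_def[of t]\<close>)
    qed
    have int_g: "integrable lborel (\<lambda>t. g t powr enn2real p)"
      by (rule Bochner_Integration.integrable_bound[OF int]) (use le' in auto)
    have g_off: "g t = 0" if "t \<notin> {0<..<T}" for t using that by (simp add: g_def)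
    note fin_norm = Lp_frac_norm_finite[OF p fin g_meas g_off nm]
    have "(LBINT t. g t powr enn2real p) powr (1 / enn2real p) \<le> (LBINT t. G t powr enn2real p) powr (1 / enn2real p)"
      using p0 le' int int_g by (intro powr_mono2 integral_mono_AE integral_nonneg_AE) auto
    then show "?u \<in> Lp_frac \<Omega> l \<phi> p T \<gamma> \<and>
      Lp_frac_norm \<Omega> l \<phi> p T \<gamma> ?u \<le> (LBINT t. G t powr enn2real p) powr (1 / enn2real p)"
      using fin bm dom int_g fin_norm by (simp add: Lp_frac_def bochner_Lp_def AE_lebesgue_on_iff)
  }
  {
    assume inf: "p = \<infinity>" and B: "0 \<le> B" "AE t\<in>{0<..<T} in lborel. G t \<le> B"
    have "(\<lambda>t. N \<gamma> (?u t)) \<in> borel_measurable (lebesgue_on {0<..<T})"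
      by (rule lebesgue_on_borel_representative(1)[OF _ g_meas nm]) simp
    then have m: "(\<lambda>t. ereal (N \<gamma> (?u t))) \<in> borel_measurable (lebesgue_on {0<..<T})" by measurable
    have "AE t in lebesgue_on {0<..<T}. ereal (N \<gamma> (?u t)) \<le> ereal B"
      unfolding AE_lebesgue_on_iff[OF borel_open[OF open_greaterThanLessThan]]
      using nm g_le B(2) by eventually_elim auto
    then have E: "esssup (lebesgue_on {0<..<T}) (\<lambda>t. ereal (N \<gamma> (?u t))) \<le> ereal B"
      by (rule esssup_I[OF m])
    then have "real_of_ereal (esssup (lebesgue_on {0<..<T}) (\<lambda>t. ereal (N \<gamma> (?u t)))) \<le> B"
      using B(1) by (cases "esssup (lebesgue_on {0<..<T}) (\<lambda>t. ereal (N \<gamma> (?u t)))") auto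
    moreover have "esssup (lebesgue_on {0<..<T}) (\<lambda>t. ereal (N \<gamma> (?u t))) < \<infinity>"
      using E by (rule le_less_trans) simp
    ultimately show "?u \<in> Lp_frac \<Omega> l \<phi> p T \<gamma> \<and> Lp_frac_norm \<Omega> l \<phi> p T \<gamma> ?u \<le> B"
      using inf bm dom by (simp add: Lp_frac_def bochner_Lp_def Lp_frac_norm_def bochner_norm_def AE_lebesgue_on_iff)
  }
qed

end

section \<open>The coefficient equations\<close>

lemma enn2real_ge_1: "1 \<le> p \<Longrightarrow> p \<noteq> \<infinity> \<Longrightarrow> 1 \<le> enn2real p"
  by (cases p) (auto simp flip: ennreal_1 simp: ennreal_le_iff2)

lemma powr_at_0_tendsto:
  fixes b B :: real
  assumes "0 < b"
  shows "((\<lambda>t. B * (t powr b / b)) \<longlongrightarrow> 0) (at_right 0)"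
proof -
  have "((\<lambda>t::real. t powr b) \<longlongrightarrow> 0) (at_right 0)" using assms by real_asymp
  from tendsto_mult_left[OF this, of "B / b"] show ?thesis by simp
qed

lemma AE_interval_ex:
  assumes "AE t\<in>{0<..<T} in lborel. P t" "0 < (T::real)"
  shows "\<exists>t\<in>{0<..<T}. P t"
proof (rule ccontr)
  assume neg: "\<not> ?thesis"
  have "AE t in lborel. t \<notin> {0<..<T}" using assms(1) by eventually_elim (use neg in auto)
  then have "emeasure lborel {0<..<T} = 0"
    by (subst (asm) AE_iff_null_sets[symmetric]) auto
  then show False using assms(2) by simp
qed

locale multi_term_diffusion = spectral_scale \<Omega> \<phi> l l0
  for \<Omega> :: "(real^'d::finite) set" and \<phi> :: "nat \<Rightarrow> real^'d \<Rightarrow> real" and l :: "nat \<Rightarrow> real" and l0 :: real +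
  fixes T :: real and m :: nat and \<alpha> q :: "nat \<Rightarrow> real"
  assumes T: "0 < T" and m: "1 \<le> m" and \<alpha>: "\<And>j. j \<in> {1..m} \<Longrightarrow> 0 < \<alpha> j \<and> \<alpha> j < 1"
    and q: "\<And>j. j \<in> {1..m} \<Longrightarrow> 0 < q j"
begin

abbreviation "Lp p \<equiv> Lp_frac \<Omega> l \<phi> p T"
abbreviation "LpN p \<equiv> Lp_frac_norm \<Omega> l \<phi> p T"

text \<open>
  The eigenvalue term is treated as one more memory term, with index \<open>0\<close>: a kernel of order \<open>0\<close> is
  constant and stands for plain integration.
\<close>

definition weight :: "nat \<Rightarrow> nat \<Rightarrow> real" where
  "weight n j = (if j = 0 then l n else q j / Gamma (1 - \<alpha> j))"

definition order :: "nat \<Rightarrow> real" where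
  "order j = (if j = 0 then 0 else \<alpha> j)"

definition memory :: "nat \<Rightarrow> real \<Rightarrow> real" where
  "memory n = trunc T (power_kernel {0..m} (weight n) order)"

lemma order_bounds: "j \<in> {0..m} \<Longrightarrow> 0 \<le> order j \<and> order j < 1"
  using \<alpha>[of j] by (auto simp: order_def)

lemma weight_pos: "j \<in> {0..m} \<Longrightarrow> 0 < weight n j"
  using \<alpha>[of j] q[of j] l_pos[of n] by (auto simp: weight_def)

lemma \<alpha>_first: "0 < \<alpha> 1" "\<alpha> 1 < 1"
  using \<alpha>[of 1] m by auto

lemma memory_eq: "memory n s = (\<Sum>j\<in>{0..m}. weight n j * power_singularity T (1 - order j) s)"
  by (cases "0 < s \<and> s < T") (auto simp: memory_def power_singularity_def trunc_def power_kernel_def sum_distrib_left)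

lemma memory_measurable [measurable]: "memory n \<in> borel_measurable borel"
  unfolding memory_def by measurable

lemma integrable_singularity: "j \<in> {0..m} \<Longrightarrow> integrable lborel (power_singularity T (1 - order j))"
  using has_bochner_integral_power_singularity[of "1 - order j" T] order_bounds[of j] T
  by (auto simp: has_bochner_integral_iff)

lemma integrable_memory: "integrable lborel (memory n)"
  unfolding memory_eq[abs_def] by (intro Bochner_Integration.integrable_sum integrable_mult_right integrable_singularity)

lemma memory_off: "t \<le> 0 \<Longrightarrow> memory n t = 0"
  by (simp add: memory_def)

text \<open>
  Weights with positive index are the same for all modes, so the mode \<open>0\<close> in \<open>weight 0 1\<close> is no
  restriction.
\<close>

definition C\<^sub>0 :: real where
  "C\<^sub>0 = 2 powr (1 - \<alpha> 1) / weight 0 1"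

definition is_resolvent :: "nat \<Rightarrow> (real \<Rightarrow> real) \<Rightarrow> bool" where
  "is_resolvent n r \<longleftrightarrow> r \<in> borel_measurable borel \<and> (\<forall>t. t \<notin> {0<..<T} \<longrightarrow> r t = 0) \<and> (\<forall>t. 0 \<le> r t) \<and>
    (\<forall>t\<in>{0<..<T}. r t \<le> C\<^sub>0 * t powr (\<alpha> 1 - 1)) \<and>
    (\<forall>t\<in>{0<..<T}. l n * t * r t \<le> 2) \<and> integrable lborel r \<and> l n * (LBINT t. r t) \<le> 1 \<and>
    (\<forall>t. 0 < t \<longrightarrow> t < T \<longrightarrow> conv (memory n) r t = 1)"

definition R :: "nat \<Rightarrow> real \<Rightarrow> real" where
  "R n = (SOME r. is_resolvent n r)"

lemma is_resolvent_R: "is_resolvent n (R n)"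
proof -
  have J: "finite {0..m}" "1 \<in> {0..m}" "0 \<in> {0..m}" using m by auto
  have pos: "0 < weight n 1" "0 < order 1" "0 < weight n 0" "order 0 = 0"
    using weight_pos[OF J(2)] weight_pos[OF J(3)] \<alpha>_first by (auto simp: order_def)
  have eq: "weight n 1 = weight 0 1" "weight n 0 = l n" "order 1 = \<alpha> 1"
    by (auto simp: weight_def order_def)
  have "\<exists>r. is_resolvent n r"
    using resolvent_bounds[where c="weight n" and a=order and J="{0..m}" and i=1 and z=0, OF J _ order_bounds pos T]
      weight_pos[of _ n]
    unfolding is_resolvent_def memory_def C\<^sub>0_def eq by (simp add: less_imp_le)
  then show ?thesis unfolding R_def by (rule someI_ex)
qed

lemma R_measurable [measurable]: "R n \<in> borel_measurable borel"
  and R_off: "t \<notin> {0<..<T} \<Longrightarrow> R n t = 0"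
  and R_nonneg: "0 \<le> R n t"
  and R_singularity: "t \<in> {0<..<T} \<Longrightarrow> R n t \<le> C\<^sub>0 * t powr (\<alpha> 1 - 1)"
  and R_decay: "t \<in> {0<..<T} \<Longrightarrow> l n * t * R n t \<le> 2"
  and integrable_R: "integrable lborel (R n)"
  and integral_R: "l n * (LBINT t. R n t) \<le> 1"
  and R_resolvent: "0 < t \<Longrightarrow> t < T \<Longrightarrow> conv (memory n) (R n) t = 1"
  using is_resolvent_R[of n] by (auto simp: is_resolvent_def)

lemma R_nonpos: "t \<le> 0 \<Longrightarrow> R n t = 0"
  by (rule R_off) simp

lemma memory_term_eq_conv:
  assumes h: "AE s\<in>{0<..<T} in lborel. h s = w s" and [measurable]: "w \<in> borel_measurable borel"
    and w0: "\<And>s. s \<notin> {0<..<T} \<Longrightarrow> w s = 0" and t: "t \<in> {0<..<T}"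
  shows "(LINT s|lebesgue_on {0<..<t}. (t - s) powr - a * h s) = conv (power_singularity T (1 - a)) w t"
    and "(LINT s|lebesgue_on {0<..<t}. h s) = (LBINT s. indicator {0<..<t} s * w s)"
    and "(LINT s|lebesgue_on {0<..<t}. h s) = conv (power_singularity T 1) w t"
proof -
  have ae: "AE s\<in>{0<..<t} in lborel. h s = w s"
    using h by eventually_elim (use t in auto)
  then have ae': "AE s\<in>{0<..<t} in lborel. (t - s) powr - a * h s = (t - s) powr - a * w s"
    by eventually_elim auto
  have pw: "indicator {0<..<t} s * ((t - s) powr - a * w s) = power_singularity T (1 - a) (t - s) * w s" for s a
    using w0[of s] t by (cases "s \<le> 0"; cases "t \<le> s") (auto simp: power_singularity_def)
  have m: "(\<lambda>s. (t - s) powr - a * w s) \<in> borel_measurable borel" by measurable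
  show "(LINT s|lebesgue_on {0<..<t}. (t - s) powr - a * h s) = conv (power_singularity T (1 - a)) w t"
    using lebesgue_on_borel_representative(2)[OF _ m ae'] by (simp only: pw conv_def borel_open open_greaterThanLessThan)
  show h_int: "(LINT s|lebesgue_on {0<..<t}. h s) = (LBINT s. indicator {0<..<t} s * w s)"
    using lebesgue_on_borel_representative(2)[OF _ assms(2) ae] by simp
  have "indicator {0<..<t} s * w s = power_singularity T 1 (t - s) * w s" for s
    using w0[of s] t by (cases "s \<le> 0"; cases "t \<le> s") (auto simp: power_singularity_def)
  then show "(LINT s|lebesgue_on {0<..<t}. h s) = conv (power_singularity T 1) w t"
    unfolding h_int conv_def by (intro Bochner_Integration.integral_cong refl)
qed

text \<open>
  The integrals of the single terms may be added only where all of them exist, which is the case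
  for almost every \<open>t\<close>.
\<close>

lemma memory_eq_conv:
  assumes h: "AE s\<in>{0<..<T} in lborel. h s = w s" and w: "integrable lborel w"
    and w0: "\<And>s. s \<notin> {0<..<T} \<Longrightarrow> w s = 0"
  shows "AE t\<in>{0<..<T} in lborel.
    (\<Sum>j=1..m. q j / Gamma (1 - \<alpha> j) * (LINT s|lebesgue_on {0<..<t}. (t - s) powr (- \<alpha> j) * h s))
      + l n * (LINT s|lebesgue_on {0<..<t}. h s) = conv (memory n) w t"
proof -
  have [measurable]: "w \<in> borel_measurable borel" using w by auto
  have "AE t in lborel. \<forall>j\<in>{0..m}. integrable lborel (\<lambda>s. power_singularity T (1 - order j) (t - s) * w s)"
    by (intro AE_finite_allI AE_integrable_conv integrable_singularity w) auto
  then show ?thesis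
  proof eventually_elim
    case (elim t)
    show ?case
    proof
      assume t: "t \<in> {0<..<T}"
      have "conv (memory n) w t = (LBINT s. (\<Sum>j\<in>{0..m}. weight n j * (power_singularity T (1 - order j) (t - s) * w s)))"
        by (simp add: conv_def memory_eq sum_distrib_right mult.assoc)
      also have "\<dots> = (\<Sum>j\<in>{0..m}. weight n j * conv (power_singularity T (1 - order j)) w t)"
        using elim by (subst Bochner_Integration.integral_sum) (auto simp: conv_def)
      also have "\<dots> = l n * conv (power_singularity T 1) w t + (\<Sum>j=1..m. q j / Gamma (1 - \<alpha> j) * conv (power_singularity T (1 - \<alpha> j)) w t)"
        by (subst sum.atLeast_Suc_atMost) (auto simp: weight_def order_def)
      also have "\<dots> = (\<Sum>j=1..m. q j / Gamma (1 - \<alpha> j) * (LINT s|lebesgue_on {0<..<t}. (t - s) powr (- \<alpha> j) * h s))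
          + l n * (LINT s|lebesgue_on {0<..<t}. h s)"
        using memory_term_eq_conv[OF h _ w0 t] by simp
      finally show "(\<Sum>j=1..m. q j / Gamma (1 - \<alpha> j) * (LINT s|lebesgue_on {0<..<t}. (t - s) powr (- \<alpha> j) * h s))
        + l n * (LINT s|lebesgue_on {0<..<t}. h s) = conv (memory n) w t" by simp
    qed
  qed
qed

abbreviation "solves \<equiv> is_solution \<Omega> l \<phi> m \<alpha> q T"

text \<open>
  The left hand side of the equation is a convolution with \<open>memory n\<close>; the right hand side is left
  as it is, since uniqueness only compares it with itself.
\<close>

lemma solution_coefficients:
  assumes "solves F u"
  obtains w where "w \<in> borel_measurable borel" "integrable lborel w" "\<And>t. t \<notin> {0<..<T} \<Longrightarrow> w t = 0"
    "AE t\<in>{0<..<T} in lborel. coef (u t) n = w t"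
    "AE t\<in>{0<..<T} in lborel. conv (memory n) w t = (LINT s|lebesgue_on {0<..<t}. coef (F s) n)"
proof -
  let ?h = "\<lambda>t. coef (u t) n"
  have int: "integrable (lebesgue_on {0<..<T}) ?h" using assms by (simp add: is_solution_def)
  obtain w where w [measurable]: "w \<in> borel_measurable borel" and w0: "\<And>t. t \<notin> {0<..<T} \<Longrightarrow> w t = 0"
    and eq: "AE t\<in>{0<..<T} in lborel. ?h t = w t"
    by (rule borel_representative[OF borel_measurable_integrable[OF int]], rule that)
  have "(\<lambda>t. indicator {0<..<T} t * w t) = w" using w0 by (auto split: split_indicator)
  then have w_int: "integrable lborel w"
    using lebesgue_on_borel_representative(3)[OF _ w eq] int by simp
  have "AE t\<in>{0<..<T} in lborel. (\<Sum>j=1..m. q j / Gamma (1 - \<alpha> j) * (LINT s|lebesgue_on {0<..<t}. (t - s) powr (- \<alpha> j) * ?h s))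
      + l n * (LINT s|lebesgue_on {0<..<t}. ?h s) = (LINT s|lebesgue_on {0<..<t}. coef (F s) n)"
    using assms by (simp add: is_solution_def AE_lebesgue_on_iff)
  moreover have "AE t\<in>{0<..<T} in lborel. (\<Sum>j=1..m. q j / Gamma (1 - \<alpha> j) * (LINT s|lebesgue_on {0<..<t}. (t - s) powr (- \<alpha> j) * ?h s))
      + l n * (LINT s|lebesgue_on {0<..<t}. ?h s) = conv (memory n) w t"
    by (rule memory_eq_conv[OF eq w_int w0])
  ultimately have "AE t\<in>{0<..<T} in lborel. conv (memory n) w t = (LINT s|lebesgue_on {0<..<t}. coef (F s) n)"
    by eventually_elim auto
  then show ?thesis using that w w_int w0 eq by blast
qed

text \<open>
  The difference of two solutions satisfies the homogeneous equation in every mode, and an element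
  of \<open>L\<^sup>2\<close> is determined by its coefficients.
\<close>

lemma solution_unique:
  assumes u: "solves F u" and v: "solves F v"
  shows "ae_eq \<Omega> T v u"
proof -
  have "AE t\<in>{0<..<T} in lborel. coef (v t) n = coef (u t) n" for n
  proof -
    obtain w where w: "integrable lborel w" "\<And>t. t \<notin> {0<..<T} \<Longrightarrow> w t = 0"
      "AE t\<in>{0<..<T} in lborel. coef (u t) n = w t"
      "AE t\<in>{0<..<T} in lborel. conv (memory n) w t = (LINT s|lebesgue_on {0<..<t}. coef (F s) n)"
      by (rule solution_coefficients[OF u, of n], rule that)
    obtain w' where w': "integrable lborel w'" "\<And>t. t \<notin> {0<..<T} \<Longrightarrow> w' t = 0"
      "AE t\<in>{0<..<T} in lborel. coef (v t) n = w' t"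
      "AE t\<in>{0<..<T} in lborel. conv (memory n) w' t = (LINT s|lebesgue_on {0<..<t}. coef (F s) n)"
      by (rule solution_coefficients[OF v, of n], rule that)
    have "AE t in lborel. (\<lambda>t. w' t - w t) t = 0"
    proof (rule volterra_unique[where k="memory n" and r="R n", OF integrable_memory memory_off integrable_R R_nonpos R_resolvent])
      show "integrable lborel (\<lambda>t. w' t - w t)" using w w' by simp
      show "AE t\<in>{0<..<T} in lborel. conv (memory n) (\<lambda>t. w' t - w t) t = 0"
        using w(4) w'(4) AE_integrable_conv[OF integrable_memory w(1), of n] AE_integrable_conv[OF integrable_memory w'(1), of n]
        by eventually_elim (auto simp: conv_def right_diff_distrib)
    qed (use w w' T in auto)
    then show ?thesis using w(3) w'(3) by eventually_elim auto
  qed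
  then have "AE t in lborel. \<forall>n. t \<in> {0<..<T} \<longrightarrow> coef (v t) n = coef (u t) n"
    unfolding AE_all_countable by blast
  moreover have "AE t\<in>{0<..<T} in lborel. u t \<in> L2_space \<Omega>" "AE t\<in>{0<..<T} in lborel. v t \<in> L2_space \<Omega>"
    using u v by (auto simp: is_solution_def AE_lebesgue_on_iff)
  ultimately have "AE t\<in>{0<..<T} in lborel. (AE x in lebesgue_on \<Omega>. v t x = u t x)"
    by eventually_elim (auto intro: eq_coeffs_AE)
  then show ?thesis by (simp add: ae_eq_def AE_lebesgue_on_iff)
qed

definition sol_coeff :: "(nat \<Rightarrow> real \<Rightarrow> real) \<Rightarrow> nat \<Rightarrow> real \<Rightarrow> real" where
  "sol_coeff f n = trunc T (conv (R n) (f n))"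

definition sol :: "(nat \<Rightarrow> real \<Rightarrow> real) \<Rightarrow> real \<Rightarrow> real^'d \<Rightarrow> real" where
  "sol f t = vec (\<lambda>n. sol_coeff f n t)"

lemma sol_solves:
  assumes F: "is_coeffs T F f" and f: "\<And>n. integrable lborel (f n)"
    and sm: "AE t\<in>{0<..<T} in lborel. summable (\<lambda>n. (sol_coeff f n t)\<^sup>2)"
  shows "solves F (sol f)"
proof -
  have f_meas [measurable]: "f n \<in> borel_measurable borel" and f0: "t \<notin> {0<..<T} \<Longrightarrow> f n t = 0"
    and F_eq: "AE t\<in>{0<..<T} in lborel. coef (F t) n = f n t" for n t
    using F by (auto simp: is_coeffs_def elim: eventually_mono)
  have w_meas [measurable]: "sol_coeff f n \<in> borel_measurable borel" for n
    unfolding sol_coeff_def by measurable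
  have w0: "t \<notin> {0<..<T} \<Longrightarrow> sol_coeff f n t = 0" for n t
    by (auto simp: sol_coeff_def trunc_def)
  have w_int: "integrable lborel (sol_coeff f n)" for n
    using integrable_mult_indicator[of "{0<..<T}" lborel "conv (R n) (f n)"] integrable_conv[OF integrable_R f]
    by (simp add: sol_coeff_def trunc_def[abs_def])
  have w_eq: "AE t\<in>{0<..<T} in lborel. coef (sol f t) n = sol_coeff f n t" for n
    using sm by eventually_elim (simp add: sol_def vec_inner)
  have eq: "AE t\<in>{0<..<T} in lborel.
      (\<Sum>j=1..m. q j / Gamma (1 - \<alpha> j) * (LINT s|lebesgue_on {0<..<t}. (t - s) powr (- \<alpha> j) * coef (sol f s) n))
      + l n * (LINT s|lebesgue_on {0<..<t}. coef (sol f s) n) = (LINT s|lebesgue_on {0<..<t}. coef (F s) n)" for n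
  proof -
    have f_off: "t \<le> 0 \<Longrightarrow> f n t = 0" for t by (rule f0) simp
    have "AE t\<in>{0<..<T} in lborel. conv (memory n) (conv (R n) (f n)) t = (LBINT s. indicator {0<..<t} s * f n s)"
      by (rule volterra_solution[OF integrable_memory memory_off integrable_R R_nonpos R_resolvent f f_off])
    moreover have "AE t\<in>{0<..<T} in lborel. (\<Sum>j=1..m. q j / Gamma (1 - \<alpha> j) * (LINT s|lebesgue_on {0<..<t}. (t - s) powr (- \<alpha> j) * coef (sol f s) n))
      + l n * (LINT s|lebesgue_on {0<..<t}. coef (sol f s) n) = conv (memory n) (sol_coeff f n) t"
      by (rule memory_eq_conv[OF w_eq w_int w0])
    ultimately show ?thesis
    proof eventually_elim
      case (elim t)
      show ?case
      proof
        assume t: "t \<in> {0<..<T}"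
        have "conv (memory n) (sol_coeff f n) t = conv (memory n) (conv (R n) (f n)) t"
          unfolding sol_coeff_def using t
          by (intro conv_trunc_right memory_off conv_zero_left R_nonpos f_off) auto
        then show "(\<Sum>j=1..m. q j / Gamma (1 - \<alpha> j) * (LINT s|lebesgue_on {0<..<t}. (t - s) powr (- \<alpha> j) * coef (sol f s) n))
            + l n * (LINT s|lebesgue_on {0<..<t}. coef (sol f s) n) = (LINT s|lebesgue_on {0<..<t}. coef (F s) n)"
          using elim t memory_term_eq_conv(2)[OF F_eq[of n] f_meas f0 t] by simp
      qed
    qed
  qed
  have int: "integrable (lebesgue_on {0<..<T}) (\<lambda>t. coef (sol f t) n)" for n
  proof -
    have "(\<lambda>t. indicator {0<..<T} t * sol_coeff f n t) = sol_coeff f n" using w0 by (auto split: split_indicator)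
    then show ?thesis using lebesgue_on_borel_representative(3)[OF _ w_meas w_eq, of n] w_int by simp
  qed
  show ?thesis using eq int by (simp add: is_solution_def AE_lebesgue_on_iff sol_def vec_L2)
qed

section \<open>Estimates of the solution\<close>

definition C\<^sub>1 :: real where
  "C\<^sub>1 = 2 * max 1 C\<^sub>0"

lemma C\<^sub>0_pos: "0 < C\<^sub>0" using weight_pos[of 1 0] m by (simp add: C\<^sub>0_def)

lemma C\<^sub>1_pos: "0 < C\<^sub>1" by (simp add: C\<^sub>1_def)

text \<open>
  \<open>l powr (1 - \<tau>) * R = (l * R) powr (1 - \<tau>) * R powr \<tau>\<close>; the first factor is bounded by the decay
  \<open>2 / t\<close> and the second one by the singularity \<open>t powr (\<alpha> 1 - 1)\<close>. The constant depends neither on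
  the mode nor on \<open>\<tau>\<close>.
\<close>

lemma R_interpolated:
  assumes \<tau>: "0 < \<tau>" "\<tau> \<le> 1"
  shows "l n powr (1 - \<tau>) * R n t \<le> C\<^sub>1 * power_singularity T (\<alpha> 1 * \<tau>) t"
proof (cases "t \<in> {0<..<T} \<and> 0 < R n t")
  case False
  then have "R n t = 0" using R_off[of t n] R_nonneg[of n t] by auto
  then show ?thesis using power_singularity_nonneg C\<^sub>1_pos by simp
next
  case True
  then have t: "t \<in> {0<..<T}" "0 < t" "t < T" and r: "0 < R n t" by auto
  have "l n powr (1 - \<tau>) * R n t = (l n * R n t) powr (1 - \<tau>) * R n t powr \<tau>"
    using r l_pos[of n] by (simp add: powr_mult powr_diff)
  also have "\<dots> \<le> (2 / t) powr (1 - \<tau>) * (C\<^sub>0 * t powr (\<alpha> 1 - 1)) powr \<tau>"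
  proof (intro mult_mono powr_mono2)
    show "l n * R n t \<le> 2 / t" using R_decay[OF t(1), of n] t by (simp add: field_simps)
    show "R n t \<le> C\<^sub>0 * t powr (\<alpha> 1 - 1)" by (rule R_singularity[OF t(1)])
  qed (use \<tau> r l_pos[of n] in auto)
  also have "\<dots> = (2 powr (1 - \<tau>) * C\<^sub>0 powr \<tau>) * (t powr - (1 - \<tau>) * t powr ((\<alpha> 1 - 1) * \<tau>))"
  proof -
    have "(2 / t) powr (1 - \<tau>) = 2 powr (1 - \<tau>) * t powr - (1 - \<tau>)"
      using t by (subst powr_divide) (auto simp only: powr_minus divide_inverse)
    then show ?thesis using t C\<^sub>0_pos by (simp add: powr_mult powr_powr)
  qed
  also have "t powr - (1 - \<tau>) * t powr ((\<alpha> 1 - 1) * \<tau>) = t powr (\<alpha> 1 * \<tau> - 1)"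
    by (simp add: algebra_simps flip: powr_add)
  also have "2 powr (1 - \<tau>) * C\<^sub>0 powr \<tau> \<le> C\<^sub>1"
  proof -
    have "(2::real) powr (1 - \<tau>) \<le> 2 powr 1" using \<tau> by (intro powr_mono) auto
    moreover have "C\<^sub>0 powr \<tau> \<le> max 1 C\<^sub>0"
    proof -
      have "C\<^sub>0 powr \<tau> \<le> max 1 C\<^sub>0 powr \<tau>" using C\<^sub>0_pos \<tau> by (intro powr_mono2) auto
      also have "\<dots> \<le> max 1 C\<^sub>0 powr 1" using \<tau> by (intro powr_mono) auto
      finally show ?thesis by simp
    qed
    ultimately show ?thesis unfolding C\<^sub>1_def by (intro mult_mono) auto
  qed
  finally show ?thesis using t by (simp add: power_singularity_def mult_right_mono)
qed

text \<open>
  Minkowski's inequality moves the norm of sequences under the integral, where the bound on the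
  resolvents, uniform in the mode, is taken out of the sum.
\<close>

lemma pointwise_estimate:
  assumes \<tau>: "0 < \<tau>" "\<tau> \<le> 1" and f [measurable]: "\<And>n. f n \<in> borel_measurable borel"
    and sm: "\<And>s. summable (\<lambda>n. (l n powr \<gamma> * f n s)\<^sup>2)" and t: "t \<in> {0<..<T}"
    and int: "integrable lborel (\<lambda>s. power_singularity T (\<alpha> 1 * \<tau>) (t - s) * sqrt (\<Sum>n. (l n powr \<gamma> * f n s)\<^sup>2))"
  shows "summable (\<lambda>n. (l n powr (\<gamma> + 1 - \<tau>) * sol_coeff f n t)\<^sup>2)"
    and "sqrt (\<Sum>n. (l n powr (\<gamma> + 1 - \<tau>) * sol_coeff f n t)\<^sup>2)
      \<le> C\<^sub>1 * conv (power_singularity T (\<alpha> 1 * \<tau>)) (\<lambda>s. sqrt (\<Sum>n. (l n powr \<gamma> * f n s)\<^sup>2)) t"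
proof -
  define \<omega> where "\<omega> s = C\<^sub>1 * power_singularity T (\<alpha> 1 * \<tau>) (t - s)" for s
  define b where "b n s = l n powr (\<gamma> + 1 - \<tau>) * (R n (t - s) * f n s)" for n s
  have coeff: "l n powr (\<gamma> + 1 - \<tau>) * sol_coeff f n t = (LBINT s. b n s)" for n
    using t by (simp add: sol_coeff_def conv_def b_def)
  have b_meas: "b n \<in> borel_measurable lborel" for n unfolding b_def[abs_def] by measurable
  have b_le: "\<bar>b n s\<bar> \<le> \<omega> s * \<bar>l n powr \<gamma> * f n s\<bar>" for n s
  proof -
    have "l n powr (\<gamma> + 1 - \<tau>) = l n powr (1 - \<tau>) * l n powr \<gamma>" by (simp add: algebra_simps flip: powr_add)
    then have "\<bar>b n s\<bar> = (l n powr (1 - \<tau>) * R n (t - s)) * \<bar>l n powr \<gamma> * f n s\<bar>"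
      by (simp add: b_def abs_mult R_nonneg mult_ac)
    also have "\<dots> \<le> \<omega> s * \<bar>l n powr \<gamma> * f n s\<bar>"
      unfolding \<omega>_def by (intro mult_right_mono R_interpolated \<tau>) auto
    finally show ?thesis .
  qed
  have \<omega>: "0 \<le> \<omega> s" for s using C\<^sub>1_pos by (simp add: \<omega>_def power_singularity_nonneg)
  have int': "integrable lborel (\<lambda>s. \<omega> s * sqrt (\<Sum>n. (l n powr \<gamma> * f n s)\<^sup>2))"
    unfolding \<omega>_def mult.assoc by (intro integrable_mult_right int)
  note mink = minkowski_l2[where h="\<lambda>n s. l n powr \<gamma> * f n s", OF b_meas b_le \<omega> sm int']
  show "summable (\<lambda>n. (l n powr (\<gamma> + 1 - \<tau>) * sol_coeff f n t)\<^sup>2)"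
    unfolding coeff by (rule mink(1))
  show "sqrt (\<Sum>n. (l n powr (\<gamma> + 1 - \<tau>) * sol_coeff f n t)\<^sup>2)
      \<le> C\<^sub>1 * conv (power_singularity T (\<alpha> 1 * \<tau>)) (\<lambda>s. sqrt (\<Sum>n. (l n powr \<gamma> * f n s)\<^sup>2)) t"
    unfolding coeff using mink(2) by (simp add: \<omega>_def conv_def mult.assoc)
qed

definition coeff_norm :: "real \<Rightarrow> (nat \<Rightarrow> real \<Rightarrow> real) \<Rightarrow> real \<Rightarrow> real" where
  "coeff_norm \<gamma> f t = sqrt (\<Sum>n. (l n powr \<gamma> * f n t)\<^sup>2)"

definition source :: "ennreal \<Rightarrow> real \<Rightarrow> (real \<Rightarrow> real^'d \<Rightarrow> real) \<Rightarrow> (nat \<Rightarrow> real \<Rightarrow> real) \<Rightarrow> bool" where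
  "source p \<gamma> F f \<longleftrightarrow> F \<in> Lp p \<gamma> \<and> is_coeffs T F f \<and>
    (\<forall>t. summable (\<lambda>n. (l n powr \<gamma> * f n t)\<^sup>2)) \<and>
    (AE t\<in>{0<..<T} in lborel. N \<gamma> (F t) = coeff_norm \<gamma> f t)"

lemma source_exists: assumes F: "F \<in> Lp p \<gamma>" shows "\<exists>f. source p \<gamma> F f"
proof -
  obtain f where "is_coeffs T F f" "\<And>t. summable (\<lambda>n. (l n powr \<gamma> * f n t)\<^sup>2)"
    "AE t\<in>{0<..<T} in lborel. N \<gamma> (F t) = sqrt (\<Sum>n. (l n powr \<gamma> * f n t)\<^sup>2)"
    by (rule Lp_frac_coefficients[OF F], rule that)
  then have "source p \<gamma> F f" using F by (simp add: source_def coeff_norm_def)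
  then show ?thesis by blast
qed

lemma integrable_interpolation_kernel: "0 < \<tau> \<Longrightarrow> integrable lborel (power_singularity T (\<alpha> 1 * \<tau>))"
  "0 < \<tau> \<Longrightarrow> (LBINT t. power_singularity T (\<alpha> 1 * \<tau>) t) = T powr (\<alpha> 1 * \<tau>) / (\<alpha> 1 * \<tau>)"
  using has_bochner_integral_power_singularity[of "\<alpha> 1 * \<tau>" T] \<alpha>_first T by (auto simp: has_bochner_integral_iff)

definition C\<^sub>2 :: real where
  "C\<^sub>2 = C\<^sub>1 * max 1 T / \<alpha> 1"

lemma C\<^sub>2_pos: "0 < C\<^sub>2" using C\<^sub>1_pos \<alpha>_first by (simp add: C\<^sub>2_def)

text \<open>
  The factor \<open>1 / \<tau>\<close> of the estimates comes from the mass of the interpolated kernel.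
\<close>

lemma singularity_mass_le:
  assumes \<tau>: "0 < \<tau>" "\<tau> \<le> 1" shows "C\<^sub>1 * (T powr (\<alpha> 1 * \<tau>) / (\<alpha> 1 * \<tau>)) \<le> C\<^sub>2 / \<tau>"
proof -
  have "\<alpha> 1 * \<tau> \<le> 1 * 1" using \<tau> \<alpha>_first by (intro mult_mono) auto
  have "T powr (\<alpha> 1 * \<tau>) \<le> max 1 T powr (\<alpha> 1 * \<tau>)" using T \<alpha>_first \<tau> by (intro powr_mono2) auto
  also have "\<dots> \<le> max 1 T powr 1" using \<open>\<alpha> 1 * \<tau> \<le> 1 * 1\<close> by (intro powr_mono) auto
  finally have "C\<^sub>1 * (T powr (\<alpha> 1 * \<tau>) / (\<alpha> 1 * \<tau>)) \<le> C\<^sub>1 * (max 1 T / (\<alpha> 1 * \<tau>))"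
    using C\<^sub>1_pos \<alpha>_first \<tau> by (intro mult_left_mono divide_right_mono) auto
  then show ?thesis by (simp add: C\<^sub>2_def)
qed

context
  fixes p \<gamma> F f assumes src: "source p \<gamma> F f" and p: "1 \<le> p" and \<gamma>: "0 \<le> \<gamma>"
begin

lemma source_summable: "summable (\<lambda>n. (l n powr \<gamma> * f n t)\<^sup>2)"
  and source_measurable: "f n \<in> borel_measurable borel"
  and source_off: "t \<notin> {0<..<T} \<Longrightarrow> f n t = 0"
  and source_Lp: "F \<in> Lp p \<gamma>"
  and source_coeffs: "is_coeffs T F f"
  and source_norm: "AE t\<in>{0<..<T} in lborel. N \<gamma> (F t) = coeff_norm \<gamma> f t"
  using src by (auto simp: source_def is_coeffs_def)

lemma coeff_norm_measurable [measurable]: "coeff_norm \<gamma> f \<in> borel_measurable borel"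
proof -
  note source_measurable[measurable]
  show ?thesis unfolding coeff_norm_def[abs_def] by measurable
qed

lemma coeff_norm_nonneg: "0 \<le> coeff_norm \<gamma> f t"
  using source_summable by (simp add: coeff_norm_def suminf_nonneg)

lemma coeff_norm_off: "t \<notin> {0<..<T} \<Longrightarrow> coeff_norm \<gamma> f t = 0"
  by (simp add: coeff_norm_def source_off)

lemma coeff_norm_powr:
  assumes "p \<noteq> \<infinity>"
  shows "integrable lborel (\<lambda>t. coeff_norm \<gamma> f t powr enn2real p)"
    and "LpN p \<gamma> F = (LBINT t. coeff_norm \<gamma> f t powr enn2real p) powr (1 / enn2real p)"
  using Lp_frac_norm_finite[OF p assms coeff_norm_measurable coeff_norm_off source_norm] source_Lp assms
  by (auto simp: Lp_frac_def bochner_Lp_def)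

lemma coeff_norm_bounded:
  assumes "p = \<infinity>"
  shows "0 \<le> LpN p \<gamma> F" "AE t in lborel. coeff_norm \<gamma> f t \<le> LpN p \<gamma> F"
proof -
  have ae: "AE t\<in>{0<..<T} in lborel. coeff_norm \<gamma> f t \<le> LpN p \<gamma> F"
    using Lp_frac_norm_infinite[OF source_Lp[unfolded assms] source_norm] assms by simp
  from AE_interval_ex[OF this T] show 0: "0 \<le> LpN p \<gamma> F"
    using coeff_norm_nonneg order_trans by blast
  show "AE t in lborel. coeff_norm \<gamma> f t \<le> LpN p \<gamma> F"
    using ae
  proof eventually_elim
    case (elim t)
    then show ?case using 0 coeff_norm_off[of t] by (cases "t \<in> {0<..<T}") auto
  qed
qed

lemma integrable_coeff_norm: "integrable lborel (coeff_norm \<gamma> f)"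
proof (cases "p = \<infinity>")
  case True
  show ?thesis
  proof (rule Bochner_Integration.integrable_bound)
    show "integrable lborel (\<lambda>t. indicator {0<..<T} t * LpN p \<gamma> F)"
      using T by simp
    show "AE t in lborel. norm (coeff_norm \<gamma> f t) \<le> norm (indicator {0<..<T} t * LpN p \<gamma> F)"
      using coeff_norm_bounded(2)[OF True]
    proof eventually_elim
      case (elim t)
      then show ?case using coeff_norm_bounded(1)[OF True] coeff_norm_off[of t] coeff_norm_nonneg[of t]
        by (cases "t \<in> {0<..<T}") auto
    qed
  qed simp
next
  case False
  have "integrable lborel (\<lambda>t. indicator {0<..<T} t * coeff_norm \<gamma> f t)"
  proof (rule weighted_power_mean(1)[OF enn2real_ge_1[OF p False]])
    have "(\<lambda>t. indicator {0<..<T} t * coeff_norm \<gamma> f t powr enn2real p) = (\<lambda>t. coeff_norm \<gamma> f t powr enn2real p)"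
      using coeff_norm_off by (auto split: split_indicator)
    then show "integrable lborel (\<lambda>t. indicator {0<..<T} t * coeff_norm \<gamma> f t powr enn2real p)"
      using coeff_norm_powr(1)[OF False] by simp
  qed (use T in \<open>auto simp: coeff_norm_nonneg\<close>)
  moreover have "(\<lambda>t. indicator {0<..<T} t * coeff_norm \<gamma> f t) = coeff_norm \<gamma> f"
    using coeff_norm_off by (auto split: split_indicator)
  ultimately show ?thesis by simp
qed

lemma source_le_coeff_norm: "l n powr \<gamma> * \<bar>f n t\<bar> \<le> coeff_norm \<gamma> f t"
proof -
  have "(l n powr \<gamma> * f n t)\<^sup>2 \<le> (\<Sum>n. (l n powr \<gamma> * f n t)\<^sup>2)"
    using sum_le_suminf[OF source_summable, of "{n}"] by simp
  then have "sqrt ((l n powr \<gamma> * f n t)\<^sup>2) \<le> coeff_norm \<gamma> f t"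
    unfolding coeff_norm_def by (rule real_sqrt_le_mono)
  then show ?thesis by (simp add: abs_mult)
qed

lemma source_integrable: "integrable lborel (f n)"
proof (rule Bochner_Integration.integrable_bound)
  show "integrable lborel (\<lambda>t. coeff_norm \<gamma> f t / l n powr \<gamma>)" using integrable_coeff_norm by simp
  show "AE t in lborel. norm (f n t) \<le> norm (coeff_norm \<gamma> f t / l n powr \<gamma>)"
    using source_le_coeff_norm[of n] l_pos[of n] coeff_norm_nonneg by (intro AE_I2) (simp add: pos_le_divide_eq mult.commute)
qed (use source_measurable in simp)

lemma AE_estimate:
  assumes \<tau>: "0 < \<tau>" "\<tau> \<le> 1"
  shows "AE t\<in>{0<..<T} in lborel.
    summable (\<lambda>n. (l n powr (\<gamma> + 1 - \<tau>) * sol_coeff f n t)\<^sup>2) \<and>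
    sqrt (\<Sum>n. (l n powr (\<gamma> + 1 - \<tau>) * sol_coeff f n t)\<^sup>2) \<le> C\<^sub>1 * conv (power_singularity T (\<alpha> 1 * \<tau>)) (coeff_norm \<gamma> f) t"
  using AE_integrable_conv[OF integrable_interpolation_kernel(1)[OF \<tau>(1)] integrable_coeff_norm]
proof eventually_elim
  case (elim t)
  then show ?case
    using pointwise_estimate[OF \<tau> source_measurable source_summable, of t] by (simp add: coeff_norm_def[abs_def])
qed

lemma sol_coeff_measurable: "sol_coeff f n \<in> borel_measurable borel"
proof -
  note source_measurable[measurable]
  show ?thesis unfolding sol_coeff_def by measurable
qed

lemma solves_sol: "solves F (sol f)"
proof (rule sol_solves[OF source_coeffs source_integrable])
  show "AE t\<in>{0<..<T} in lborel. summable (\<lambda>n. (sol_coeff f n t)\<^sup>2)"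
    using AE_estimate[of 1] summable_unweighted[OF \<gamma>] by (auto elim!: eventually_mono)
qed

text \<open>
  The majorant in the pointwise estimate is a convolution with an integrable kernel. By Young's
  inequality, for \<open>p = \<infinity>\<close> by the trivial bound, the mass of the kernel bounds the operator.
\<close>

lemma Lp_estimate:
  assumes \<tau>: "0 < \<tau>" "\<tau> \<le> 1"
  shows "sol f \<in> Lp p (\<gamma> + 1 - \<tau>) \<and>
    LpN p (\<gamma> + 1 - \<tau>) (sol f) \<le> C\<^sub>2 / \<tau> * LpN p \<gamma> F"
proof -
  let ?b = "\<alpha> 1 * \<tau>" and ?g = "coeff_norm \<gamma> f"
  define A where "A = C\<^sub>1 * (T powr ?b / ?b)"
  define \<kappa> where "\<kappa> s = C\<^sub>1 * power_singularity T ?b s" for s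
  have A: "0 \<le> A" "A \<le> C\<^sub>2 / \<tau>"
    using singularity_mass_le[OF \<tau>] C\<^sub>1_pos \<alpha>_first \<tau> by (auto simp: A_def)
  have b: "0 < ?b" using \<alpha>_first \<tau> by simp
  have \<gamma>': "0 \<le> \<gamma> + 1 - \<tau>" using \<gamma> \<tau> by simp
  have \<kappa>: "integrable lborel \<kappa>" "(LBINT s. \<kappa> s) = A" "\<And>s. 0 \<le> \<kappa> s"
    using integrable_interpolation_kernel[OF \<tau>(1)] C\<^sub>1_pos by (auto simp: \<kappa>_def[abs_def] A_def power_singularity_nonneg)
  have [measurable]: "\<kappa> \<in> borel_measurable borel" using \<kappa>(1) by auto
  have G_eq: "conv \<kappa> ?g t = C\<^sub>1 * conv (power_singularity T ?b) ?g t" for t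
    by (simp add: conv_def \<kappa>_def mult.assoc)
  have le: "AE t\<in>{0<..<T} in lborel. summable (\<lambda>n. (l n powr (\<gamma> + 1 - \<tau>) * sol_coeff f n t)\<^sup>2) \<and>
      sqrt (\<Sum>n. (l n powr (\<gamma> + 1 - \<tau>) * sol_coeff f n t)\<^sup>2) \<le> conv \<kappa> ?g t"
    unfolding G_eq by (rule AE_estimate[OF \<tau>])
  have G_meas: "conv \<kappa> ?g \<in> borel_measurable borel" by measurable
  note vec = Lp_frac_vec[OF sol_coeff_measurable \<gamma>' p G_meas le, folded sol_def]
  have goal: ?thesis if "sol f \<in> Lp p (\<gamma> + 1 - \<tau>)"
    "LpN p (\<gamma> + 1 - \<tau>) (sol f) \<le> A * LpN p \<gamma> F"
    "0 \<le> LpN p \<gamma> F"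
    using that(1,2) mult_right_mono[OF A(2) that(3)] by simp
  show ?thesis
  proof (cases "p = \<infinity>")
    case True
    let ?B = "LpN p \<gamma> F"
    have "conv \<kappa> ?g t \<le> A * ?B" if t: "t \<in> {0<..<T}" for t
    proof -
      have "conv (power_singularity T ?b) ?g t \<le> ?B * (t powr ?b / ?b)"
        using t by (intro conv_power_singularity_bounded(2) b coeff_norm_measurable coeff_norm_nonneg coeff_norm_off coeff_norm_bounded(2)[OF True]) auto
      also have "\<dots> \<le> ?B * (T powr ?b / ?b)"
        using t b coeff_norm_bounded(1)[OF True] by (intro mult_left_mono divide_right_mono powr_mono2) auto
      finally have "C\<^sub>1 * conv (power_singularity T ?b) ?g t \<le> C\<^sub>1 * (?B * (T powr ?b / ?b))"
        using C\<^sub>1_pos by (intro mult_left_mono) auto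
      then show ?thesis unfolding G_eq A_def by (simp add: mult_ac)
    qed
    then have "AE t\<in>{0<..<T} in lborel. conv \<kappa> ?g t \<le> A * ?B" by simp
    then show ?thesis
      using vec(2)[OF True mult_nonneg_nonneg[OF A(1) coeff_norm_bounded(1)[OF True]]] goal coeff_norm_bounded(1)[OF True]
      by blast
  next
    case False
    let ?P = "enn2real p"
    have P: "1 \<le> ?P" by (rule enn2real_ge_1[OF p False])
    note Y = young_convolution[OF P \<kappa>(1,3) coeff_norm_measurable coeff_norm_nonneg coeff_norm_powr(1)[OF False]]
    have I0: "0 \<le> (LBINT t. ?g t powr ?P)" by (intro integral_nonneg_AE) auto
    have "(LBINT t. conv \<kappa> ?g t powr ?P) powr (1 / ?P) \<le> (A powr ?P * (LBINT t. ?g t powr ?P)) powr (1 / ?P)"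
      using Y(3) P unfolding \<kappa>(2) by (intro powr_mono2 integral_nonneg_AE) auto
    also have "\<dots> = A * LpN p \<gamma> F"
      using A(1) I0 P by (simp add: coeff_norm_powr(2)[OF False] powr_mult powr_powr)
    finally show ?thesis
      using vec(1)[OF False Y(2)] by (intro goal) (auto simp: coeff_norm_powr(2)[OF False])
  qed
qed

text \<open>
  For \<open>p = 2\<close> the norms in time and in the modes are both square sums and can be exchanged. So
  Young's inequality may be applied in each mode, to the kernel \<open>l n * R n\<close> of mass at most \<open>1\<close>,
  without any loss in \<open>\<tau>\<close>.
\<close>

lemma L2_estimate:
  assumes p2: "p = 2"
  shows "sol f \<in> Lp 2 (\<gamma> + 1) \<and>
    LpN 2 (\<gamma> + 1) (sol f) \<le> LpN 2 \<gamma> F"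
proof -
  let ?g = "coeff_norm \<gamma> f"
  note source_measurable[measurable] sol_coeff_measurable[measurable]
  have fin: "p \<noteq> \<infinity>" using p2 by simp
  have g2: "integrable lborel (\<lambda>t. (?g t)\<^sup>2)"
    using coeff_norm_powr(1)[OF fin] coeff_norm_nonneg by (simp add: p2 powr_numeral)
  have mode_bound: "(\<integral>\<^sup>+t. ennreal ((l n powr (\<gamma> + 1) * sol_coeff f n t)\<^sup>2) \<partial>lborel)
      \<le> (\<integral>\<^sup>+t. ennreal ((l n powr \<gamma> * f n t)\<^sup>2) \<partial>lborel)" for n
  proof -
    define h where "h t = \<bar>l n powr \<gamma> * f n t\<bar>" for t
    have [measurable]: "h \<in> borel_measurable borel" unfolding h_def[abs_def] by measurable
    define \<kappa> where "\<kappa> s = l n * R n s" for s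
    have \<kappa>: "integrable lborel \<kappa>" "(LBINT s. \<kappa> s) \<le> 1" "\<And>s. 0 \<le> \<kappa> s"
      using integrable_R integral_R R_nonneg l_pos[of n] by (auto simp: \<kappa>_def[abs_def])
    have h2: "integrable lborel (\<lambda>t. h t powr 2)"
    proof (rule Bochner_Integration.integrable_bound[OF g2])
      have "(h t)\<^sup>2 \<le> (?g t)\<^sup>2" for t
        using source_le_coeff_norm[of n t] by (intro power_mono) (auto simp: h_def abs_mult)
      then show "AE t in lborel. norm (h t powr 2) \<le> norm ((?g t)\<^sup>2)" by (simp add: h_def powr_numeral)
    qed measurable
    have h0: "0 \<le> h t" for t by (simp add: h_def)
    have "1 \<le> (2::real)" by simp
    note Y = young_convolution[OF this \<kappa>(1,3) _ h0 h2]
    have pw: "(l n powr (\<gamma> + 1) * sol_coeff f n t)\<^sup>2 \<le> conv \<kappa> h t powr 2" for t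
    proof -
      have "\<bar>l n powr (\<gamma> + 1) * sol_coeff f n t\<bar> \<le> conv \<kappa> h t"
      proof (cases "t \<in> {0<..<T}")
        case True
        then have "l n powr (\<gamma> + 1) * sol_coeff f n t = (LBINT s. \<kappa> (t - s) * (l n powr \<gamma> * f n s))"
          using l_pos[of n] by (simp add: sol_coeff_def conv_def \<kappa>_def powr_add mult_ac flip: Bochner_Integration.integral_mult_right_zero)
        also have "\<bar>\<dots>\<bar> \<le> (LBINT s. \<bar>\<kappa> (t - s) * (l n powr \<gamma> * f n s)\<bar>)"
          using integral_norm_bound[of lborel "\<lambda>s. \<kappa> (t - s) * (l n powr \<gamma> * f n s)"] by simp
        also have "\<dots> = conv \<kappa> h t" by (simp add: conv_def h_def abs_mult \<kappa>(3))
        finally show ?thesis .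
      next
        case False
        then have "sol_coeff f n t = 0" by (auto simp: sol_coeff_def trunc_def)
        then show ?thesis using \<kappa>(3) h0 by (simp add: conv_def)
      qed
      then have "(\<bar>l n powr (\<gamma> + 1) * sol_coeff f n t\<bar>)\<^sup>2 \<le> (conv \<kappa> h t)\<^sup>2" by (intro power_mono) auto
      moreover have "0 \<le> conv \<kappa> h t" using \<kappa>(3) h0 by (simp add: conv_def)
      ultimately show ?thesis by (simp add: powr_numeral)
    qed
    have "(\<integral>\<^sup>+t. ennreal ((l n powr (\<gamma> + 1) * sol_coeff f n t)\<^sup>2) \<partial>lborel) \<le> (\<integral>\<^sup>+t. ennreal (conv \<kappa> h t powr 2) \<partial>lborel)"
      by (intro nn_integral_mono ennreal_leI pw)
    also have "\<dots> = ennreal (LBINT t. conv \<kappa> h t powr 2)"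
      by (rule nn_integral_eq_integral) (use Y(2) in auto)
    also have "\<dots> \<le> ennreal (LBINT t. h t powr 2)"
    proof (rule ennreal_leI)
      have "(LBINT s. \<kappa> s) powr 2 \<le> 1 powr 2" using \<kappa> by (intro powr_mono2 integral_nonneg_AE) auto
      then have "(LBINT s. \<kappa> s) powr 2 * (LBINT t. h t powr 2) \<le> 1 * (LBINT t. h t powr 2)"
        by (intro mult_right_mono integral_nonneg_AE) auto
      then show "(LBINT t. conv \<kappa> h t powr 2) \<le> (LBINT t. h t powr 2)" using Y(3) by simp
    qed
    also have "\<dots> = (\<integral>\<^sup>+t. ennreal (h t powr 2) \<partial>lborel)"
      by (rule nn_integral_eq_integral[symmetric]) (use h2 in auto)
    also have "\<dots> = (\<integral>\<^sup>+t. ennreal ((l n powr \<gamma> * f n t)\<^sup>2) \<partial>lborel)"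
      by (simp add: h_def powr_numeral)
    finally show ?thesis .
  qed
  let ?W = "\<lambda>t. \<Sum>n. ennreal ((l n powr (\<gamma> + 1) * sol_coeff f n t)\<^sup>2)"
  have "(\<integral>\<^sup>+t. ?W t \<partial>lborel) = (\<Sum>n. \<integral>\<^sup>+t. ennreal ((l n powr (\<gamma> + 1) * sol_coeff f n t)\<^sup>2) \<partial>lborel)"
    by (rule nn_integral_suminf) measurable
  also have "\<dots> \<le> (\<Sum>n. \<integral>\<^sup>+t. ennreal ((l n powr \<gamma> * f n t)\<^sup>2) \<partial>lborel)"
    by (intro suminf_le mode_bound) auto
  also have "\<dots> = (\<integral>\<^sup>+t. (\<Sum>n. ennreal ((l n powr \<gamma> * f n t)\<^sup>2)) \<partial>lborel)"
    by (rule nn_integral_suminf[symmetric]) measurable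
  also have "\<dots> = (\<integral>\<^sup>+t. ennreal ((?g t)\<^sup>2) \<partial>lborel)"
    using source_summable by (simp add: suminf_ennreal2 coeff_norm_def suminf_nonneg)
  also have "\<dots> = ennreal (LBINT t. (?g t)\<^sup>2)"
    by (rule nn_integral_eq_integral[OF g2]) simp
  finally have W_le: "(\<integral>\<^sup>+t. ?W t \<partial>lborel) \<le> ennreal (LBINT t. (?g t)\<^sup>2)" .
  then have "(\<integral>\<^sup>+t. ?W t \<partial>lborel) \<noteq> \<infinity>" by (auto simp: top_unique)
  then have "AE t in lborel. ?W t \<noteq> \<infinity>" by (intro nn_integral_PInf_AE) measurable
  then have sm: "AE t in lborel. summable (\<lambda>n. (l n powr (\<gamma> + 1) * sol_coeff f n t)\<^sup>2)"
    by eventually_elim (auto intro: summable_suminf_not_top)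
  define G where "G = coeff_norm (\<gamma> + 1) (sol_coeff f)"
  have [measurable]: "G \<in> borel_measurable borel" unfolding G_def coeff_norm_def[abs_def] by measurable
  have le: "AE t\<in>{0<..<T} in lborel. summable (\<lambda>n. (l n powr (\<gamma> + 1) * sol_coeff f n t)\<^sup>2) \<and>
      sqrt (\<Sum>n. (l n powr (\<gamma> + 1) * sol_coeff f n t)\<^sup>2) \<le> G t"
    using sm by eventually_elim (simp add: G_def coeff_norm_def)
  have G2: "AE t in lborel. ennreal (G t powr 2) = ?W t"
    using sm by eventually_elim (simp add: G_def coeff_norm_def suminf_ennreal2 suminf_nonneg powr_numeral)
  have nn: "(\<integral>\<^sup>+t. ennreal (G t powr 2) \<partial>lborel) \<le> ennreal (LBINT t. (?g t)\<^sup>2)"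
    using W_le nn_integral_cong_AE[OF G2] by simp
  have G_int: "integrable lborel (\<lambda>t. G t powr 2)"
    by (rule integrableI_nonneg) (use nn in \<open>auto intro: le_less_trans\<close>)
  have "(LBINT t. G t powr 2) \<le> (LBINT t. (?g t)\<^sup>2)"
    using nn by (subst (asm) nn_integral_eq_integral[OF G_int]) (auto simp: ennreal_le_iff)
  then have "(LBINT t. G t powr 2) powr (1 / 2) \<le> LpN 2 \<gamma> F"
    using coeff_norm_powr(2)[OF fin] coeff_norm_nonneg by (auto simp: p2 powr_numeral intro!: powr_mono2 integral_nonneg_AE)
  moreover have "0 \<le> \<gamma> + 1" using \<gamma> by simp
  ultimately show ?thesis
    using Lp_frac_vec(1)[OF sol_coeff_measurable \<open>0 \<le> \<gamma> + 1\<close> p _ le] G_int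
    by (simp add: p2 sol_def[abs_def])
qed

text \<open>
  The pointwise estimate holds at every time at which the singular kernel can be paired with the
  norm of the source. Hoelder's inequality (for \<open>p = \<infinity>\<close>: boundedness) guarantees this at all times
  and bounds the result by a positive power of \<open>t\<close>.
\<close>

lemma initial_decay:
  assumes \<tau>: "0 < \<tau>" "\<tau> \<le> 1" and crit: "p = \<infinity> \<or> (1 < enn2real p \<and> 1 < \<alpha> 1 * \<tau> * enn2real p)"
  shows "\<forall>t\<in>{0<..<T}. sol f t \<in> D (\<gamma> + 1 - \<tau>)"
    and "((\<lambda>t. N (\<gamma> + 1 - \<tau>) (sol f t)) \<longlongrightarrow> 0) (at_right 0)"
proof -
  let ?b = "\<alpha> 1 * \<tau>" and ?g = "coeff_norm \<gamma> f"
  have b: "0 < ?b" using \<alpha>_first \<tau> by simp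
  have \<gamma>': "0 \<le> \<gamma> + 1 - \<tau>" using \<gamma> \<tau> by simp
  have "\<exists>E. (\<forall>t\<in>{0<..<T}. integrable lborel (\<lambda>s. power_singularity T ?b (t - s) * ?g s) \<and>
      conv (power_singularity T ?b) ?g t \<le> E t) \<and> (E \<longlongrightarrow> 0) (at_right 0)"
  proof (cases "p = \<infinity>")
    case True
    let ?B = "LpN p \<gamma> F"
    have "((\<lambda>t. ?B * (t powr ?b / ?b)) \<longlongrightarrow> 0) (at_right 0)"
      by (rule powr_at_0_tendsto[OF b])
    moreover have "integrable lborel (\<lambda>s. power_singularity T ?b (t - s) * ?g s) \<and>
      conv (power_singularity T ?b) ?g t \<le> ?B * (t powr ?b / ?b)" if "t \<in> {0<..<T}" for t
      using that by (intro conjI conv_power_singularity_bounded[where B="?B"] b coeff_norm_measurable coeff_norm_nonneg coeff_norm_off coeff_norm_bounded(2)[OF True]) auto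
    ultimately show ?thesis by (intro exI[of _ "\<lambda>t. ?B * (t powr ?b / ?b)"]) simp
  next
    case False
    let ?P = "enn2real p"
    have P: "1 < ?P" "1 < ?b * ?P" using crit False by auto
    define e where "e = (?b - 1) * (?P / (?P - 1)) + 1"
    let ?I = "\<integral>s. ?g s powr ?P \<partial>lborel"
    let ?E = "\<lambda>t. ((t powr e / e) powr (?P - 1) * ?I) powr (1 / ?P)"
    have holder: "0 < e \<and> integrable lborel (\<lambda>s. power_singularity T ?b (t - s) * ?g s) \<and>
      conv (power_singularity T ?b) ?g t \<le> ?E t" if "t \<in> {0<..<T}" for t
      unfolding e_def using that
      by (intro conjI conv_power_singularity_Lp[where p="?P"] P coeff_norm_measurable coeff_norm_nonneg coeff_norm_off coeff_norm_powr(1)[OF False]) auto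
    have e: "0 < e" using holder[of "T/2"] T by simp
    have "((\<lambda>t. t powr e / e) \<longlongrightarrow> 0) (at_right 0)"
      using powr_at_0_tendsto[OF e, of 1] by simp
    then have "((\<lambda>t. (t powr e / e) powr (?P - 1)) \<longlongrightarrow> 0 powr (?P - 1)) (at_right 0)"
      using P e by (intro tendsto_powr') (auto simp: eventually_at_filter)
    then have "((\<lambda>t. (t powr e / e) powr (?P - 1) * ?I) \<longlongrightarrow> 0 * ?I) (at_right 0)"
      by (intro tendsto_intros) simp
    then have "(?E \<longlongrightarrow> (0 * ?I) powr (1 / ?P)) (at_right 0)"
      using P by (intro tendsto_powr') (auto simp: eventually_at_filter intro!: mult_nonneg_nonneg integral_nonneg_AE)
    then show ?thesis using holder by (intro exI[of _ ?E]) auto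
  qed
  then obtain E where E: "\<And>t. t \<in> {0<..<T} \<Longrightarrow> integrable lborel (\<lambda>s. power_singularity T ?b (t - s) * ?g s)"
      "\<And>t. t \<in> {0<..<T} \<Longrightarrow> conv (power_singularity T ?b) ?g t \<le> E t" and E_lim: "(E \<longlongrightarrow> 0) (at_right 0)" by blast
  have est: "summable (\<lambda>n. (l n powr (\<gamma> + 1 - \<tau>) * sol_coeff f n t)\<^sup>2) \<and>
      sqrt (\<Sum>n. (l n powr (\<gamma> + 1 - \<tau>) * sol_coeff f n t)\<^sup>2) \<le> C\<^sub>1 * E t" if t: "t \<in> {0<..<T}" for t
  proof -
    have int: "integrable lborel (\<lambda>s. power_singularity T ?b (t - s) * sqrt (\<Sum>n. (l n powr \<gamma> * f n s)\<^sup>2))"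
      using E(1)[OF t] by (simp add: coeff_norm_def)
    have "C\<^sub>1 * conv (power_singularity T ?b) ?g t \<le> C\<^sub>1 * E t"
      using C\<^sub>1_pos by (intro mult_left_mono E(2)[OF t]) auto
    then show ?thesis
      using pointwise_estimate[OF \<tau> source_measurable source_summable t int] by (simp add: coeff_norm_def[abs_def])
  qed
  show "\<forall>t\<in>{0<..<T}. sol f t \<in> D (\<gamma> + 1 - \<tau>)"
    using est vec_frac(1)[OF \<gamma>'] by (simp add: sol_def)
  have N_bound: "0 \<le> N (\<gamma> + 1 - \<tau>) (sol f t) \<and> N (\<gamma> + 1 - \<tau>) (sol f t) \<le> C\<^sub>1 * E t" if "t \<in> {0<..<T}" for t
    using est[OF that] vec_frac(3)[OF \<gamma>'] by (simp add: sol_def suminf_nonneg)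
  have ev: "\<forall>\<^sub>F t in at_right 0. t \<in> {0<..<T}"
    using eventually_at_right_real[OF T] by simp
  show "((\<lambda>t. N (\<gamma> + 1 - \<tau>) (sol f t)) \<longlongrightarrow> 0) (at_right 0)"
  proof (rule tendsto_sandwich)
    show "\<forall>\<^sub>F t in at_right 0. 0 \<le> N (\<gamma> + 1 - \<tau>) (sol f t)"
      using ev by eventually_elim (use N_bound in blast)
    show "\<forall>\<^sub>F t in at_right 0. N (\<gamma> + 1 - \<tau>) (sol f t) \<le> C\<^sub>1 * E t"
      using ev by eventually_elim (use N_bound in blast)
    show "((\<lambda>t. C\<^sub>1 * E t) \<longlongrightarrow> 0) (at_right 0)"
      using tendsto_mult[OF tendsto_const[of C\<^sub>1] E_lim] by simp
  qed simp
qed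

end

end

section \<open>Well-posedness\<close>

text \<open>
  The threshold on \<open>\<tau>\<close>, stated with the conventions of extended arithmetic, in terms of real numbers.
\<close>

lemma critical_exponent:
  fixes a \<tau> :: real and p :: ennreal
  assumes a: "0 < a" "a < 1" and p: "1 \<le> p" and ap: "1 < ennreal a * p" and \<tau>: "1 / (ennreal a * p) < ennreal \<tau>"
  shows "0 < \<tau>" "p = \<infinity> \<or> (1 < enn2real p \<and> 1 < a * \<tau> * enn2real p)"
proof -
  have "0 < ennreal \<tau>" using \<tau> by (rule le_less_trans[rotated]) simp
  then show \<tau>0: "0 < \<tau>" by simp
  show "p = \<infinity> \<or> (1 < enn2real p \<and> 1 < a * \<tau> * enn2real p)"
  proof (cases "p = \<infinity>")
    case False
    then obtain P where P: "p = ennreal P" "0 \<le> P" by (cases p) auto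
    have "1 < ennreal (a * P)" using ap a P by (simp add: ennreal_mult)
    then have aP: "1 < a * P" by (simp add: ennreal_less_iff flip: ennreal_1)
    have "1 / (ennreal a * p) = ennreal (1 / (a * P))"
      using aP a P by (simp add: divide_ennreal flip: ennreal_mult ennreal_1)
    then have "1 / (a * P) < \<tau>" using \<tau> aP by (simp add: ennreal_less_iff)
    then have "1 < a * \<tau> * P" using aP by (simp add: pos_divide_less_eq mult_ac)
    moreover have "1 < P"
    proof -
      have "a * P \<le> 1 * P" using a P by (intro mult_right_mono) auto
      then show ?thesis using aP by simp
    qed
    ultimately show ?thesis using P by simp
  qed simp
qed

theorem theorem2p2:
  fixes \<Omega> :: "(real^'d::finite) set"
    and a :: "'d \<Rightarrow> 'd \<Rightarrow> real^'d \<Rightarrow> real" and c :: "real^'d \<Rightarrow> real"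
    and l :: "nat \<Rightarrow> real" and \<phi> :: "nat \<Rightarrow> real^'d \<Rightarrow> real"
    and T \<gamma> :: real and m :: nat and \<alpha> q :: "nat \<Rightarrow> real" and p :: ennreal
  assumes "smooth_bounded_domain \<Omega>"
    and "elliptic_coeffs \<Omega> a c"
    and "eigensystem \<Omega> a c l \<phi>"
    and "T > 0"
    and "m \<ge> 1"
    and "\<forall>j\<in>{1..m}. 0 < \<alpha> j \<and> \<alpha> j < 1"
    and "\<forall>i\<in>{1..m}. \<forall>j\<in>{1..m}. i < j \<longrightarrow> \<alpha> i > \<alpha> j"
    and "\<forall>j\<in>{1..m}. q j > 0"
    and "q 1 = 1"
    and "1 \<le> p"
    and "0 \<le> \<gamma>" and "\<gamma> \<le> 1"
  shows
    "(p = 2 \<longrightarrow>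
        (\<exists>C>0. \<forall>F\<in>Lp_frac \<Omega> l \<phi> 2 T \<gamma>. \<exists>u\<in>Lp_frac \<Omega> l \<phi> 2 T (\<gamma> + 1).
           is_solution \<Omega> l \<phi> m \<alpha> q T F u \<and>
           (\<forall>v\<in>Lp_frac \<Omega> l \<phi> 2 T (\<gamma> + 1). is_solution \<Omega> l \<phi> m \<alpha> q T F v \<longrightarrow> ae_eq \<Omega> T v u) \<and>
           Lp_frac_norm \<Omega> l \<phi> 2 T (\<gamma> + 1) u \<le> C * Lp_frac_norm \<Omega> l \<phi> 2 T \<gamma> F)) \<and>
     (p \<noteq> 2 \<longrightarrow>
        (\<exists>C>0. \<forall>F\<in>Lp_frac \<Omega> l \<phi> p T \<gamma>. \<exists>u. is_solution \<Omega> l \<phi> m \<alpha> q T F u \<and>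
           (\<forall>\<tau>\<in>{0<..1}.
              u \<in> Lp_frac \<Omega> l \<phi> p T (\<gamma> + 1 - \<tau>) \<and>
              (\<forall>v\<in>Lp_frac \<Omega> l \<phi> p T (\<gamma> + 1 - \<tau>).
                 is_solution \<Omega> l \<phi> m \<alpha> q T F v \<longrightarrow> ae_eq \<Omega> T v u) \<and>
              Lp_frac_norm \<Omega> l \<phi> p T (\<gamma> + 1 - \<tau>) u \<le> C / \<tau> * Lp_frac_norm \<Omega> l \<phi> p T \<gamma> F))) \<and>
     (ennreal (\<alpha> 1) * p > 1 \<longrightarrow>
        (\<forall>F\<in>Lp_frac \<Omega> l \<phi> p T \<gamma>. \<forall>u.
           is_solution \<Omega> l \<phi> m \<alpha> q T F u \<and>
           (if p = 2 then u \<in> Lp_frac \<Omega> l \<phi> p T (\<gamma> + 1)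
            else \<forall>\<tau>\<in>{0<..1}. u \<in> Lp_frac \<Omega> l \<phi> p T (\<gamma> + 1 - \<tau>)) \<longrightarrow>
           (\<exists>w. ae_eq \<Omega> T w u \<and>
              (\<forall>\<tau>. 1 / (ennreal (\<alpha> 1) * p) < ennreal \<tau> \<and> \<tau> \<le> 1 \<longrightarrow>
                 (\<forall>t\<in>{0<..<T}. w t \<in> frac_dom \<Omega> l \<phi> (\<gamma> + 1 - \<tau>)) \<and>
                 ((\<lambda>t. frac_norm \<Omega> l \<phi> (\<gamma> + 1 - \<tau>) (w t)) \<longlongrightarrow> 0) (at_right 0)))))"
proof -
  have \<Omega>: "open \<Omega>" "bounded \<Omega>" using assms(1) by (auto simp: smooth_bounded_domain_def)
  have eig: "0 < l 0" "incseq l" "L2_orthonormal_basis \<Omega> \<phi>" using assms(3) by (auto simp: eigensystem_def)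
  have \<alpha>: "0 < \<alpha> j \<and> \<alpha> j < 1" if "j \<in> {1..m}" for j using assms(6) that by blast
  have q: "0 < q j" if "j \<in> {1..m}" for j using assms(8) that by blast
  interpret multi_term_diffusion \<Omega> \<phi> l "l 0" T m \<alpha> q
  proof
    show "\<Omega> \<in> lmeasurable" by (rule lmeasurable_open[OF \<Omega>(2,1)])
    show "l 0 \<le> l n" for n using eig(2) by (simp add: incseq_def)
  qed (use eig assms(4,5) \<alpha> q in auto)
  note \<gamma> = \<open>0 \<le> \<gamma>\<close> and p = \<open>1 \<le> p\<close>
  show ?thesis
  proof (intro conjI impI, goal_cases)
    case p2: 1
    have "\<exists>u\<in>Lp 2 (\<gamma> + 1). solves F u \<and>
        (\<forall>v\<in>Lp 2 (\<gamma> + 1). solves F v \<longrightarrow> ae_eq \<Omega> T v u) \<and>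
        LpN 2 (\<gamma> + 1) u \<le> 1 * LpN 2 \<gamma> F"
      if F: "F \<in> Lp 2 \<gamma>" for F
    proof -
      obtain f where f: "source p \<gamma> F f" using source_exists F p2 by blast
      then show ?thesis
        using L2_estimate[OF f p \<gamma> p2] solves_sol[OF f p \<gamma>] solution_unique[of F "sol f"]
        by (intro bexI[of _ "sol f"]) auto
    qed
    then show ?case by (intro exI[of _ 1] conjI ballI zero_less_one)
  next
    case 2
    have "\<exists>u. solves F u \<and> (\<forall>\<tau>\<in>{0<..1}. u \<in> Lp p (\<gamma> + 1 - \<tau>) \<and>
        (\<forall>v\<in>Lp p (\<gamma> + 1 - \<tau>). solves F v \<longrightarrow> ae_eq \<Omega> T v u) \<and>
        LpN p (\<gamma> + 1 - \<tau>) u \<le> C\<^sub>2 / \<tau> * LpN p \<gamma> F)"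
      if F: "F \<in> Lp p \<gamma>" for F
    proof -
      obtain f where f: "source p \<gamma> F f" using source_exists F by blast
      then show ?thesis
        using Lp_estimate[OF f p \<gamma>] solves_sol[OF f p \<gamma>] solution_unique[of F "sol f"]
        by (intro exI[of _ "sol f"]) auto
    qed
    then show ?case by (intro exI[of _ C\<^sub>2] conjI ballI C\<^sub>2_pos)
  next
    case ap: 3
    show ?case
    proof (intro ballI allI impI, goal_cases)
      case (1 F u)
      then obtain f where f: "source p \<gamma> F f" and u: "solves F u" using source_exists by blast
      show ?case
      proof (intro exI[of _ "sol f"] conjI allI impI solution_unique[OF u solves_sol[OF f p \<gamma>]])
        fix \<tau> assume "1 / (ennreal (\<alpha> 1) * p) < ennreal \<tau> \<and> \<tau> \<le> 1"
        then have \<tau>: "0 < \<tau>" "\<tau> \<le> 1" "p = \<infinity> \<or> (1 < enn2real p \<and> 1 < \<alpha> 1 * \<tau> * enn2real p)"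
          using critical_exponent[OF \<alpha>_first p ap] by auto
        show "\<forall>t\<in>{0<..<T}. sol f t \<in> D (\<gamma> + 1 - \<tau>)" "((\<lambda>t. N (\<gamma> + 1 - \<tau>) (sol f t)) \<longlongrightarrow> 0) (at_right 0)"
          using initial_decay[OF f p \<gamma> \<tau>] by auto
      qed
    qed
  qed
qed

end
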